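(* Let $\alpha\in\mathbb{R}\setminus\mathbb{Q}$, $\omega=(1,\alpha)$, let $\mathcal{A}\subset\mathbb{R}$ be open, let $g:\mathcal{A}\to\mathbb{R}$ be real analytic, and let $f:\mathbb{T}^2\to\mathbb{R}$ be real analytic, with an analytic extension to the strip $\Sigma_\xi$ for some $\xi>0$. Let $f_0$ be the average (zeroth Fourier coefficient) of $f$, and assume that there is $c\in\mathcal{A}$ which is a zero of odd order $\mathfrak{n}>1$ of the function $x\mapsto g(x)-f_0$. Consider the ordinary differential equation $$\varepsilon\ddot x+\dot x+\varepsilon g(x)=\varepsilon f(\omega t). \qquad ( * )$$ Let $p_n/q_n$ be the convergents of $\alpha$ and let $$C_0=\frac{\mathfrak{n}+1}{4(\mathfrak{n}^2+2\mathfrak{n}-1)}\,\xi .$$ Then there exists a constant $\eta_0>0$ such that, setting $a_0=\eta_0^{1/(\mathfrak{n}+1)}$ and $b_0=\eta_0^{1/(\mathfrak{n}(\mathfrak{n}+1))}$, the following holds. Let $N\in\mathbb{N}$ be such that $$e^{-C_0x}\le\frac{a_0}{x^{\mathfrak{n}}}\qquad\text{for all real }x\ge q_N .$$ If the convergents of $\alpha$ satisfy $$q_{n+1}\le b_0\,e^{(C_0/\mathfrak{n})q_n}\qquad\text{for all }n\ge N,$$ then for all $0<\varepsilon<a_0q_N^{-\mathfrak{n}}$ there is at least one quasi-periodic solution $x(t,\varepsilon)=c+X(\omega t,\varepsilon)$ to $( * )$, such that $X(\psi,\varepsilon)$ is analytic in $\psi$ in the strip $\Sigma_{\xi'}$ for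 every $0<\xi'<\xi/4$, is continuous in $\varepsilon$, and goes to zero as $\varepsilon\to0$.
   Context: $\mathbb{T}=\mathbb{R}/2\pi\mathbb{Z}$. For $\xi>0$, $\Sigma_\xi=\{\psi=(\psi_1,\psi_2)\in\mathbb{C}^2:\ \mathrm{Re}\,\psi_i\in\mathbb{T},\ |\mathrm{Im}\,\psi_i|\le\xi,\ i=1,2\}$. A point $c$ is a zero of order $\mathfrak{n}$ of $g(x)-f_0$ if $g(c)=f_0$, $g^{(j)}(c)=0$ for $j=1,\dots,\mathfrak{n}-1$, and $g^{(\mathfrak{n})}(c)\ne0$. The convergents $p_n/q_n$ of $\alpha$ are those of its simple continued fraction $[a_0,a_1,a_2,\dots]$ (these partial quotients are unrelated to the constant $a_0$ of the claim): $q_0=1$, $q_1=a_1$, $q_k=a_kq_{k-1}+q_{k-2}$ for $k\ge2$, and $p_k/q_k=[a_0,\dots,a_k]$. *)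

theory Defs
  imports "HOL-Analysis.Analysis"
begin

text \<open>Complete quotients and partial quotients of the simple continued fraction of an irrational
  number, and the denominators of its convergents.\<close>

fun cf_complete :: "real \<Rightarrow> nat \<Rightarrow> real" where
  "cf_complete \<alpha> 0 = \<alpha>"
| "cf_complete \<alpha> (Suc k) = 1 / frac (cf_complete \<alpha> k)"

definition cf_coeff :: "real \<Rightarrow> nat \<Rightarrow> int" where
  "cf_coeff \<alpha> k = \<lfloor>cf_complete \<alpha> k\<rfloor>"

fun cf_denom :: "real \<Rightarrow> nat \<Rightarrow> int" where
  "cf_denom \<alpha> 0 = 1"
| "cf_denom \<alpha> (Suc 0) = cf_coeff \<alpha> 1"
| "cf_denom \<alpha> (Suc (Suc k)) =
     cf_coeff \<alpha> (Suc (Suc k)) * cf_denom \<alpha> (Suc k) + cf_denom \<alpha> k"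

definition real_analytic_on :: "(real \<Rightarrow> real) \<Rightarrow> real set \<Rightarrow> bool" where
  "real_analytic_on g A \<longleftrightarrow> (\<forall>x\<in>A. \<exists>G. (\<lambda>h. g (x + h)) has_fps_expansion G)"

text \<open>Analyticity in two variables: near every point of \<open>S\<close> (on a full polydisc, which need not
  be contained in \<open>S\<close>) the function is the sum of a double power series. Used over both
  the real and the complex field.\<close>

definition analytic2_on :: "('a::real_normed_field \<times> 'a \<Rightarrow> 'a) \<Rightarrow> ('a \<times> 'a) set \<Rightarrow> bool" where
  "analytic2_on F S \<longleftrightarrow>
     (\<forall>(a, b)\<in>S. \<exists>r>0. \<exists>C :: nat \<Rightarrow> nat \<Rightarrow> 'a. \<forall>u v. norm (u - a) < r \<longrightarrow> norm (v - b) < r \<longrightarrow>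
        ((\<lambda>(j, k). C j k * (u - a) ^ j * (v - b) ^ k) has_sum F (u, v)) UNIV)"

text \<open>Functions on the torus, or on a complex strip around it, are represented by their lifts,
  which are \<open>2\<pi>\<close>-periodic in each variable; accordingly the strip is the lifted one, with
  unrestricted real parts.\<close>

definition torus_strip :: "real \<Rightarrow> (complex \<times> complex) set" where
  "torus_strip \<xi> = {\<psi>. \<bar>Im (fst \<psi>)\<bar> \<le> \<xi> \<and> \<bar>Im (snd \<psi>)\<bar> \<le> \<xi>}"

definition periodic2_on :: "('a::real_algebra_1 \<times> 'a \<Rightarrow> 'b) \<Rightarrow> ('a \<times> 'a) set \<Rightarrow> bool" where
  "periodic2_on F S \<longleftrightarrow>
     (\<forall>(u, v)\<in>S. F (u + of_real (2 * pi), v) = F (u, v) \<and> F (u, v + of_real (2 * pi)) = F (u, v))"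

definition torus_mean :: "(real \<times> real \<Rightarrow> real) \<Rightarrow> real" where
  "torus_mean f = integral ({0..2 * pi} \<times> {0..2 * pi}) f / (2 * pi)\<^sup>2"

definition zero_of_order :: "(real \<Rightarrow> real) \<Rightarrow> real \<Rightarrow> real \<Rightarrow> nat \<Rightarrow> bool" where
  "zero_of_order g y c n \<longleftrightarrow>
     g c = y \<and> (\<forall>j\<in>{1..<n}. (deriv ^^ j) g c = 0) \<and> (deriv ^^ n) g c \<noteq> 0"

text \<open>A global solution of \<open>\<epsilon> x'' + x' + \<epsilon> g(x) = \<epsilon> f(\<omega>t)\<close>, \<open>\<omega> = (1, \<alpha>)\<close>; it has to stay in the
  domain \<open>A\<close> of \<open>g\<close>.\<close>

definition is_solution ::
  "real \<Rightarrow> real \<Rightarrow> real set \<Rightarrow> (real \<Rightarrow> real) \<Rightarrow> (real \<times> real \<Rightarrow> real) \<Rightarrow> (real \<Rightarrow> real) \<Rightarrow> bool" where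
  "is_solution \<epsilon> \<alpha> A g f x \<longleftrightarrow>
     (\<exists>x' x''. \<forall>t. x t \<in> A \<and>
        (x has_real_derivative x' t) (at t) \<and> (x' has_real_derivative x'' t) (at t) \<and>
        \<epsilon> * x'' t + x' t + \<epsilon> * g (x t) = \<epsilon> * f (t, \<alpha> * t))"

end

theory Submission
  imports Defs "HOL-Complex_Analysis.Complex_Analysis"
begin

text \<open>
  The arithmetic hypothesis only enters through the bound \<open>\<bar>j + \<alpha> k\<bar> \<ge> exp (- \<sigma> (\<bar>j\<bar> + \<bar>k\<bar>)) / K\<close> with
  \<open>\<sigma> = C0 / n\<close>: the inverse \<open>\<partial>\<inverse>\<close> of \<open>\<partial> = \<omega> \<cdot> \<nabla>\<close> costs a width \<open>\<sigma>\<close> of the strip, and the proof affords it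
  twice. Put \<open>X = \<epsilon> Y\<close> and let \<open>P = (1 + \<epsilon> \<partial>)\<inverse>\<close>, a Fourier multiplier of norm at most 1. The equation
  becomes \<open>\<partial> Y + \<epsilon>\<^sup>n P \<Gamma>(Y) = P (f - f0)\<close>, where \<open>\<Gamma>(Y) = \<gamma> Y\<^sup>n + O(\<epsilon>)\<close>.

  At leading order \<open>Y\<close> is \<open>W = \<partial>\<inverse> (f - f0) + z\<close>, with the real constant \<open>z\<close> fixed by
  \<open>\<langle>W\<^sup>n\<rangle> = 0\<close>, which is solvable because \<open>n\<close> is odd. The linearised operator is
  \<open>\<partial> + \<epsilon>\<^sup>n P a\<close> with \<open>a = n \<gamma> W\<^sup>n\<^sup>-\<^sup>1\<close>. Its mean \<open>\<langle>a\<rangle>\<close> does not vanish as \<open>n - 1\<close> is even, and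
  the substitution \<open>v = v' - \<epsilon>\<^sup>n P (p1 + b v')\<close>, \<open>b = \<partial>\<inverse> (a - \<langle>a\<rangle>)\<close>, \<open>p1 = \<partial>\<inverse> (\<gamma> W\<^sup>n)\<close>, replaces \<open>a\<close> by
  its mean. The operator \<open>\<partial> + \<epsilon>\<^sup>n \<langle>a\<rangle> P\<close> is diagonal and has no small divisors: with
  \<open>S = \<epsilon>\<^sup>n (\<partial> + \<epsilon>\<^sup>n \<langle>a\<rangle> P)\<inverse>\<close> both \<open>S\<close> and \<open>E = \<epsilon>\<^sup>-\<^sup>n \<partial> S\<close> are bounded uniformly in \<open>\<epsilon>\<close>. Writing
  \<open>v' = S \<rho>\<close> gives a fixed point equation for \<open>\<rho>\<close> that is a contraction for small \<open>\<epsilon>\<close>.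

  The contraction takes place in the unweighted algebra of absolutely convergent Fourier series. The
  width of the strip is obtained by solving the same equation for the data translated by each of the
  four corners \<open>i (\<plusminus>\<xi>/4, \<plusminus>\<xi>/4)\<close>; the Picard iterates of the translated problems are the translates of
  the original ones, and so are the limits.
\<close>

text \<open>The obstacle is that the zero is degenerate: as \<open>n > 1\<close>, the linearisation
  of \<open>g\<close> at \<open>c\<close> vanishes and gives no restoring force. The forcing itself
  produces one, the mean of \<open>a\<close>, but only of size \<epsilon>^n. Hence S, normalised by
  \<epsilon>^n, is bounded but not small. The oscillating part of \<open>a\<close> has the same size
  as its mean, and so has \<gamma> W^n; neither can be treated as a perturbation, which is why both
  are removed by primitives, \<open>b\<close> and \<open>p1\<close>, before iterating. A scheme that
  used the inverse of the derivative in every iteration would lose strip width every time; here it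
  acts only on the data, at most twice in succession. If \<open>f\<close> is constant there is no
  oscillation, W = 0 and the mean of \<open>a\<close> is 0; then the constant \<open>c\<close> is
  itself the solution and is treated separately. Translating the data takes the place of a weighted
  norm because such a norm would depend on the width, a term, whereas the norm of a type class
  instance is fixed by the type.\<close>

no_notation Infinite_Set_Sum.abs_summable_on (infix "abs'_summable'_on" 50)

section \<open>Continued fractions and small divisors\<close>

lemma one_lt_inverse_frac:
  assumes "(x :: real) \<notin> \<rat>"
  shows "1 / frac x \<notin> \<rat>" "1 / frac x > 1" "frac x > 0"
proof -
  have i: "x \<notin> \<int>" using assms Ints_subset_Rats by blast
  then show f: "frac x > 0" by (simp add: frac_gt_0_iff)
  then show "1 / frac x > 1" using frac_lt_1[of x] by (simp add: field_simps)
  show "1 / frac x \<notin> \<rat>"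
  proof
    assume "1 / frac x \<in> \<rat>"
    then have "1 / (1 / frac x) \<in> \<rat>" by (rule Rats_divide[OF Rats_1])
    then have "frac x \<in> \<rat>" by simp
    then have "frac x + of_int \<lfloor>x\<rfloor> \<in> \<rat>" by (rule Rats_add) simp
    then show False using assms by (simp add: frac_def)
  qed
qed

fun cf_numer :: "real \<Rightarrow> nat \<Rightarrow> int" where
  "cf_numer \<alpha> 0 = cf_coeff \<alpha> 0"
| "cf_numer \<alpha> (Suc 0) = cf_coeff \<alpha> 1 * cf_coeff \<alpha> 0 + 1"
| "cf_numer \<alpha> (Suc (Suc k)) =
     cf_coeff \<alpha> (Suc (Suc k)) * cf_numer \<alpha> (Suc k) + cf_numer \<alpha> k"

definition cf_error :: "real \<Rightarrow> nat \<Rightarrow> real" where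
  "cf_error \<alpha> k = of_int (cf_denom \<alpha> k) * \<alpha> - of_int (cf_numer \<alpha> k)"

lemma cf_det:
  "cf_denom \<alpha> (Suc k) * cf_numer \<alpha> k - cf_numer \<alpha> (Suc k) * cf_denom \<alpha> k = (- 1) ^ Suc k"
proof (induction k)
  case (Suc k)
  then show ?case by (simp add: algebra_simps)
qed simp

context
  fixes \<alpha> :: real
  assumes irr: "\<alpha> \<notin> \<rat>"
begin

lemma cf_complete_irrational: "cf_complete \<alpha> k \<notin> \<rat>"
  by (induction k) (use irr one_lt_inverse_frac in auto)

lemma cf_complete_gt_1: "cf_complete \<alpha> (Suc k) > 1"
  using one_lt_inverse_frac(2)[OF cf_complete_irrational] by simp

lemma cf_coeff_pos: "cf_coeff \<alpha> (Suc k) \<ge> 1"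
  unfolding cf_coeff_def using less_imp_le[OF cf_complete_gt_1[of k]] by (simp add: le_floor_iff)


lemma cf_denom_ge_1: "cf_denom \<alpha> k \<ge> 1 \<and> cf_denom \<alpha> (Suc k) \<ge> cf_denom \<alpha> k"
proof (induction k)
  case 0
  then show ?case using cf_coeff_pos[of 0] by simp
next
  case (Suc k)
  have "1 * cf_denom \<alpha> (Suc k) \<le> cf_coeff \<alpha> (Suc (Suc k)) * cf_denom \<alpha> (Suc k)"
    by (rule mult_right_mono[OF cf_coeff_pos]) (use Suc in auto)
  moreover have "cf_denom \<alpha> (Suc (Suc k)) = cf_coeff \<alpha> (Suc (Suc k)) * cf_denom \<alpha> (Suc k) + cf_denom \<alpha> k"
    by simp
  ultimately show ?case using Suc by linarith
qed

text \<open>The index starts at 1 because the first partial quotient may be 1, in which case the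
  denominators of index 0 and 1 coincide. The shift reappears in
  \<open>cf_denom_ge_index\<close>.\<close>

lemma cf_denom_strict: "cf_denom \<alpha> (Suc k) < cf_denom \<alpha> (Suc (Suc k))"
proof -
  have "1 * cf_denom \<alpha> (Suc k) \<le> cf_coeff \<alpha> (Suc (Suc k)) * cf_denom \<alpha> (Suc k)"
    by (rule mult_right_mono[OF cf_coeff_pos]) (use cf_denom_ge_1[of "Suc k"] in auto)
  moreover have "cf_denom \<alpha> (Suc (Suc k)) = cf_coeff \<alpha> (Suc (Suc k)) * cf_denom \<alpha> (Suc k) + cf_denom \<alpha> k"
    by simp
  ultimately show ?thesis using cf_denom_ge_1[of k] by linarith
qed

lemma cf_denom_ge_index: "cf_denom \<alpha> (Suc k) \<ge> int k"
proof (induction k)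
  case 0
  then show ?case using cf_denom_ge_1[of "Suc 0"] by linarith
next
  case (Suc k)
  then show ?case using cf_denom_strict[of k] by linarith
qed

text \<open>This is the identity expressing \<alpha> through a complete quotient and two consecutive
  convergents, cleared of denominators. Since complete quotients of positive index exceed 1, the
  errors alternate in sign and do not grow.\<close>

lemma cf_error_rec: "cf_complete \<alpha> (Suc (Suc k)) * cf_error \<alpha> (Suc k) + cf_error \<alpha> k = 0"
proof (induction k)
  case 0
  have f: "frac (cf_complete \<alpha> 0) > 0" "frac (cf_complete \<alpha> (Suc 0)) > 0"
    by (rule one_lt_inverse_frac(3)[OF cf_complete_irrational])+
  have "frac (cf_complete \<alpha> (Suc 0)) = 1 / frac \<alpha> - cf_coeff \<alpha> 1"
    by (simp add: frac_def cf_coeff_def)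
  moreover have "cf_error \<alpha> 0 = frac \<alpha>"
    by (simp add: cf_error_def cf_coeff_def frac_def)
  moreover have "cf_error \<alpha> 1 = cf_coeff \<alpha> 1 * frac \<alpha> - 1"
    by (simp add: cf_error_def cf_coeff_def[of _ 0] frac_def algebra_simps)
  ultimately have "cf_error \<alpha> 1 = - frac (cf_complete \<alpha> (Suc 0)) * cf_error \<alpha> 0"
    using f by (simp add: field_simps)
  then show ?case using f by (simp add: field_simps)
next
  case (Suc k)
  have f: "frac (cf_complete \<alpha> (Suc (Suc k))) > 0"
    by (rule one_lt_inverse_frac(3)[OF cf_complete_irrational])
  have "cf_error \<alpha> (Suc (Suc k)) = cf_coeff \<alpha> (Suc (Suc k)) * cf_error \<alpha> (Suc k) + cf_error \<alpha> k"
    by (simp add: cf_error_def algebra_simps)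
  also have "\<dots> = - frac (cf_complete \<alpha> (Suc (Suc k))) * cf_error \<alpha> (Suc k)"
    using Suc by (simp add: frac_def cf_coeff_def algebra_simps del: cf_complete.simps)
  finally show ?case using f
    by (simp add: cf_complete.simps(2)[of _ "Suc (Suc k)"] field_simps del: cf_complete.simps)
qed

lemma cf_error_props:
  shows "cf_error \<alpha> k * cf_error \<alpha> (Suc k) \<le> 0" "\<bar>cf_error \<alpha> (Suc k)\<bar> \<le> \<bar>cf_error \<alpha> k\<bar>"
proof -
  have e: "cf_error \<alpha> k = - cf_complete \<alpha> (Suc (Suc k)) * cf_error \<alpha> (Suc k)"
    using cf_error_rec[of k] by linarith
  note gt = cf_complete_gt_1[of "Suc k"]
  show "cf_error \<alpha> k * cf_error \<alpha> (Suc k) \<le> 0"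
    unfolding e using gt by (simp add: mult.assoc del: cf_complete.simps)
  have "1 * \<bar>cf_error \<alpha> (Suc k)\<bar> \<le> cf_complete \<alpha> (Suc (Suc k)) * \<bar>cf_error \<alpha> (Suc k)\<bar>"
    by (rule mult_right_mono) (use gt in auto)
  then show "\<bar>cf_error \<alpha> (Suc k)\<bar> \<le> \<bar>cf_error \<alpha> k\<bar>"
    unfolding e using gt by (simp add: abs_mult del: cf_complete.simps)
qed

text \<open>By the determinant identity, two consecutive errors combined with each other's
  denominators give 1 or -1. The later error and the earlier denominator are the smaller ones, so
  twice \<open>cf_denom \<alpha> (Suc k) * \<bar>cf_error \<alpha> k\<bar>\<close> is at least
  1.\<close>

lemma cf_error_lower: "\<bar>cf_error \<alpha> k\<bar> \<ge> 1 / (2 * cf_denom \<alpha> (Suc k))"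
proof -
  let ?q = "real_of_int (cf_denom \<alpha> (Suc k))" and ?q' = "real_of_int (cf_denom \<alpha> k)"
  have q: "?q' \<ge> 1" "?q \<ge> ?q'"
    using cf_denom_ge_1[of k] by auto
  have "?q * cf_error \<alpha> k - ?q' * cf_error \<alpha> (Suc k)
      = - of_int (cf_denom \<alpha> (Suc k) * cf_numer \<alpha> k - cf_numer \<alpha> (Suc k) * cf_denom \<alpha> k)"
    by (simp add: cf_error_def algebra_simps)
  also have "\<bar>\<dots>\<bar> = 1" unfolding cf_det by simp
  finally have "1 = \<bar>?q * cf_error \<alpha> k - ?q' * cf_error \<alpha> (Suc k)\<bar>" by simp
  also have "\<dots> \<le> ?q * \<bar>cf_error \<alpha> k\<bar> + ?q' * \<bar>cf_error \<alpha> (Suc k)\<bar>"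
    using q abs_triangle_ineq4[of "?q * cf_error \<alpha> k" "?q' * cf_error \<alpha> (Suc k)"] by (simp add: abs_mult)
  also have "\<dots> \<le> ?q * \<bar>cf_error \<alpha> k\<bar> + ?q * \<bar>cf_error \<alpha> k\<bar>"
    using q cf_error_props(2)[of k] by (intro add_left_mono mult_mono) auto
  finally show ?thesis using q by (simp add: field_simps)
qed

text \<open>Two consecutive convergents form a basis of the integer lattice, so (q, p) has integer
  coordinates x, y in it. The range of q forces x to be nonzero and x, y not to have the same sign;
  as the errors alternate, the two contributions add up without cancellation and the first alone
  gives the bound.\<close>

lemma cf_best_approx:
  assumes "1 \<le> q" "q < cf_denom \<alpha> (Suc k)"
  shows "\<bar>of_int q * \<alpha> - of_int p\<bar> \<ge> 1 / (2 * cf_denom \<alpha> (Suc k))"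
proof -
  define s :: int where "s = (- 1) ^ Suc k"
  have s: "s * s = 1" by (simp add: s_def power_mult_distrib[symmetric])
  \<comment> \<open>Cramer's rule; dividing by the determinant is multiplying by it, as it is 1 or
    -1.\<close>
  define x where "x = s * (cf_denom \<alpha> (Suc k) * p - cf_numer \<alpha> (Suc k) * q)"
  define y where "y = s * (cf_numer \<alpha> k * q - cf_denom \<alpha> k * p)"
  have det: "cf_denom \<alpha> (Suc k) * cf_numer \<alpha> k - cf_numer \<alpha> (Suc k) * cf_denom \<alpha> k = s"
    using cf_det s_def by simp
  have "x * cf_denom \<alpha> k + y * cf_denom \<alpha> (Suc k)
      = s * (cf_denom \<alpha> (Suc k) * cf_numer \<alpha> k - cf_numer \<alpha> (Suc k) * cf_denom \<alpha> k) * q"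
    unfolding x_def y_def by (simp add: algebra_simps)
  then have q: "x * cf_denom \<alpha> k + y * cf_denom \<alpha> (Suc k) = q" using det s by simp
  have "x * cf_numer \<alpha> k + y * cf_numer \<alpha> (Suc k)
      = s * (cf_denom \<alpha> (Suc k) * cf_numer \<alpha> k - cf_numer \<alpha> (Suc k) * cf_denom \<alpha> k) * p"
    unfolding x_def y_def by (simp add: algebra_simps)
  then have p: "x * cf_numer \<alpha> k + y * cf_numer \<alpha> (Suc k) = p" using det s by simp
  have eq: "of_int q * \<alpha> - of_int p = of_int x * cf_error \<alpha> k + of_int y * cf_error \<alpha> (Suc k)"
    unfolding cf_error_def q[symmetric] p[symmetric] by (simp add: algebra_simps)
  have d: "cf_denom \<alpha> k \<ge> 1" "cf_denom \<alpha> (Suc k) \<ge> 1" using cf_denom_ge_1 by auto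
  have x0: "x \<noteq> 0"
  proof
    assume "x = 0"
    then have yq: "y * cf_denom \<alpha> (Suc k) = q" using q by simp
    then have "y \<ge> 1" using assms(1) d(2) by (smt (verit) mult_nonpos_nonneg)
    then have "y * cf_denom \<alpha> (Suc k) \<ge> 1 * cf_denom \<alpha> (Suc k)" using d by (intro mult_right_mono) auto
    then show False using yq assms by simp
  qed
  have xy: "x * y \<le> 0"
  proof (rule ccontr)
    assume "\<not> x * y \<le> 0"
    then consider "x \<ge> 1" "y \<ge> 1" | "x \<le> -1" "y \<le> -1" by (auto simp: zero_less_mult_iff not_le)
    then show False
    proof cases
      case 1
      then have "x * cf_denom \<alpha> k \<ge> 0" "y * cf_denom \<alpha> (Suc k) \<ge> 1 * cf_denom \<alpha> (Suc k)"
        using d by (auto intro!: mult_right_mono simp del: mult_1)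
      then show False using q assms by simp
    next
      case 2
      then have "x * cf_denom \<alpha> k \<le> 0" "y * cf_denom \<alpha> (Suc k) \<le> 0"
        using d by (auto simp: mult_nonpos_nonneg)
      then show False using q assms by simp
    qed
  qed
  have "(of_int x * cf_error \<alpha> k) * (of_int y * cf_error \<alpha> (Suc k))
      = of_int (x * y) * (cf_error \<alpha> k * cf_error \<alpha> (Suc k))" by simp
  also have "\<dots> \<ge> 0" using xy cf_error_props(1) by (intro mult_nonpos_nonpos) (auto simp del: of_int_mult)
  finally have "\<bar>of_int x * cf_error \<alpha> k + of_int y * cf_error \<alpha> (Suc k)\<bar> \<ge> \<bar>of_int x * cf_error \<alpha> k\<bar>"
    by (auto simp: zero_le_mult_iff)
  also have "\<bar>of_int x * cf_error \<alpha> k\<bar> \<ge> 1 * \<bar>cf_error \<alpha> k\<bar>"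
    unfolding abs_mult using x0 by (intro mult_right_mono) auto
  ultimately show ?thesis unfolding eq using cf_error_lower[of k] by linarith
qed

text \<open>Below the denominator of index N + 1 one constant serves all k. Beyond it, |k| lies
  between consecutive denominators, and the growth hypothesis bounds the larger one, which governs
  the approximation, by an exponential of the smaller one, hence of |k|.\<close>

lemma cf_small_divisor:
  fixes \<sigma> :: real
  assumes \<sigma>: "\<sigma> \<ge> 0" and N: "\<And>k. k \<ge> N \<Longrightarrow> cf_denom \<alpha> (Suc k) \<le> exp (\<sigma> * cf_denom \<alpha> k)"
  obtains K where "K > 0"
    and "\<And>j k. (j, k) \<noteq> (0, 0) \<Longrightarrow>
      exp (- \<sigma> * (\<bar>real_of_int j\<bar> + \<bar>real_of_int k\<bar>)) \<le> K * \<bar>of_int j + \<alpha> * of_int k\<bar>"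
proof
  let ?K = "2 * real_of_int (cf_denom \<alpha> (Suc N))"
  have K: "?K \<ge> 2" using cf_denom_ge_1[of "Suc N"] by simp
  then show "?K > 0" by linarith
  have main: "exp (- \<sigma> * (\<bar>j\<bar> + \<bar>k\<bar>)) \<le> ?K * \<bar>j + \<alpha> * k\<bar>" if k: "k \<ge> 1" for j k :: int
  proof (cases "k < cf_denom \<alpha> (Suc N)")
    have eq: "\<bar>of_int k * \<alpha> - of_int (- j)\<bar> = \<bar>j + \<alpha> * k\<bar>" by (simp add: algebra_simps)
    case True
    have "1 \<le> ?K * \<bar>of_int k * \<alpha> - of_int (- j)\<bar>"
      using cf_best_approx[OF k True, of "-j"] K by (simp add: field_simps)
    moreover have "exp (- \<sigma> * (\<bar>j\<bar> + \<bar>k\<bar>)) \<le> 1" using \<sigma> by (simp add: mult_nonpos_nonneg)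
    ultimately show ?thesis unfolding eq by linarith
  next
    have eq: "\<bar>of_int k * \<alpha> - of_int (- j)\<bar> = \<bar>j + \<alpha> * k\<bar>" by (simp add: algebra_simps)
    case False
    \<comment> \<open>The least \<open>i\<close> with this property puts \<open>k\<close> between
      the denominators of index \<open>i\<close> and \<open>i + 1\<close>.\<close>
    define P where "P = (\<lambda>i. k < cf_denom \<alpha> (Suc i))"
    have "P (Suc (nat k))" unfolding P_def using cf_denom_ge_index[of "Suc (nat k)"] k by simp
    then obtain i where i: "P i" "\<And>i'. i' < i \<Longrightarrow> \<not> P i'"
      by (metis exists_least_iff)
    have iN: "i > N"
    proof (rule ccontr)
      assume ni: "\<not> i > N"
      have "cf_denom \<alpha> (Suc i) \<le> cf_denom \<alpha> (Suc N)"
        by (rule lift_Suc_mono_le[of "cf_denom \<alpha>", OF conjunct2[OF cf_denom_ge_1]]) (use ni in simp)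
      then show False using False i(1) unfolding P_def by simp
    qed
    then obtain i' where i': "i = Suc i'" by (cases i) auto
    have lek: "cf_denom \<alpha> i \<le> k" using i(2)[of i'] unfolding P_def i' by simp
    have "cf_denom \<alpha> (Suc i) \<le> exp (\<sigma> * cf_denom \<alpha> i)" using N iN by simp
    also have "\<dots> \<le> exp (\<sigma> * (\<bar>j\<bar> + \<bar>k\<bar>))"
      unfolding exp_le_cancel_iff using lek k \<sigma> by (intro mult_left_mono) auto
    finally have le: "cf_denom \<alpha> (Suc i) \<le> exp (\<sigma> * (\<bar>j\<bar> + \<bar>k\<bar>))" .
    have "exp (- \<sigma> * (\<bar>j\<bar> + \<bar>k\<bar>)) = 1 / exp (\<sigma> * (\<bar>j\<bar> + \<bar>k\<bar>))"
      by (simp only: mult_minus_left exp_minus inverse_eq_divide)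
    also have "\<dots> \<le> 1 / cf_denom \<alpha> (Suc i)"
      using cf_denom_ge_1[of "Suc i"] by (intro divide_left_mono le) auto
    also have "\<dots> \<le> 2 * \<bar>of_int k * \<alpha> - of_int (- j)\<bar>"
      using cf_best_approx[OF k, of i "-j"] i(1) unfolding P_def by simp
    also have "\<dots> \<le> ?K * \<bar>of_int k * \<alpha> - of_int (- j)\<bar>"
      using K by (intro mult_right_mono) auto
    finally show ?thesis unfolding eq .
  qed
  show "exp (- \<sigma> * (\<bar>real_of_int j\<bar> + \<bar>real_of_int k\<bar>)) \<le> ?K * \<bar>of_int j + \<alpha> * of_int k\<bar>"
    if "(j, k) \<noteq> (0, 0)" for j k :: int
  proof -
    have "exp (- \<sigma> * (\<bar>j\<bar> + \<bar>k\<bar>)) \<le> ?K * \<bar>j + \<alpha> * k\<bar>"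
    proof -
    consider "k \<ge> 1" | "- k \<ge> 1" | "k = 0" by linarith
    then show ?thesis
    proof cases
      case 2
      have "\<bar>- real_of_int j - \<alpha> * k\<bar> = \<bar>j + \<alpha> * k\<bar>" by linarith
      then show ?thesis using main[OF 2, of "-j"] by simp
    next
      case 3
      then have "\<bar>j\<bar> \<ge> 1" using that by auto
      then have "1 \<le> \<bar>real_of_int j\<bar>" by linarith
      moreover have "exp (- \<sigma> * (\<bar>j\<bar> + \<bar>k\<bar>)) \<le> 1" using \<sigma> by (simp add: mult_nonpos_nonneg)
      moreover have "1 * 1 \<le> ?K * \<bar>real_of_int j\<bar>"
        using calculation(1) K by (intro mult_mono) auto
      moreover have "?K * \<bar>j + \<alpha> * k\<bar> = ?K * \<bar>real_of_int j\<bar>" using 3 by simp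
      ultimately show ?thesis by linarith
    qed (rule main)
    qed
    then show ?thesis by simp
  qed
qed

end

section \<open>The Banach algebra of absolutely summable families\<close>

lemma abs_summable_product_Times:
  fixes x :: "'a \<Rightarrow> complex" and y :: "'b \<Rightarrow> complex"
  assumes "x abs_summable_on A" "y abs_summable_on B"
  shows "(\<lambda>(a, b). x a * y b) abs_summable_on A \<times> B"
proof -
  have "(\<lambda>a. norm (x a) * infsum (\<lambda>b. norm (y b)) B) summable_on A"
    using assms(1) by (rule summable_on_cmult_left)
  moreover have "norm (infsum (\<lambda>b. norm (x a * y b)) B) = norm (x a) * infsum (\<lambda>b. norm (y b)) B" for a
    by (simp add: norm_mult infsum_cmult_right' infsum_nonneg)
  moreover have "(\<lambda>b. norm (x a * y b)) summable_on B" for a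
    unfolding norm_mult using assms(2) by (rule summable_on_cmult_right)
  ultimately show ?thesis
    by (intro Infinite_Sum.abs_summable_on_Sigma_iff[THEN iffD2]) simp
qed

definition conv :: "('i::ab_group_add \<Rightarrow> complex) \<Rightarrow> ('i \<Rightarrow> complex) \<Rightarrow> 'i \<Rightarrow> complex" where
  "conv x y k = (\<Sum>\<^sub>\<infinity>j. x j * y (k - j))"

text \<open>The shear taking (k, j) to (j, k - j) is a bijection that turns the double family into a
  product family. This is the source of the submultiplicativity of the norm.\<close>

lemma conv_abs_summable2:
  fixes x y :: "'i::ab_group_add \<Rightarrow> complex"
  assumes "x abs_summable_on UNIV" "y abs_summable_on UNIV"
  shows "(\<lambda>(k, j). x j * y (k - j)) abs_summable_on UNIV"
    and "(\<Sum>\<^sub>\<infinity>(k, j). norm (x j * y (k - j))) = (\<Sum>\<^sub>\<infinity>j. norm (x j)) * (\<Sum>\<^sub>\<infinity>j. norm (y j))"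
proof -
  have s: "(\<lambda>(j, i). x j * y i) abs_summable_on UNIV \<times> UNIV"
    using assms by (rule abs_summable_product_Times)
  have b: "bij (\<lambda>(k, j). (j, k - j :: 'i))"
    by (rule bij_betw_byWitness[where f' = "\<lambda>(j, i). (j + i, j)"]) auto
  have "(\<lambda>p. norm ((\<lambda>(j, i). x j * y i) ((\<lambda>(k, j). (j, k - j)) p))) summable_on UNIV"
    using s summable_on_reindex_bij_betw[OF b, of "\<lambda>p. norm ((\<lambda>(j, i). x j * y i) p)"] by simp
  then show "(\<lambda>(k, j). x j * y (k - j)) abs_summable_on UNIV"
    by (simp add: case_prod_unfold)
  have "(\<Sum>\<^sub>\<infinity>(k, j). norm (x j * y (k - j))) = (\<Sum>\<^sub>\<infinity>(j, i)\<in>UNIV \<times> UNIV. norm (x j * y i))"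
    using infsum_reindex_bij_betw[OF b, of "\<lambda>(j, i). norm (x j * y i)"] by (simp add: case_prod_unfold)
  also have "\<dots> = (\<Sum>\<^sub>\<infinity>j. \<Sum>\<^sub>\<infinity>i. norm (x j * y i))"
    by (rule infsum_Sigma'_banach[symmetric]) (use s in \<open>simp add: case_prod_unfold\<close>)
  also have "\<dots> = (\<Sum>\<^sub>\<infinity>j. norm (x j)) * (\<Sum>\<^sub>\<infinity>j. norm (y j))"
    by (simp add: norm_mult infsum_cmult_right' infsum_cmult_left')
  finally show "(\<Sum>\<^sub>\<infinity>(k, j). norm (x j * y (k - j))) = (\<Sum>\<^sub>\<infinity>j. norm (x j)) * (\<Sum>\<^sub>\<infinity>j. norm (y j))" .
qed

lemma conv_terms_summable:
  fixes x y :: "'i::ab_group_add \<Rightarrow> complex"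
  assumes "x abs_summable_on UNIV" "y abs_summable_on UNIV"
  shows "(\<lambda>j. x j * y (k - j)) abs_summable_on UNIV"
  using conv_abs_summable2(1)[OF assms] Infinite_Sum.abs_summable_on_Sigma_iff[of "\<lambda>(k, j). x j * y (k - j)" UNIV "\<lambda>_. UNIV"]
  by simp

lemma conv_abs_summable:
  fixes x y :: "'i::ab_group_add \<Rightarrow> complex"
  assumes "x abs_summable_on UNIV" "y abs_summable_on UNIV"
  shows "conv x y abs_summable_on UNIV"
    and "(\<Sum>\<^sub>\<infinity>k. norm (conv x y k)) \<le> (\<Sum>\<^sub>\<infinity>j. norm (x j)) * (\<Sum>\<^sub>\<infinity>j. norm (y j))"
proof -
  note t = conv_terms_summable[OF assms]
  have le: "norm (conv x y k) \<le> (\<Sum>\<^sub>\<infinity>j. norm (x j * y (k - j)))" for k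
    unfolding conv_def by (rule norm_infsum_bound[OF t])
  have s: "(\<lambda>k. \<Sum>\<^sub>\<infinity>j. norm (x j * y (k - j))) summable_on UNIV"
    using summable_on_Sigma_banach[of "\<lambda>k j. norm (x j * y (k - j))" UNIV "\<lambda>_. UNIV"]
      conv_abs_summable2(1)[OF assms] by (simp add: case_prod_unfold)
  show a: "conv x y abs_summable_on UNIV"
    by (rule Infinite_Sum.abs_summable_on_comparison_test[where g = "\<lambda>k. \<Sum>\<^sub>\<infinity>j. norm (x j * y (k - j))"])
       (use s le in \<open>auto simp: infsum_nonneg\<close>)
  have "(\<Sum>\<^sub>\<infinity>k. norm (conv x y k)) \<le> (\<Sum>\<^sub>\<infinity>k. \<Sum>\<^sub>\<infinity>j. norm (x j * y (k - j)))"
    by (rule infsum_mono[OF a s le])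
  also have "\<dots> = (\<Sum>\<^sub>\<infinity>(k, j). norm (x j * y (k - j)))"
    using infsum_Sigma'_banach[of "\<lambda>k j. norm (x j * y (k - j))" UNIV "\<lambda>_. UNIV"]
      conv_abs_summable2(1)[OF assms] by (simp add: case_prod_unfold)
  finally show "(\<Sum>\<^sub>\<infinity>k. norm (conv x y k)) \<le> (\<Sum>\<^sub>\<infinity>j. norm (x j)) * (\<Sum>\<^sub>\<infinity>j. norm (y j))"
    using conv_abs_summable2(2)[OF assms] by simp
qed

text \<open>A unimodular character splits over j and k - j, so it is absorbed into the two factors
  and the double sum separates. This is what makes \<open>eval_char\<close> multiplicative.\<close>

lemma conv_sum_character:
  fixes x y :: "'i::ab_group_add \<Rightarrow> complex"
  assumes "x abs_summable_on UNIV" "y abs_summable_on UNIV"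
    and "\<And>j k. e (j + k) = e j * e k" "\<And>j. norm (e j) = 1"
  shows "(\<Sum>\<^sub>\<infinity>k. conv x y k * e k) = (\<Sum>\<^sub>\<infinity>j. x j * e j) * (\<Sum>\<^sub>\<infinity>j. y j * e j)"
proof -
  let ?x = "\<lambda>j. x j * e j" and ?y = "\<lambda>j. y j * e j"
  have xs: "?x abs_summable_on UNIV" "?y abs_summable_on UNIV"
    using assms by (simp_all add: norm_mult)
  have "conv x y k * e k = conv ?x ?y k" for k
  proof -
    have t: "x j * y (k - j) * e k = ?x j * ?y (k - j)" for j
      using assms(3)[of j "k - j"] by simp
    show ?thesis
      unfolding conv_def infsum_cmult_left'[symmetric] by (intro infsum_cong t)
  qed
  then have "(\<Sum>\<^sub>\<infinity>k. conv x y k * e k) = (\<Sum>\<^sub>\<infinity>k. \<Sum>\<^sub>\<infinity>j. ?x j * ?y (k - j))"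
    by (simp add: conv_def)
  also have "\<dots> = (\<Sum>\<^sub>\<infinity>j. \<Sum>\<^sub>\<infinity>k. ?x j * ?y (k - j))"
    by (rule infsum_swap_banach)
       (use conv_abs_summable2(1)[OF xs] in \<open>auto intro: Infinite_Sum.abs_summable_summable simp: case_prod_unfold\<close>)
  also have "\<dots> = (\<Sum>\<^sub>\<infinity>j. \<Sum>\<^sub>\<infinity>k. ?x j * ?y k)"
  proof (rule infsum_cong)
    fix j
    show "(\<Sum>\<^sub>\<infinity>k. ?x j * ?y (k - j)) = (\<Sum>\<^sub>\<infinity>k. ?x j * ?y k)"
      by (rule infsum_reindex_bij_witness[where i = "\<lambda>k. k + j" and j = "\<lambda>k. k - j"]) auto
  qed
  also have "\<dots> = (\<Sum>\<^sub>\<infinity>j. ?x j) * (\<Sum>\<^sub>\<infinity>j. ?y j)"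
    by (simp add: infsum_cmult_right' infsum_cmult_left')
  finally show ?thesis .
qed

lemma conv_commute: "conv x y = conv y x"
proof
  fix k
  show "conv x y k = conv y x k"
    unfolding conv_def
    by (rule infsum_reindex_bij_witness[where i = "\<lambda>j. k - j" and j = "\<lambda>j. k - j"]) auto
qed

lemma norm_le_l1: 
  fixes x :: "'i \<Rightarrow> 'a::real_normed_vector"
  assumes "x abs_summable_on UNIV" shows "norm (x i) \<le> (\<Sum>\<^sub>\<infinity>j. norm (x j))"
  using finite_sum_le_infsum[OF assms, of "{i}"] by auto

lemma conv_assoc:
  assumes "x abs_summable_on UNIV" "y abs_summable_on UNIV" "z abs_summable_on UNIV"
  shows "conv (conv x y) z = conv x (conv y z)"
proof
  fix k
  let ?f = "\<lambda>(m, j). x j * y (m - j) * z (k - m)"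
  have f: "?f abs_summable_on UNIV"
  proof (rule Infinite_Sum.abs_summable_on_comparison_test)
    show "(\<lambda>p. (case p of (m, j) \<Rightarrow> x j * y (m - j)) * of_real (\<Sum>\<^sub>\<infinity>j. norm (z j))) abs_summable_on UNIV"
      unfolding norm_mult using conv_abs_summable2(1)[OF assms(1,2)] by (rule summable_on_cmult_left)
    show "norm (?f p) \<le> norm ((case p of (m, j) \<Rightarrow> x j * y (m - j)) * complex_of_real (\<Sum>\<^sub>\<infinity>j. norm (z j)))" for p
      using norm_le_l1[OF assms(3), of "k - fst p"]
      by (auto simp: norm_mult case_prod_unfold infsum_nonneg intro!: mult_left_mono)
  qed
  have "conv (conv x y) z k = (\<Sum>\<^sub>\<infinity>m. \<Sum>\<^sub>\<infinity>j. x j * y (m - j) * z (k - m))"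
    by (simp add: conv_def infsum_cmult_left'[symmetric])
  also have "\<dots> = (\<Sum>\<^sub>\<infinity>j. \<Sum>\<^sub>\<infinity>m. x j * y (m - j) * z (k - m))"
    by (rule infsum_swap_banach) (use f in \<open>auto intro: Infinite_Sum.abs_summable_summable\<close>)
  also have "\<dots> = (\<Sum>\<^sub>\<infinity>j. \<Sum>\<^sub>\<infinity>i. x j * (y i * z (k - j - i)))"
  proof (rule infsum_cong)
    fix j
    show "(\<Sum>\<^sub>\<infinity>m. x j * y (m - j) * z (k - m)) = (\<Sum>\<^sub>\<infinity>i. x j * (y i * z (k - j - i)))"
      by (rule infsum_reindex_bij_witness[where i = "\<lambda>i. i + j" and j = "\<lambda>m. m - j"])
         (auto simp: algebra_simps)
  qed
  also have "\<dots> = conv x (conv y z) k"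
    by (simp add: conv_def infsum_cmult_right'[symmetric])
  finally show "conv (conv x y) z k = conv x (conv y z) k" .
qed

section \<open>The type of summable families and its algebra structure\<close>

text \<open>A type of its own, so that the class operations and theorems on powers, infinite sums,
  limits and fixed points apply without carrier sets. The index is an arbitrary type for the normed
  space and an abelian group for the algebra.\<close>

typedef 'i l1 = "{x :: 'i \<Rightarrow> complex. x abs_summable_on UNIV}"
  morphisms coef Abs_l1
  by (rule exI[of _ "\<lambda>_. 0"]) simp

lemma coef_summable [simp, intro]: "coef x abs_summable_on UNIV"
  using coef[of x] by simp

lemma coef_Abs_l1: "x abs_summable_on UNIV \<Longrightarrow> coef (Abs_l1 x) = x"
  by (simp add: Abs_l1_inverse)

lemma l1_eqI: "(\<And>k. coef x k = coef y k) \<Longrightarrow> x = y"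
  by (metis coef_inject ext)

lemma abs_summable_on_add_complex:
  fixes x y :: "'i \<Rightarrow> complex"
  assumes "x abs_summable_on A" "y abs_summable_on A"
  shows "(\<lambda>i. x i + y i) abs_summable_on A"
  using assms summable_on_iff_abs_summable_on_complex summable_on_add by metis

instantiation l1 :: (type) real_normed_vector
begin

definition "(0 :: 'a l1) = Abs_l1 (\<lambda>_. 0)"
definition "(x :: 'a l1) + y = Abs_l1 (\<lambda>k. coef x k + coef y k)"
definition "- (x :: 'a l1) = Abs_l1 (\<lambda>k. - coef x k)"
definition "(x :: 'a l1) - y = Abs_l1 (\<lambda>k. coef x k - coef y k)"
definition "c *\<^sub>R (x :: 'a l1) = Abs_l1 (\<lambda>k. c *\<^sub>R coef x k)"
definition "norm (x :: 'a l1) = (\<Sum>\<^sub>\<infinity>k. norm (coef x k))"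
definition "sgn (x :: 'a l1) = inverse (norm x) *\<^sub>R x"
definition "dist (x :: 'a l1) y = norm (x - y)"
definition [code del]:
  "(uniformity :: ('a l1 \<times> 'a l1) filter) = (INF e\<in>{0<..}. principal {(x, y). dist x y < e})"
definition [code del]:
  "open (U :: 'a l1 set) \<longleftrightarrow> (\<forall>x\<in>U. eventually (\<lambda>(x', y). x' = x \<longrightarrow> y \<in> U) uniformity)"

lemma coef_zero [simp]: "coef 0 k = 0"
  by (simp add: zero_l1_def coef_Abs_l1)

lemma coef_add [simp]: "coef (x + y) k = coef x k + coef y k"
  unfolding plus_l1_def by (subst coef_Abs_l1) (auto intro: abs_summable_on_add_complex)

lemma coef_uminus [simp]: "coef (- x) k = - coef x k"
  unfolding uminus_l1_def by (subst coef_Abs_l1) auto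

lemma coef_diff [simp]: "coef (x - y) k = coef x k - coef y k"
proof -
  have "(\<lambda>k. coef x k - coef y k) abs_summable_on UNIV"
    using abs_summable_on_add_complex[of "coef x" UNIV "\<lambda>k. - coef y k"] by simp
  then show ?thesis
    unfolding minus_l1_def by (subst coef_Abs_l1) auto
qed

lemma coef_scaleR [simp]: "coef (c *\<^sub>R x) k = c *\<^sub>R coef x k"
  unfolding scaleR_l1_def by (subst coef_Abs_l1) (auto intro!: summable_on_cmult_right)

instance
proof
  fix x y :: "'a l1" and a :: real
  show "norm x = 0 \<longleftrightarrow> x = 0"
  proof
    assume "norm x = 0"
    then have "norm (coef x k) = 0" for k
      using nonneg_infsum_le_0D[of "\<lambda>k. norm (coef x k)" UNIV k] by (simp add: norm_l1_def)
    then show "x = 0" by (intro l1_eqI) simp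
  qed (simp add: norm_l1_def)
  have "norm (x + y) \<le> (\<Sum>\<^sub>\<infinity>k. norm (coef x k) + norm (coef y k))"
    unfolding norm_l1_def by (rule infsum_mono) (auto intro!: summable_on_add simp: norm_triangle_ineq
      simp del: coef_add simp add: coef_add[abs_def] intro: abs_summable_on_add_complex)
  also have "\<dots> = norm x + norm y"
    unfolding norm_l1_def by (rule infsum_add) auto
  finally show "norm (x + y) \<le> norm x + norm y" .
  show "norm (a *\<^sub>R x) = \<bar>a\<bar> * norm x"
    by (simp add: norm_l1_def infsum_cmult_right')
qed (auto intro!: l1_eqI simp: algebra_simps sgn_l1_def dist_l1_def uniformity_l1_def open_l1_def)

end

lemma coef_le_norm: "norm (coef x k) \<le> norm x"
  unfolding norm_l1_def by (rule norm_le_l1) simp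

lemma bounded_linear_coef: "bounded_linear (\<lambda>x. coef x k)"
  by (rule bounded_linear_intro[where K = 1]) (simp_all add: coef_le_norm)

lemmas tendsto_coef = bounded_linear.tendsto[OF bounded_linear_coef]

text \<open>A Fatou argument: the coefficients converge, and bounds on finite partial sums of the
  differences survive the limit. This gives both the summability of the limit and the convergence in
  norm.\<close>

instance l1 :: (type) banach
proof
  fix X :: "nat \<Rightarrow> 'a l1"
  assume X: "Cauchy X"
  have "Cauchy (\<lambda>n. coef (X n) k)" for k
    by (rule bounded_linear.Cauchy[OF bounded_linear_coef X])
  then obtain L where L: "\<And>k. (\<lambda>n. coef (X n) k) \<longlonglongrightarrow> L k"
    unfolding Cauchy_convergent_iff convergent_def by metis
  have fin: "(\<Sum>k\<in>F. norm (coef (X n) k - L k)) \<le> e"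
    if F: "finite F" and e: "\<And>m. m \<ge> N \<Longrightarrow> norm (X n - X m) \<le> e" for F n N e
  proof (rule tendsto_upperbound)
    show "(\<lambda>m. \<Sum>k\<in>F. norm (coef (X n) k - coef (X m) k)) \<longlonglongrightarrow> (\<Sum>k\<in>F. norm (coef (X n) k - L k))"
      by (intro tendsto_intros L)
    show "\<forall>\<^sub>F m in sequentially. (\<Sum>k\<in>F. norm (coef (X n) k - coef (X m) k)) \<le> e"
      using eventually_ge_at_top[of N]
    proof eventually_elim
      case (elim m)
      have "(\<Sum>k\<in>F. norm (coef (X n - X m) k)) \<le> norm (X n - X m)"
        unfolding norm_l1_def by (rule finite_sum_le_infsum[OF coef_summable]) (use F in auto)
      then show ?case using e[OF elim] by simp
    qed
  qed simp
  have ex: "\<exists>N. \<forall>n\<ge>N. \<forall>m\<ge>N. norm (X n - X m) \<le> e" if "e > 0" for e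
    using X that unfolding Cauchy_def dist_norm by (meson less_imp_le)
  have summ: "(\<lambda>k. coef (X n) k - L k) abs_summable_on UNIV"
    if e: "\<And>m. m \<ge> N \<Longrightarrow> norm (X n - X m) \<le> e" for n N e
    unfolding abs_summable_iff_bdd_above by (rule bdd_aboveI[of _ e]) (use fin[OF _ e] in auto)
  obtain N where "\<forall>n\<ge>N. \<forall>m\<ge>N. norm (X n - X m) \<le> 1" using ex[of 1] by auto
  then have "(\<lambda>k. coef (X N) k - L k) abs_summable_on UNIV" using summ[of N N] by blast
  then have "(\<lambda>k. coef (X N) k + - (coef (X N) k - L k)) abs_summable_on UNIV"
    by (intro abs_summable_on_add_complex) (simp_all add: norm_minus_commute)
  then have Ls: "L abs_summable_on UNIV" by simp
  have "X \<longlonglongrightarrow> Abs_l1 L"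
  proof (rule metric_LIMSEQ_I)
    fix e :: real assume "e > 0"
    then obtain N where N: "\<forall>n\<ge>N. \<forall>m\<ge>N. norm (X n - X m) \<le> e / 2" using ex[of "e / 2"] by auto
    have "dist (X n) (Abs_l1 L) < e" if n: "n \<ge> N" for n
    proof -
      have "norm (X n - Abs_l1 L) \<le> e / 2"
        unfolding norm_l1_def
      proof (rule infsum_le_finite_sums)
        fix F :: "'a set" assume "finite F"
        then have "(\<Sum>k\<in>F. norm (coef (X n) k - L k)) \<le> e / 2" by (rule fin[where N = N]) (use N n in auto)
        then show "(\<Sum>k\<in>F. norm (coef (X n - Abs_l1 L) k)) \<le> e / 2" by (simp add: coef_Abs_l1[OF Ls])
      qed (rule coef_summable)
      then show ?thesis using \<open>e > 0\<close> by (simp add: dist_norm)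
    qed
    then show "\<exists>N. \<forall>n\<ge>N. dist (X n) (Abs_l1 L) < e" by blast
  qed
  then show "convergent X" by (auto simp: convergent_def)
qed

lemma abs_summable_on_finite_support:
  fixes x :: "'i \<Rightarrow> 'a::real_normed_vector"
  assumes "finite {i. x i \<noteq> 0}" shows "x abs_summable_on UNIV"
proof -
  have "x abs_summable_on {i. x i \<noteq> 0}" using assms by simp
  then show ?thesis
    by (rule summable_on_cong_neutral[THEN iffD1, rotated -1]) auto
qed

definition single :: "'i \<Rightarrow> complex \<Rightarrow> 'i l1" where
  "single k c = Abs_l1 (\<lambda>j. if j = k then c else 0)"

lemma coef_single [simp]: "coef (single k c) j = (if j = k then c else 0)"
  unfolding single_def by (subst coef_Abs_l1) (auto intro: abs_summable_on_finite_support)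

instantiation l1 :: (ab_group_add) "{real_normed_algebra_1, comm_ring_1}"
begin

definition "(1 :: 'a l1) = single 0 1"
definition "(x :: 'a l1) * y = Abs_l1 (conv (coef x) (coef y))"

lemma coef_mult: "coef (x * y) = conv (coef x) (coef y)"
  unfolding times_l1_def by (rule coef_Abs_l1) (rule conv_abs_summable; simp)

lemma coef_one [simp]: "coef 1 k = (if k = 0 then 1 else 0)"
  by (simp add: one_l1_def)

instance
proof
  fix x y z :: "'a l1" and a :: real
  have distrib: "coef ((x + y) * z) k = coef (x * z + y * z) k" for x y z :: "'a l1" and k
    unfolding coef_add coef_mult conv_def
    by (subst infsum_add[symmetric])
       (auto intro: Infinite_Sum.abs_summable_summable[OF conv_terms_summable] simp: algebra_simps)
  have comm: "x * y = y * x" for x y :: "'a l1"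
    by (intro l1_eqI) (simp add: coef_mult conv_commute)
  have sc: "a *\<^sub>R x * y = a *\<^sub>R (x * y)" for x y :: "'a l1"
    by (intro l1_eqI) (simp add: coef_mult conv_def infsum_scaleR_right[symmetric])
  show "x * y * z = x * (y * z)"
    by (intro l1_eqI) (simp add: coef_mult conv_assoc)
  show "x * y = y * x" by (rule comm)
  show d: "(x + y) * z = x * z + y * z" by (intro l1_eqI distrib)
  show "x * (y + z) = x * y + x * z"
    using distrib[of y z x] by (intro l1_eqI) (simp add: comm)
  show "a *\<^sub>R x * y = a *\<^sub>R (x * y)" by (rule sc)
  show "x * a *\<^sub>R y = a *\<^sub>R (x * y)" using sc[of y x] by (simp add: comm)
  show "norm (x * y) \<le> norm x * norm y"
    unfolding norm_l1_def coef_mult by (rule conv_abs_summable) auto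
  show one: "1 * x = x"
  proof (intro l1_eqI)
    fix k
    have "(\<Sum>\<^sub>\<infinity>j. coef 1 j * coef x (k - j)) = (\<Sum>\<^sub>\<infinity>j\<in>{0}. coef 1 j * coef x (k - j))"
      by (rule infsum_cong_neutral) auto
    then show "coef (1 * x) k = coef x k" by (simp add: coef_mult conv_def)
  qed
  show "x * 1 = x" using one comm by simp
  show "norm (1 :: 'a l1) = 1"
  proof -
    have "(\<Sum>\<^sub>\<infinity>j. norm (coef (1 :: 'a l1) j)) = (\<Sum>\<^sub>\<infinity>j\<in>{0::'a}. 1)"
      by (rule infsum_cong_neutral) auto
    then show ?thesis by (simp add: norm_l1_def)
  qed
  show "(0 :: 'a l1) \<noteq> 1"
    by (metis coef_one coef_zero zero_neq_one)
qed

end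

lemma norm_single [simp]: "norm (single k c) = norm c"
proof -
  have "(\<Sum>\<^sub>\<infinity>j. norm (if j = k then c else 0)) = (\<Sum>\<^sub>\<infinity>j\<in>{k}. norm c)"
    by (rule infsum_cong_neutral) auto
  then show ?thesis by (simp add: norm_l1_def if_distrib cong: if_cong)
qed

lemma bounded_linear_single: "bounded_linear (single k)"
  by (rule bounded_linear_intro[where K = 1]) (auto intro!: l1_eqI)

lemma coef_sum: "coef (\<Sum>i\<in>A. x i) k = (\<Sum>i\<in>A. coef (x i) k)"
  by (induction A rule: infinite_finite_induct) auto

text \<open>The distance to a finite truncation is exactly the part of the norm that is left out.
  Density of the finitely supported elements is what \<open>continuous_on_diag\<close> relies
  on.\<close>

lemma has_sum_single: "((\<lambda>k. single k (coef x k)) has_sum x) UNIV"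
proof -
  have d: "dist (\<Sum>k\<in>F. single k (coef x k)) x = norm x - (\<Sum>k\<in>F. norm (coef x k))" if F: "finite F" for F
  proof -
    have "(\<Sum>\<^sub>\<infinity>k. norm (coef ((\<Sum>k\<in>F. single k (coef x k)) - x) k)) = (\<Sum>\<^sub>\<infinity>k\<in>-F. norm (coef x k))"
      by (rule infsum_cong_neutral) (use F in \<open>auto simp: coef_sum\<close>)
    also have "\<dots> = (\<Sum>\<^sub>\<infinity>k. norm (coef x k)) - (\<Sum>\<^sub>\<infinity>k\<in>F. norm (coef x k))"
      unfolding Compl_eq_Diff_UNIV by (rule infsum_Diff) (use F in auto)
    finally show ?thesis using F by (simp add: dist_norm norm_l1_def)
  qed
  have "((\<lambda>F. norm x - (\<Sum>k\<in>F. norm (coef x k))) \<longlongrightarrow> norm x - norm x) (finite_subsets_at_top UNIV)"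
    unfolding norm_l1_def by (intro tendsto_intros infsum_tendsto) auto
  then have "((\<lambda>F. norm x - (\<Sum>k\<in>F. norm (coef x k))) \<longlongrightarrow> 0) (finite_subsets_at_top UNIV)"
    by simp
  then have "((\<lambda>F. dist (\<Sum>k\<in>F. single k (coef x k)) x) \<longlongrightarrow> 0) (finite_subsets_at_top UNIV)"
    by (rule Lim_transform_eventually) (auto intro!: eventually_finite_subsets_at_top_weakI simp only: d)
  then show ?thesis unfolding has_sum_def by (rule tendsto_dist_iff[THEN iffD2])
qed

section \<open>Fourier multipliers\<close>

text \<open>The Fourier multiplier with symbol m. A bound on m, as in the following context, gives
  it sense; otherwise the product may fail to be summable.\<close>

definition diag :: "('i \<Rightarrow> complex) \<Rightarrow> 'i l1 \<Rightarrow> 'i l1" where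
  "diag m x = Abs_l1 (\<lambda>k. m k * coef x k)"

context
  fixes m :: "'i \<Rightarrow> complex" and K :: real
  assumes m: "\<And>k. norm (m k) \<le> K"
begin

lemma coef_diag: "coef (diag m x) k = m k * coef x k"
proof -
  have "(\<lambda>k. m k * coef x k) abs_summable_on UNIV"
  proof (rule Infinite_Sum.abs_summable_on_comparison_test)
    show "(\<lambda>k. of_real K * coef x k) abs_summable_on UNIV"
      unfolding norm_mult by (intro summable_on_cmult_right) simp
    show "norm (m k * coef x k) \<le> norm (of_real K * coef x k)" for k
      using m[of k] by (auto simp: norm_mult intro!: mult_right_mono)
  qed
  then show ?thesis by (simp add: diag_def coef_Abs_l1)
qed

lemma norm_diag_le: "norm (diag m x) \<le> K * norm x"
proof -
  have "norm (diag m x) \<le> (\<Sum>\<^sub>\<infinity>k. K * norm (coef x k))"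
    unfolding norm_l1_def by (rule infsum_mono)
      (auto simp: coef_diag norm_mult intro!: mult_right_mono m summable_on_cmult_right,
       simp add: norm_mult[symmetric] coef_diag[symmetric])
  then show ?thesis by (simp add: norm_l1_def infsum_cmult_right')
qed

lemma bounded_linear_diag: "bounded_linear (diag m)"
  by (rule bounded_linear_intro[where K = K])
     (auto intro!: l1_eqI simp: coef_diag algebra_simps norm_diag_le)

lemma diag_single: "diag m (single k c) = single k (m k * c)"
  by (rule l1_eqI) (simp add: coef_diag)

end

text \<open>The symbol is continuous in p for each index separately, with no uniformity, so the
  operators are only strongly continuous. On a fixed x the uniform bound reduces the claim to finite
  truncations, which converge uniformly in p.\<close>

lemma continuous_on_diag:
  fixes m :: "'p::topological_space \<Rightarrow> 'i \<Rightarrow> complex"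
  assumes "\<And>p k. p \<in> S \<Longrightarrow> norm (m p k) \<le> K"
    and "\<And>k. continuous_on S (\<lambda>p. m p k)"
  shows "continuous_on S (\<lambda>p. diag (m p) x)"
proof (cases "S = {}")
  case False
  then obtain p0 where "p0 \<in> S" by auto
  then have K: "K \<ge> 0" using assms(1)[of p0 undefined] norm_ge_zero order_trans by blast
  let ?x = "\<lambda>k. single k (coef x k)"
  show ?thesis
  proof (rule uniform_limit_theorem)
    show "\<forall>\<^sub>F F in finite_subsets_at_top UNIV. continuous_on S (\<lambda>p. \<Sum>k\<in>F. single k (m p k * coef x k))"
      by (intro always_eventually allI continuous_on_sum
          bounded_linear.continuous_on[OF bounded_linear_single] continuous_intros assms(2))
    have le: "dist (\<Sum>k\<in>F. single k (m p k * coef x k)) (diag (m p) x) \<le> K * dist (\<Sum>k\<in>F. ?x k) x"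
      if p: "p \<in> S" for p F
    proof -
      note bl = bounded_linear_diag[OF assms(1)[OF p]]
      have "(\<Sum>k\<in>F. single k (m p k * coef x k)) = diag (m p) (\<Sum>k\<in>F. ?x k)"
        by (simp add: linear_sum[OF bounded_linear.linear[OF bl]] diag_single[OF assms(1)[OF p]])
      then have "(\<Sum>k\<in>F. single k (m p k * coef x k)) - diag (m p) x = diag (m p) ((\<Sum>k\<in>F. ?x k) - x)"
        by (simp add: linear_diff[OF bounded_linear.linear[OF bl]])
      then show ?thesis using norm_diag_le[OF assms(1)[OF p]] by (simp add: dist_norm)
    qed
    show "uniform_limit S (\<lambda>F p. \<Sum>k\<in>F. single k (m p k * coef x k)) (\<lambda>p. diag (m p) x) (finite_subsets_at_top UNIV)"
    proof (rule uniform_limitI)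
      fix e :: real assume "e > 0"
      then have "e / (K + 1) > 0" using K by simp
      then have "\<forall>\<^sub>F F in finite_subsets_at_top UNIV. dist (\<Sum>k\<in>F. ?x k) x < e / (K + 1)"
        using has_sum_single[of x] unfolding has_sum_def by (rule tendstoD[rotated])
      then show "\<forall>\<^sub>F F in finite_subsets_at_top UNIV. \<forall>p\<in>S. dist (\<Sum>k\<in>F. single k (m p k * coef x k)) (diag (m p) x) < e"
      proof eventually_elim
        case (elim F)
        then have "(K + 1) * dist (\<Sum>k\<in>F. ?x k) x < e" using K by (simp add: field_simps)
        then have "K * dist (\<Sum>k\<in>F. ?x k) x < e"
          by (smt (verit, best) mult_right_mono zero_le_dist)
        then show ?case using le by (meson le_less_trans)
      qed
    qed
  qed simp
qed simp

section \<open>Conjugation and imaginary translation\<close>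

text \<open>Read as functions, y is the conjugate of x, translated by an imaginary vector that is
  encoded in the multiplicative factor w. For w = 1 and x = y this says that x is real; for
  \<open>wc h\<close> it compares a problem with its translate. It is a relation rather than an
  operation because the translate of an element need not be summable.\<close>

definition cnj_twist :: "('i::ab_group_add \<Rightarrow> complex) \<Rightarrow> 'i l1 \<Rightarrow> 'i l1 \<Rightarrow> bool" where
  "cnj_twist w x y \<longleftrightarrow> (\<forall>k. coef y k = w k * cnj (coef x (- k)))"

context
  fixes w :: "'i::ab_group_add \<Rightarrow> complex"
  assumes w: "\<And>j k. w (j + k) = w j * w k"
begin

lemma cnj_twist_mult:
  assumes "cnj_twist w x y" "cnj_twist w x' y'"
  shows "cnj_twist w (x * x') (y * y')"
  unfolding cnj_twist_def
proof
  fix k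
  have "coef (y * y') k = (\<Sum>\<^sub>\<infinity>j. w k * cnj (coef x (- j) * coef x' (- (k - j))))"
    unfolding coef_mult conv_def
  proof (rule infsum_cong)
    fix j
    have "w k = w j * w (k - j)" using w[of j "k - j"] by simp
    then show "coef y j * coef y' (k - j) = w k * cnj (coef x (- j) * coef x' (- (k - j)))"
      using assms by (simp add: cnj_twist_def)
  qed
  also have "\<dots> = w k * (\<Sum>\<^sub>\<infinity>j. cnj (coef x (- j) * coef x' (- (k - j))))"
    by (rule infsum_cmult_right')
  also have "(\<Sum>\<^sub>\<infinity>j. cnj (coef x (- j) * coef x' (- (k - j)))) = (\<Sum>\<^sub>\<infinity>j. cnj (coef x j * coef x' (- k - j)))"
    by (rule infsum_reindex_bij_witness[where i = uminus and j = uminus]) auto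
  also have "\<dots> = cnj (coef (x * x') (- k))"
    unfolding infsum_cnj by (simp add: coef_mult conv_def)
  finally show "coef (y * y') k = w k * cnj (coef (x * x') (- k))" .
qed

lemma cnj_twist_one: "w 0 = 1 \<Longrightarrow> cnj_twist w 1 1"
  by (simp add: cnj_twist_def)

lemma cnj_twist_power:
  assumes "w 0 = 1" "cnj_twist w x y" shows "cnj_twist w (x ^ n) (y ^ n)"
  by (induction n) (use assms in \<open>auto intro: cnj_twist_one cnj_twist_mult\<close>)

end

lemma cnj_twist_add: "cnj_twist w x y \<Longrightarrow> cnj_twist w x' y' \<Longrightarrow> cnj_twist w (x + x') (y + y')"
  and cnj_twist_diff: "cnj_twist w x y \<Longrightarrow> cnj_twist w x' y' \<Longrightarrow> cnj_twist w (x - x') (y - y')"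
  and cnj_twist_scaleR: "cnj_twist w x y \<Longrightarrow> cnj_twist w (c *\<^sub>R x) (c *\<^sub>R y)"
  and cnj_twist_zero: "cnj_twist w 0 0"
  by (auto simp: cnj_twist_def algebra_simps)

lemma cnj_twist_diag:
  assumes "\<And>k. norm (m k) \<le> K" "\<And>k. m (- k) = cnj (m k)" "cnj_twist w x y"
  shows "cnj_twist w (diag m x) (diag m y)"
  using assms unfolding cnj_twist_def by (simp add: coef_diag[OF assms(1)])

lemma cnj_twist_LIMSEQ:
  assumes "\<And>n. cnj_twist w (X n) (Y n)" "X \<longlonglongrightarrow> x" "Y \<longlonglongrightarrow> y"
  shows "cnj_twist w x y"
  unfolding cnj_twist_def
proof
  fix k
  have "(\<lambda>n. coef (Y n) k) \<longlonglongrightarrow> w k * cnj (coef x (- k))"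
    using assms(1) unfolding cnj_twist_def by (auto intro!: tendsto_intros tendsto_coef assms(2))
  then show "coef y k = w k * cnj (coef x (- k))"
    using tendsto_coef[OF assms(3)] LIMSEQ_unique by blast
qed

lemma cnj_twist_suminf:
  assumes "\<And>n. cnj_twist w (X n) (Y n)" "summable X" "summable Y"
  shows "cnj_twist w (suminf X) (suminf Y)"
proof (rule cnj_twist_LIMSEQ[where X = "\<lambda>n. \<Sum>i<n. X i" and Y = "\<lambda>n. \<Sum>i<n. Y i"])
  show "cnj_twist w (\<Sum>i<n. X i) (\<Sum>i<n. Y i)" for n
    by (induction n) (auto intro: cnj_twist_zero cnj_twist_add assms)
qed (use assms in \<open>simp_all add: summable_LIMSEQ\<close>)

section \<open>Point evaluation\<close>

definition eval_char :: "('i \<Rightarrow> complex) \<Rightarrow> 'i l1 \<Rightarrow> complex" where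
  "eval_char e x = (\<Sum>\<^sub>\<infinity>k. coef x k * e k)"

lemma eval_char_summable:
  assumes "\<And>k. norm (e k) \<le> 1"
  shows "(\<lambda>k. coef x k * e k) abs_summable_on UNIV"
  by (rule Infinite_Sum.abs_summable_on_comparison_test[OF coef_summable[of x]])
     (use assms in \<open>auto simp: norm_mult intro!: mult_left_le\<close>)

lemma bounded_linear_eval_char:
  assumes "\<And>k. norm (e k) \<le> 1"
  shows "bounded_linear (eval_char e)"
proof (rule bounded_linear_intro[where K = 1])
  note s = eval_char_summable[OF assms, THEN Infinite_Sum.abs_summable_summable]
  show "eval_char e (x + y) = eval_char e x + eval_char e y" for x y
    unfolding eval_char_def by (simp add: s infsum_add[symmetric] distrib_right)
  show "eval_char e (c *\<^sub>R x) = c *\<^sub>R eval_char e x" for c x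
    unfolding eval_char_def by (simp add: infsum_scaleR_right[symmetric])
  show "norm (eval_char e x) \<le> norm x * 1" for x
  proof -
    have "norm (eval_char e x) \<le> (\<Sum>\<^sub>\<infinity>k. norm (coef x k * e k))"
      unfolding eval_char_def by (rule norm_infsum_bound[OF eval_char_summable[OF assms]])
    also have "\<dots> \<le> norm x"
      unfolding norm_l1_def by (rule infsum_mono[OF eval_char_summable[OF assms]])
        (use assms in \<open>auto simp: norm_mult intro!: mult_left_le\<close>)
    finally show ?thesis by simp
  qed
qed

lemma eval_char_mult:
  assumes "\<And>j k. e (j + k) = e j * e k" "\<And>k. norm (e k) = 1"
  shows "eval_char e (x * y) = eval_char e x * eval_char e y"
  unfolding eval_char_def coef_mult by (rule conv_sum_character) (use assms in auto)

lemma eval_char_single [simp]: "eval_char e (single k c) = c * e k"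
proof -
  have "(\<Sum>\<^sub>\<infinity>j. coef (single k c) j * e j) = (\<Sum>\<^sub>\<infinity>j\<in>{k}. c * e j)"
    by (rule infsum_cong_neutral) auto
  then show ?thesis by (simp add: eval_char_def)
qed

lemma eval_char_power:
  assumes "\<And>j k. e (j + k) = e j * e k" "\<And>k. norm (e k) = 1"
  shows "eval_char e (x ^ n) = eval_char e x ^ n"
proof (induction n)
  case 0
  have "e 0 * e 0 = e 0" using assms(1)[of 0 0] by simp
  moreover have "e 0 \<noteq> 0" using assms(2)[of 0] by auto
  ultimately show ?case by (simp add: one_l1_def)
qed (simp add: eval_char_mult[OF assms])

section \<open>Weighted summability\<close>

text \<open>A predicate and not a norm: weighted sums are needed only qualitatively, for the data
  and for the final regularity.\<close>

definition wsummable :: "('i \<Rightarrow> real) \<Rightarrow> 'i l1 \<Rightarrow> bool" where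
  "wsummable w x \<longleftrightarrow> (\<lambda>k. norm (coef x k) * w k) summable_on UNIV"

lemma wsummable_add:
  assumes "wsummable w x" "wsummable w y" "\<And>k. w k \<ge> 0"
  shows "wsummable w (x + y)"
  unfolding wsummable_def
proof (rule summable_on_comparison_test)
  show "(\<lambda>k. norm (coef x k) * w k + norm (coef y k) * w k) summable_on UNIV"
    using assms unfolding wsummable_def by (intro summable_on_add)
  show "norm (coef (x + y) k) * w k \<le> norm (coef x k) * w k + norm (coef y k) * w k" for k
    using mult_right_mono[OF norm_triangle_ineq assms(3)] by (simp add: distrib_right)
qed (use assms in auto)

lemma wsummable_scaleR: "wsummable w x \<Longrightarrow> wsummable w (c *\<^sub>R x)"
  unfolding wsummable_def by (simp add: mult.assoc summable_on_cmult_right)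

lemma wsummable_single: "wsummable w (single k c)"
proof -
  have "(\<lambda>j. norm (coef (single k c) j) * w j) summable_on {k}" by simp
  then show ?thesis unfolding wsummable_def
    by (rule summable_on_cong_neutral[THEN iffD1, rotated -1]) auto
qed

text \<open>A submultiplicative weight distributes over the terms of the convolution. The weighted
  moduli are viewed as complex families so that \<open>conv_abs_summable\<close> applies to
  them.\<close>

lemma wsummable_mult:
  assumes "wsummable w x" "wsummable w y" and w: "\<And>k. w k \<ge> 0"
    and sub: "\<And>j k. w (j + k) \<le> w j * w k"
  shows "wsummable w (x * y)"
proof -
  let ?x = "\<lambda>k. complex_of_real (norm (coef x k) * w k)"
  let ?y = "\<lambda>k. complex_of_real (norm (coef y k) * w k)"
  have xs: "?x abs_summable_on UNIV" "?y abs_summable_on UNIV"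
    unfolding norm_of_real using assms(1,2) w by (simp_all add: wsummable_def abs_mult)
  note c = conv_abs_summable(1)[OF xs]
  have "norm (norm (coef (x * y) k) * w k) \<le> norm (conv ?x ?y k)" for k
  proof -
    have t: "norm (coef (x * y) k) \<le> (\<Sum>\<^sub>\<infinity>j. norm (coef x j * coef y (k - j)))"
      unfolding coef_mult conv_def by (rule norm_infsum_bound) (auto intro: conv_terms_summable)
    have "norm (coef (x * y) k) * w k \<le> (\<Sum>\<^sub>\<infinity>j. norm (coef x j * coef y (k - j))) * w k"
      by (rule mult_right_mono[OF t w])
    also have "\<dots> = (\<Sum>\<^sub>\<infinity>j. norm (coef x j * coef y (k - j)) * w k)"
      by (rule infsum_cmult_left'[symmetric])
    also have "\<dots> \<le> (\<Sum>\<^sub>\<infinity>j. norm (?x j * ?y (k - j)))"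
    proof (rule infsum_mono)
      show "(\<lambda>j. norm (coef x j * coef y (k - j)) * w k) summable_on UNIV"
        by (intro summable_on_cmult_left conv_terms_summable) auto
      show "(\<lambda>j. ?x j * ?y (k - j)) abs_summable_on UNIV" by (rule conv_terms_summable[OF xs])
      show "norm (coef x j * coef y (k - j)) * w k \<le> norm (?x j * ?y (k - j))" for j
        using mult_left_mono[OF sub[of j "k - j"], of "norm (coef x j * coef y (k - j))"] w
        by (simp add: norm_mult abs_mult mult_ac)
    qed
    also have "\<dots> = (\<Sum>\<^sub>\<infinity>j. norm (coef x j) * w j * (norm (coef y (k - j)) * w (k - j)))"
      using w by (simp add: norm_mult abs_mult)
    also have "\<dots> = (\<Sum>\<^sub>\<infinity>j. Re (?x j * ?y (k - j)))"
      by simp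
    also have "\<dots> = Re (conv ?x ?y k)"
      unfolding conv_def
      by (rule infsum_Re) (rule Infinite_Sum.abs_summable_summable[OF conv_terms_summable[OF xs]])
    also have "\<dots> \<le> norm (conv ?x ?y k)" by (rule complex_Re_le_cmod)
    finally show ?thesis using w by (simp add: abs_mult)
  qed
  then show ?thesis
    unfolding wsummable_def
    by (rule Infinite_Sum.abs_summable_summable[OF Infinite_Sum.abs_summable_on_comparison_test[OF c]])
qed

lemma wsummable_power:
  assumes "wsummable w x" "\<And>k. w k \<ge> 0" "\<And>j k. w (j + k) \<le> w j * w k"
  shows "wsummable w (x ^ n)"
proof (induction n)
  case (Suc n)
  show ?case unfolding power_Suc by (rule wsummable_mult[OF assms(1) Suc assms(2,3)])
qed (simp add: one_l1_def wsummable_single)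

lemma wsummable_mono:
  assumes "wsummable w x" "\<And>k. norm (coef y k) * v k \<le> C * (norm (coef x k) * w k)" "\<And>k. v k \<ge> 0"
  shows "wsummable v y"
proof -
  have s: "(\<lambda>k. C * (norm (coef x k) * w k)) summable_on UNIV"
    using assms(1) unfolding wsummable_def by (rule summable_on_cmult_right)
  show ?thesis
    unfolding wsummable_def
    by (rule summable_on_comparison_test[OF s]) (simp_all add: assms)
qed

section \<open>The contraction\<close>

lemma norm_power_diff_le:
  fixes x y :: "'a::{real_normed_algebra_1, comm_ring_1}"
  assumes "norm x \<le> t" "norm y \<le> t"
  shows "norm (x ^ m - y ^ m) \<le> real m * t ^ (m - 1) * norm (x - y)"
proof -
  have t: "t \<ge> 0" using assms(1) norm_ge_zero order_trans by blast
  have "norm (y ^ (m - Suc i) * x ^ i) \<le> t ^ (m - 1)" if "i < m" for i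
  proof -
    have "norm (y ^ (m - Suc i) * x ^ i) \<le> norm (y ^ (m - Suc i)) * norm (x ^ i)"
      by (rule norm_mult_ineq)
    also have "\<dots> \<le> t ^ (m - Suc i) * t ^ i"
      using t assms by (intro mult_mono order_trans[OF norm_power_ineq] power_mono) auto
    also have "\<dots> = t ^ (m - 1)" using that by (simp add: power_add[symmetric])
    finally show ?thesis .
  qed
  then have "norm (\<Sum>i<m. y ^ (m - Suc i) * x ^ i) \<le> real m * t ^ (m - 1)"
    by (intro order_trans[OF norm_sum] sum_bounded_above[where A = "{..<m}", simplified]) auto
  then have "norm (x - y) * norm (\<Sum>i<m. y ^ (m - Suc i) * x ^ i) \<le> norm (x - y) * (real m * t ^ (m - 1))"
    by (rule mult_left_mono) simp
  then show ?thesis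
    unfolding power_diff_sumr2 using norm_mult_ineq order_trans by (fastforce simp: mult_ac)
qed

text \<open>Strict differentiability: the difference quotient of the power is a polynomial in both
  increments, hence continuous, with value n W^(n-1) at the origin. Two free increments are what a
  Lipschitz estimate requires.\<close>

lemma power_strict_derivative:
  fixes W :: "'a::{real_normed_algebra_1, comm_ring_1}"
  assumes "\<tau> > 0"
  obtains r where "r > 0" and "\<And>h k. norm h \<le> r \<Longrightarrow> norm k \<le> r \<Longrightarrow>
    norm ((W + h) ^ n - (W + k) ^ n - real n *\<^sub>R (W ^ (n - 1) * (h - k))) \<le> \<tau> * norm (h - k)"
proof -
  define q where "q = (\<lambda>p :: 'a \<times> 'a. \<Sum>i<n. (W + snd p) ^ (n - Suc i) * (W + fst p) ^ i)"
  have "isCont q (0, 0)" unfolding q_def by (intro continuous_intros)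
  then obtain d where d: "d > 0" "\<And>p. dist p (0, 0) < d \<Longrightarrow> dist (q p) (q (0, 0)) < \<tau>"
    using assms unfolding continuous_at_eps_delta by meson
  have q0: "q (0, 0) = real n *\<^sub>R W ^ (n - 1)"
    by (simp add: q_def power_add[symmetric] scaleR_conv_of_real)
  show ?thesis
  proof
    show "d / 4 > 0" using d by simp
    fix h k :: 'a assume hk: "norm h \<le> d / 4" "norm k \<le> d / 4"
    have "dist (h, k) (0, 0) \<le> norm h + norm k"
      unfolding dist_norm using norm_Pair_le[of h k] by (simp add: zero_prod_def[symmetric] flip: zero_prod_def)
    also have "\<dots> < d" using hk d by simp
    finally have "norm (q (h, k) - q (0, 0)) \<le> \<tau>" using d(2) by (force simp: dist_norm)
    moreover have "(W + h) ^ n - (W + k) ^ n - real n *\<^sub>R (W ^ (n - 1) * (h - k)) = (q (h, k) - q (0, 0)) * (h - k)"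
      unfolding power_diff_sumr2 q0 by (simp add: q_def algebra_simps)
    ultimately show "norm ((W + h) ^ n - (W + k) ^ n - real n *\<^sub>R (W ^ (n - 1) * (h - k))) \<le> \<tau> * norm (h - k)"
      by (metis mult_right_mono norm_ge_zero norm_mult_ineq order_trans)
  qed
qed

text \<open>The iterates start at 0 and their convergence is part of the result, since symmetries of
  the fixed point are read off along them. For continuity in p it suffices that each \<Phi> p x with
  fixed x is continuous: the contraction bounds the displacement of the fixed point by twice the
  displacement of \<Phi> at it.\<close>

lemma contraction_family:
  fixes \<Phi> :: "'p::metric_space \<Rightarrow> 'a::banach \<Rightarrow> 'a"
  assumes "r \<ge> 0"
    and self: "\<And>p x. p \<in> I \<Longrightarrow> norm x \<le> r \<Longrightarrow> norm (\<Phi> p x) \<le> r"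
    and lip: "\<And>p x y. p \<in> I \<Longrightarrow> norm x \<le> r \<Longrightarrow> norm y \<le> r \<Longrightarrow> norm (\<Phi> p x - \<Phi> p y) \<le> norm (x - y) / 2"
    and cont: "\<And>x. norm x \<le> r \<Longrightarrow> continuous_on I (\<lambda>p. \<Phi> p x)"
  obtains \<rho> where "\<And>p. p \<in> I \<Longrightarrow> norm (\<rho> p) \<le> r" "\<And>p. p \<in> I \<Longrightarrow> \<Phi> p (\<rho> p) = \<rho> p"
    "\<And>p. p \<in> I \<Longrightarrow> (\<lambda>k. (\<Phi> p ^^ k) 0) \<longlonglongrightarrow> \<rho> p" "continuous_on I \<rho>"
proof -
  have "\<exists>!x\<in>cball 0 r. \<Phi> p x = x" if "p \<in> I" for p
    by (rule Banach_fix[where c = "1 / 2"])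
       (use that self lip \<open>r \<ge> 0\<close> in \<open>auto simp: complete_eq_closed dist_norm\<close>)
  then obtain \<rho> where \<rho>: "\<And>p. p \<in> I \<Longrightarrow> norm (\<rho> p) \<le> r" "\<And>p. p \<in> I \<Longrightarrow> \<Phi> p (\<rho> p) = \<rho> p"
    by (metis mem_cball_0)
  moreover have "(\<lambda>k. (\<Phi> p ^^ k) 0) \<longlonglongrightarrow> \<rho> p" if p: "p \<in> I" for p
  proof -
    have b: "norm ((\<Phi> p ^^ k) 0) \<le> r \<and> norm ((\<Phi> p ^^ k) 0 - \<rho> p) \<le> r * (1 / 2) ^ k" for k
    proof (induction k)
      case (Suc k)
      then have "norm (\<Phi> p ((\<Phi> p ^^ k) 0) - \<Phi> p (\<rho> p)) \<le> r * (1 / 2) ^ k / 2"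
        using lip[OF p, of "(\<Phi> p ^^ k) 0" "\<rho> p"] \<rho>(1)[OF p] by linarith
      then show ?case using Suc self[OF p] \<rho>(2)[OF p] by simp
    qed (use \<open>r \<ge> 0\<close> \<rho>(1)[OF p] in auto)
    have "(\<lambda>k. r * (1 / 2) ^ k) \<longlonglongrightarrow> r * 0"
      by (intro tendsto_mult tendsto_const LIMSEQ_power_zero) auto
    then have "(\<lambda>k. r * (1 / 2) ^ k) \<longlonglongrightarrow> 0" by simp
    then have "(\<lambda>k. (\<Phi> p ^^ k) 0 - \<rho> p) \<longlonglongrightarrow> 0"
      by (rule Lim_null_comparison[rotated]) (use b in simp)
    then show ?thesis by (rule LIM_zero_cancel)
  qed
  moreover have "continuous_on I \<rho>"
    unfolding continuous_on_def
  proof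
    fix p assume p: "p \<in> I"
    have le: "norm (\<rho> q - \<rho> p) \<le> 2 * norm (\<Phi> q (\<rho> p) - \<Phi> p (\<rho> p))" if q: "q \<in> I" for q
    proof -
      have "norm (\<rho> q - \<rho> p) \<le> norm (\<Phi> q (\<rho> q) - \<Phi> q (\<rho> p)) + norm (\<Phi> q (\<rho> p) - \<Phi> p (\<rho> p))"
        using norm_triangle_ineq[of "\<Phi> q (\<rho> q) - \<Phi> q (\<rho> p)" "\<Phi> q (\<rho> p) - \<Phi> p (\<rho> p)"] \<rho>(2) p q by simp
      then show ?thesis using lip[OF q \<rho>(1)[OF q] \<rho>(1)[OF p]] by simp
    qed
    have "((\<lambda>q. \<Phi> q (\<rho> p)) \<longlongrightarrow> \<Phi> p (\<rho> p)) (at p within I)"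
      using cont[OF \<rho>(1)[OF p]] p by (simp add: continuous_on_def)
    then have "((\<lambda>q. 2 * norm (\<Phi> q (\<rho> p) - \<Phi> p (\<rho> p))) \<longlongrightarrow> 0) (at p within I)"
      by (auto intro!: tendsto_eq_intros simp: LIM_zero_iff)
    then have "((\<lambda>q. \<rho> q - \<rho> p) \<longlongrightarrow> 0) (at p within I)"
      by (rule Lim_null_comparison[rotated]) (use le in \<open>auto simp: eventually_at_filter\<close>)
    then show "(\<rho> \<longlongrightarrow> \<rho> p) (at p within I)" by (simp add: LIM_zero_iff)
  qed
  ultimately show ?thesis using that by blast
qed

text \<open>The family is continuous pointwise in x, not in the operator norm; the uniform bound K
  makes up for that when the argument moves too.\<close>

lemma continuous_on_operator_family:
  fixes T :: "'p::metric_space \<Rightarrow> 'a::real_normed_vector \<Rightarrow> 'b::real_normed_vector"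
  assumes "\<And>p. p \<in> I \<Longrightarrow> bounded_linear (T p)" "\<And>p x. p \<in> I \<Longrightarrow> norm (T p x) \<le> K * norm x"
    and "\<And>x. continuous_on I (\<lambda>p. T p x)" "continuous_on I y"
  shows "continuous_on I (\<lambda>p. T p (y p))"
  unfolding continuous_on_def
proof
  fix p assume p: "p \<in> I"
  have "((\<lambda>q. K * norm (y q - y p)) \<longlongrightarrow> 0) (at p within I)"
    using assms(4) p unfolding continuous_on_def by (auto intro!: tendsto_eq_intros simp: LIM_zero_iff)
  then have "((\<lambda>q. T q (y q - y p)) \<longlongrightarrow> 0) (at p within I)"
    by (rule Lim_null_comparison[rotated]) (use assms(2) in \<open>auto simp: eventually_at_filter\<close>)
  moreover have "((\<lambda>q. T q (y p)) \<longlongrightarrow> T p (y p)) (at p within I)"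
    using assms(3) p by (simp add: continuous_on_def)
  ultimately have "((\<lambda>q. T q (y q - y p) + T q (y p)) \<longlongrightarrow> 0 + T p (y p)) (at p within I)"
    by (rule tendsto_add)
  moreover have "T q (y q - y p) + T q (y p) = T q (y q)" if "q \<in> I" for q
    using linear_add[OF bounded_linear.linear[OF assms(1)[OF that]], of "y q - y p" "y p"] by simp
  ultimately show "((\<lambda>q. T q (y q)) \<longlongrightarrow> T p (y p)) (at p within I)"
    by (force intro: Lim_transform_eventually simp: eventually_at_filter)
qed

section \<open>The abstract fixed point scheme\<close>

text \<open>No relation is assumed between the data W, b, p1, fd, nor between the operators P, E, S
  beyond uniform bounds and strong continuity. So the contraction applies to translated data as it
  stands; that a fixed point solves the equation is checked separately, in
  \<open>fixed_point_equation\<close>.\<close>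

locale fixed_point_scheme =
  fixes W b p1 fd :: "'a::{real_normed_algebra_1, banach, comm_ring_1}"
    and P E S :: "real \<Rightarrow> 'a \<Rightarrow> 'a" and \<gamma> :: "nat \<Rightarrow> real" and s K \<epsilon>1 :: real and n :: nat
  assumes n: "n > 0" and s: "s > 0" and K: "K > 0" and \<epsilon>1: "\<epsilon>1 > 0"
    and \<gamma>: "summable (\<lambda>j. \<bar>\<gamma> j\<bar> * s ^ j)"
    and linP: "\<And>\<epsilon>. 0 < \<epsilon> \<Longrightarrow> \<epsilon> < \<epsilon>1 \<Longrightarrow> bounded_linear (P \<epsilon>)"
    and linE: "\<And>\<epsilon>. 0 < \<epsilon> \<Longrightarrow> \<epsilon> < \<epsilon>1 \<Longrightarrow> bounded_linear (E \<epsilon>)"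
    and linS: "\<And>\<epsilon>. 0 < \<epsilon> \<Longrightarrow> \<epsilon> < \<epsilon>1 \<Longrightarrow> bounded_linear (S \<epsilon>)"
    and P: "\<And>\<epsilon> x. 0 < \<epsilon> \<Longrightarrow> \<epsilon> < \<epsilon>1 \<Longrightarrow> norm (P \<epsilon> x) \<le> norm x"
    and E: "\<And>\<epsilon> x. 0 < \<epsilon> \<Longrightarrow> \<epsilon> < \<epsilon>1 \<Longrightarrow> norm (E \<epsilon> x) \<le> 2 * norm x"
    and S: "\<And>\<epsilon> x. 0 < \<epsilon> \<Longrightarrow> \<epsilon> < \<epsilon>1 \<Longrightarrow> norm (S \<epsilon> x) \<le> K * norm x"
    and contP: "\<And>x. continuous_on {0<..<\<epsilon>1} (\<lambda>\<epsilon>. P \<epsilon> x)"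
    and contE: "\<And>x. continuous_on {0<..<\<epsilon>1} (\<lambda>\<epsilon>. E \<epsilon> x)"
    and contS: "\<And>x. continuous_on {0<..<\<epsilon>1} (\<lambda>\<epsilon>. S \<epsilon> x)"
begin

text \<open>This is \<epsilon>^-n times g(c + \<epsilon> Y) - f0, with \<open>\<gamma> j\<close> the
  Taylor coefficient of index n + j at c.\<close>

definition \<Gamma> :: "real \<Rightarrow> 'a \<Rightarrow> 'a" where
  "\<Gamma> \<epsilon> Y = (\<Sum>j. (\<gamma> j * \<epsilon> ^ j) *\<^sub>R Y ^ (n + j))"

text \<open>The bracket is the substitution of the overview with v' = S \<rho>. As P (f - f0) equals
  (f - f0) - \<epsilon> \<partial> P (f - f0), it has the primitive W - \<epsilon> P fd, whence the
  last term.\<close>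

definition Yf :: "real \<Rightarrow> 'a \<Rightarrow> 'a" where
  "Yf \<epsilon> \<rho> = W + (S \<epsilon> \<rho> - \<epsilon> ^ n *\<^sub>R P \<epsilon> (p1 + b * S \<epsilon> \<rho>)) - \<epsilon> *\<^sub>R P \<epsilon> fd"

text \<open>Differentiating \<open>Yf\<close> turns the equation for Y into \<partial> v' +
  \<epsilon>^n <a> P v' = \<epsilon>^n P (p0 + a v' + b \<partial> v' - \<Gamma>), where p0 =
  \<gamma> W^n. Its left side is \<epsilon>^n \<rho>, and \<partial> v' is \<epsilon>^n E \<rho>;
  solving for \<rho> gives this map.\<close>

definition \<Phi> :: "real \<Rightarrow> 'a \<Rightarrow> 'a" where
  "\<Phi> \<epsilon> \<rho> = P \<epsilon> (\<epsilon> ^ n *\<^sub>R (b * E \<epsilon> \<rho>) + \<gamma> 0 *\<^sub>R W ^ n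
      + (real n * \<gamma> 0) *\<^sub>R (W ^ (n - 1) * S \<epsilon> \<rho>) - \<Gamma> \<epsilon> (Yf \<epsilon> \<rho>))"

lemma \<Gamma>_term_le:
  fixes Y :: 'a
  assumes "0 \<le> \<epsilon>" "2 * \<epsilon> * R \<le> s" "norm Y \<le> R"
  shows "norm ((\<gamma> j * \<epsilon> ^ j) *\<^sub>R Y ^ (n + j)) \<le> R ^ n * (\<bar>\<gamma> j\<bar> * s ^ j)"
proof -
  have R: "R \<ge> 0" using assms(3) norm_ge_zero order_trans by blast
  have "norm (Y ^ (n + j)) \<le> R ^ (n + j)"
    using assms(3) by (intro order_trans[OF norm_power_ineq] power_mono) auto
  then have "norm ((\<gamma> j * \<epsilon> ^ j) *\<^sub>R Y ^ (n + j)) \<le> \<bar>\<gamma> j\<bar> * \<epsilon> ^ j * R ^ (n + j)"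
    using assms(1) by (simp add: abs_mult mult_left_mono)
  also have "\<dots> = R ^ n * (\<bar>\<gamma> j\<bar> * (\<epsilon> * R) ^ j)"
    by (simp add: power_add power_mult_distrib)
  also have "\<dots> \<le> R ^ n * (\<bar>\<gamma> j\<bar> * s ^ j)"
  proof (intro mult_left_mono power_mono)
    show "\<epsilon> * R \<le> s" using assms(1,2) R mult_nonneg_nonneg[of \<epsilon> R] by linarith
  qed (use assms(1) R in auto)
  finally show ?thesis .
qed

lemma \<Gamma>_summable:
  fixes Y :: 'a
  assumes "0 \<le> \<epsilon>" "2 * \<epsilon> * R \<le> s" "norm Y \<le> R"
  shows "summable (\<lambda>j. (\<gamma> j * \<epsilon> ^ j) *\<^sub>R Y ^ (n + j))"
  by (rule summable_comparison_test'[OF summable_mult[OF \<gamma>], of 0]) (use \<Gamma>_term_le[OF assms] in auto)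

text \<open>The terms beyond the leading one carry a factor \<epsilon>. Differentiating the power of
  exponent n + j + 1 costs that number as a factor; it is at most (n + 2) 2^j, and the 2 in
  \<open>2 * \<epsilon> * R \<le> s\<close> pays for it.\<close>

lemma \<Gamma>_remainder_lipschitz:
  assumes "0 \<le> \<epsilon>" "2 * \<epsilon> * R \<le> s" "norm Y \<le> R" "norm Z \<le> R"
  shows "norm ((\<Gamma> \<epsilon> Y - \<gamma> 0 *\<^sub>R Y ^ n) - (\<Gamma> \<epsilon> Z - \<gamma> 0 *\<^sub>R Z ^ n))
    \<le> \<epsilon> * (R ^ n * (real n + 2) * (\<Sum>j. \<bar>\<gamma> (Suc j)\<bar> * s ^ j)) * norm (Y - Z)"
proof -
  have R: "R \<ge> 0" using assms(3) norm_ge_zero order_trans by blast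
  let ?u = "\<lambda>Y j. (\<gamma> j * \<epsilon> ^ j) *\<^sub>R Y ^ (n + j)"
  have sm: "summable (?u Y)" "summable (?u Z)"
    using \<Gamma>_summable assms by blast+
  have sm': "summable (\<lambda>j. ?u Y (Suc j))" "summable (\<lambda>j. ?u Z (Suc j))"
    using sm summable_Suc_iff[of "?u Y"] summable_Suc_iff[of "?u Z"] by blast+
  have tail: "\<Gamma> \<epsilon> Y - \<gamma> 0 *\<^sub>R Y ^ n = (\<Sum>j. ?u Y (Suc j))" if "summable (?u Y)" for Y
    unfolding \<Gamma>_def using suminf_split_head[OF that] by simp
  have "summable (\<lambda>j. \<bar>\<gamma> (Suc j)\<bar> * s ^ Suc j)"
    using \<gamma> by (subst summable_Suc_iff)
  then have "summable (\<lambda>j. (\<bar>\<gamma> (Suc j)\<bar> * s ^ Suc j) * (1 / s))" by (rule summable_mult2)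
  then have \<gamma>': "summable (\<lambda>j. \<bar>\<gamma> (Suc j)\<bar> * s ^ j)" using s by (simp add: field_simps)
  define C where "C = \<epsilon> * (R ^ n * (real n + 2)) * norm (Y - Z)"
  have le: "norm (?u Y (Suc j) - ?u Z (Suc j)) \<le> C * (\<bar>\<gamma> (Suc j)\<bar> * s ^ j)" for j
  proof -
    have "real (n + Suc j) * (\<epsilon> * R) ^ j \<le> real (n + Suc j) * (s / 2) ^ j"
      using assms(1,2) R by (intro mult_left_mono power_mono) auto
    also have "\<dots> = (real (n + Suc j) / 2 ^ j) * s ^ j" by (simp add: power_divide)
    also have "\<dots> \<le> (real n + 2) * s ^ j"
    proof (rule mult_right_mono)
      have "real j \<le> 2 ^ j" using less_imp_le[OF of_nat_less_two_power[of j]] by simp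
      moreover have "real n * 1 \<le> real n * 2 ^ j" "(1 :: real) \<le> 2 ^ j" by (intro mult_left_mono) auto
      ultimately have "real n + 1 + real j \<le> real n * 2 ^ j + 2 ^ j + 2 ^ j" by linarith
      then have "real (n + Suc j) \<le> (real n + 2) * 2 ^ j" by (simp add: algebra_simps)
      then show "real (n + Suc j) / 2 ^ j \<le> real n + 2" by (simp add: field_simps)
    qed (use s in auto)
    finally have poly: "real (n + Suc j) * (\<epsilon> * R) ^ j \<le> (real n + 2) * s ^ j" .
    have "norm (Y ^ (n + Suc j) - Z ^ (n + Suc j)) \<le> real (n + Suc j) * R ^ (n + j) * norm (Y - Z)"
      using norm_power_diff_le[OF assms(3,4), of "n + Suc j"] by simp
    then have "norm (?u Y (Suc j) - ?u Z (Suc j)) \<le> \<bar>\<gamma> (Suc j)\<bar> * \<epsilon> ^ Suc j * (real (n + Suc j) * R ^ (n + j) * norm (Y - Z))"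
      unfolding scaleR_diff_right[symmetric] norm_scaleR using assms(1)
      by (auto simp: abs_mult intro!: mult_left_mono)
    also have "\<dots> = \<epsilon> * R ^ n * norm (Y - Z) * \<bar>\<gamma> (Suc j)\<bar> * (real (n + Suc j) * (\<epsilon> * R) ^ j)"
      by (simp add: power_add power_mult_distrib)
    also have "\<dots> \<le> \<epsilon> * R ^ n * norm (Y - Z) * \<bar>\<gamma> (Suc j)\<bar> * ((real n + 2) * s ^ j)"
      using assms(1) R by (intro mult_left_mono poly) auto
    finally have "norm (?u Y (Suc j) - ?u Z (Suc j)) \<le> \<epsilon> * R ^ n * norm (Y - Z) * \<bar>\<gamma> (Suc j)\<bar> * ((real n + 2) * s ^ j)" .
    then show ?thesis by (simp add: C_def mult_ac)
  qed
  have "norm (\<Sum>j. ?u Y (Suc j) - ?u Z (Suc j)) \<le> (\<Sum>j. C * (\<bar>\<gamma> (Suc j)\<bar> * s ^ j))"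
    by (rule norm_suminf_le[OF le summable_mult[OF \<gamma>']])
  also have "\<dots> = C * (\<Sum>j. \<bar>\<gamma> (Suc j)\<bar> * s ^ j)" by (rule suminf_mult[OF \<gamma>'])
  finally show ?thesis
    unfolding tail[OF sm(1)] tail[OF sm(2)] suminf_diff[OF sm'] by (simp add: C_def mult_ac)
qed

text \<open>The leading term is handled by \<open>power_strict_derivative\<close> on a small ball,
  with a prescribed tolerance; the rest is of order \<epsilon> on the whole unit ball around W. The
  last bound compares with the value at 0, where everything vanishes because n > 0.\<close>

lemma \<Gamma>_strict_derivative:
  obtains r L where "0 < r" "r \<le> 1" "L \<ge> 0"
    and "\<And>\<epsilon> h k. 0 \<le> \<epsilon> \<Longrightarrow> 2 * \<epsilon> * (norm W + 1) \<le> s \<Longrightarrow> norm h \<le> r \<Longrightarrow> norm k \<le> r \<Longrightarrow>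
      norm ((\<Gamma> \<epsilon> (W + h) - \<Gamma> \<epsilon> (W + k)) - (real n * \<gamma> 0) *\<^sub>R (W ^ (n - 1) * (h - k)))
        \<le> (1 / (16 * K) + \<epsilon> * L) * norm (h - k)"
    and "\<And>\<epsilon>. 0 \<le> \<epsilon> \<Longrightarrow> 2 * \<epsilon> * (norm W + 1) \<le> s \<Longrightarrow> norm (\<Gamma> \<epsilon> W - \<gamma> 0 *\<^sub>R W ^ n) \<le> \<epsilon> * L"
proof -
  define R where "R = norm W + 1"
  define L where "L = R ^ n * (real n + 2) * (\<Sum>j. \<bar>\<gamma> (Suc j)\<bar> * s ^ j)"
  have R: "R \<ge> 1" by (simp add: R_def)
  have "summable (\<lambda>j. \<bar>\<gamma> (Suc j)\<bar> * s ^ Suc j)"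
    using \<gamma> by (subst summable_Suc_iff)
  then have "summable (\<lambda>j. (\<bar>\<gamma> (Suc j)\<bar> * s ^ Suc j) * (1 / s))" by (rule summable_mult2)
  then have "summable (\<lambda>j. \<bar>\<gamma> (Suc j)\<bar> * s ^ j)" using s by (simp add: field_simps)
  then have L: "L \<ge> 0"
    unfolding L_def using R s by (intro mult_nonneg_nonneg suminf_nonneg) auto
  \<comment> \<open>The tolerance is tuned to 1 / (16 K) because the increment fed into \<Gamma>
    later has Lipschitz constant 2 K in \<rho>, which leaves 1/8. The added 1 avoids a division by
    0.\<close>
  have pos: "1 / (16 * K * (\<bar>\<gamma> 0\<bar> + 1)) > 0" using K by simp
  obtain r0 where r0: "r0 > 0" and strict: "\<And>h k. norm h \<le> r0 \<Longrightarrow> norm k \<le> r0 \<Longrightarrow>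
    norm ((W + h) ^ n - (W + k) ^ n - real n *\<^sub>R (W ^ (n - 1) * (h - k))) \<le> 1 / (16 * K * (\<bar>\<gamma> 0\<bar> + 1)) * norm (h - k)"
    by (rule power_strict_derivative[OF pos, of W n]) blast
  show ?thesis
  proof
    show "0 < min 1 r0" "min 1 r0 \<le> 1" using r0 by auto
    show "L * R \<ge> 0" using L R by simp
    fix \<epsilon> :: real assume \<epsilon>: "0 \<le> \<epsilon>" "2 * \<epsilon> * (norm W + 1) \<le> s"
    have "norm ((\<Gamma> \<epsilon> W - \<gamma> 0 *\<^sub>R W ^ n) - (\<Gamma> \<epsilon> 0 - \<gamma> 0 *\<^sub>R 0 ^ n)) \<le> \<epsilon> * L * norm (W - 0)"
      unfolding L_def by (rule \<Gamma>_remainder_lipschitz) (use \<epsilon> in \<open>auto simp: R_def\<close>)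
    moreover have z: "(0 :: 'a) ^ (n + j) = 0" for j by (rule zero_power) (use n in simp)
    moreover have "\<Gamma> \<epsilon> 0 = 0" by (simp add: \<Gamma>_def z)
    moreover have "(0 :: 'a) ^ n = 0" by (rule zero_power[OF n])
    moreover have "\<epsilon> * L * norm (W - 0) \<le> \<epsilon> * (L * R)"
      using \<epsilon>(1) L by (simp add: R_def mult.assoc mult_left_mono)
    ultimately show "norm (\<Gamma> \<epsilon> W - \<gamma> 0 *\<^sub>R W ^ n) \<le> \<epsilon> * (L * R)" by simp
    fix h k :: 'a assume hk: "norm h \<le> min 1 r0" "norm k \<le> min 1 r0"
    have "norm (W + h) \<le> R" "norm (W + k) \<le> R"
      using hk norm_triangle_ineq[of W h] norm_triangle_ineq[of W k] by (auto simp: R_def)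
    then have a: "norm ((\<Gamma> \<epsilon> (W + h) - \<gamma> 0 *\<^sub>R (W + h) ^ n) - (\<Gamma> \<epsilon> (W + k) - \<gamma> 0 *\<^sub>R (W + k) ^ n))
        \<le> \<epsilon> * L * norm ((W + h) - (W + k))"
      unfolding L_def by (intro \<Gamma>_remainder_lipschitz) (use \<epsilon> in \<open>auto simp: R_def\<close>)
    also have "\<dots> \<le> \<epsilon> * (L * R) * norm (h - k)"
      using \<epsilon>(1) L R by (auto intro!: mult_right_mono mult_left_mono simp: mult_le_cancel_left1)
    finally have a: "norm ((\<Gamma> \<epsilon> (W + h) - \<gamma> 0 *\<^sub>R (W + h) ^ n) - (\<Gamma> \<epsilon> (W + k) - \<gamma> 0 *\<^sub>R (W + k) ^ n))
        \<le> \<epsilon> * (L * R) * norm (h - k)" .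
    have "norm (\<gamma> 0 *\<^sub>R ((W + h) ^ n - (W + k) ^ n - real n *\<^sub>R (W ^ (n - 1) * (h - k))))
        \<le> \<bar>\<gamma> 0\<bar> * (1 / (16 * K * (\<bar>\<gamma> 0\<bar> + 1)) * norm (h - k))"
      unfolding norm_scaleR by (rule mult_left_mono[OF strict]) (use hk in auto)
    also have "\<dots> = (\<bar>\<gamma> 0\<bar> / (\<bar>\<gamma> 0\<bar> + 1)) * (1 / (16 * K) * norm (h - k))"
      using K by (simp add: field_simps)
    also have "\<dots> \<le> 1 * (1 / (16 * K) * norm (h - k))"
      using K by (intro mult_right_mono) (auto simp: divide_le_eq_1)
    finally have b: "norm (\<gamma> 0 *\<^sub>R ((W + h) ^ n - (W + k) ^ n - real n *\<^sub>R (W ^ (n - 1) * (h - k))))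
        \<le> 1 / (16 * K) * norm (h - k)" by simp
    have "(\<Gamma> \<epsilon> (W + h) - \<Gamma> \<epsilon> (W + k)) - (real n * \<gamma> 0) *\<^sub>R (W ^ (n - 1) * (h - k))
      = ((\<Gamma> \<epsilon> (W + h) - \<gamma> 0 *\<^sub>R (W + h) ^ n) - (\<Gamma> \<epsilon> (W + k) - \<gamma> 0 *\<^sub>R (W + k) ^ n))
        + \<gamma> 0 *\<^sub>R ((W + h) ^ n - (W + k) ^ n - real n *\<^sub>R (W ^ (n - 1) * (h - k)))"
      by (simp add: scaleR_diff_right mult.commute)
    then show "norm ((\<Gamma> \<epsilon> (W + h) - \<Gamma> \<epsilon> (W + k)) - (real n * \<gamma> 0) *\<^sub>R (W ^ (n - 1) * (h - k)))
        \<le> (1 / (16 * K) + \<epsilon> * (L * R)) * norm (h - k)"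
      using norm_triangle_mono[OF a b] by (simp only: distrib_right add.commute)
  qed
qed

lemma \<Gamma>_continuous:
  assumes "continuous_on I Y" "\<And>\<epsilon>. \<epsilon> \<in> I \<Longrightarrow> 0 \<le> \<epsilon> \<and> 2 * \<epsilon> * R \<le> s \<and> norm (Y \<epsilon>) \<le> R"
  shows "continuous_on I (\<lambda>\<epsilon>. \<Gamma> \<epsilon> (Y \<epsilon>))"
  unfolding \<Gamma>_def
proof (rule uniform_limit_theorem)
  show "\<forall>\<^sub>F m in sequentially. continuous_on I (\<lambda>\<epsilon>. \<Sum>j<m. (\<gamma> j * \<epsilon> ^ j) *\<^sub>R Y \<epsilon> ^ (n + j))"
    by (intro always_eventually allI continuous_intros assms(1))
  show "uniform_limit I (\<lambda>m \<epsilon>. \<Sum>j<m. (\<gamma> j * \<epsilon> ^ j) *\<^sub>R Y \<epsilon> ^ (n + j))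
      (\<lambda>\<epsilon>. \<Sum>j. (\<gamma> j * \<epsilon> ^ j) *\<^sub>R Y \<epsilon> ^ (n + j)) sequentially"
    by (rule Weierstrass_m_test[OF \<Gamma>_term_le summable_mult[OF \<gamma>]]) (use assms(2) in auto)
qed simp

text \<open>With Yf = W + H, the linear term of \<Phi> cancels the derivative of \<Gamma> at W up to
  corrections of order \<epsilon>. What remains is the strict derivative remainder, small on a small
  ball, and terms with a factor \<epsilon>; these are arranged in two groups that contribute 1/4
  each to the Lipschitz constant.\<close>

lemma \<Phi>_contraction:
  obtains \<epsilon>0 r where "0 < \<epsilon>0" "\<epsilon>0 \<le> \<epsilon>1" "\<epsilon>0 \<le> 1" "0 < r" "2 * \<epsilon>0 * (norm W + 1) \<le> s"
    and "\<And>\<epsilon> \<rho>. \<epsilon> \<in> {0<..<\<epsilon>0} \<Longrightarrow> norm \<rho> \<le> r \<Longrightarrow> norm (Yf \<epsilon> \<rho>) \<le> norm W + 1"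
    and "\<And>\<epsilon> \<rho>. \<epsilon> \<in> {0<..<\<epsilon>0} \<Longrightarrow> norm \<rho> \<le> r \<Longrightarrow> norm (\<Phi> \<epsilon> \<rho>) \<le> r"
    and "\<And>\<epsilon> \<rho> \<rho>'. \<epsilon> \<in> {0<..<\<epsilon>0} \<Longrightarrow> norm \<rho> \<le> r \<Longrightarrow> norm \<rho>' \<le> r \<Longrightarrow>
      norm (\<Phi> \<epsilon> \<rho> - \<Phi> \<epsilon> \<rho>') \<le> norm (\<rho> - \<rho>') / 2"
proof -
  obtain r1 L where r1: "0 < r1" "r1 \<le> 1" and L: "L \<ge> 0"
    and strict: "\<And>\<epsilon> h k. 0 \<le> \<epsilon> \<Longrightarrow> 2 * \<epsilon> * (norm W + 1) \<le> s \<Longrightarrow> norm h \<le> r1 \<Longrightarrow> norm k \<le> r1 \<Longrightarrow>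
      norm ((\<Gamma> \<epsilon> (W + h) - \<Gamma> \<epsilon> (W + k)) - (real n * \<gamma> 0) *\<^sub>R (W ^ (n - 1) * (h - k)))
        \<le> (1 / (16 * K) + \<epsilon> * L) * norm (h - k)"
    and base: "\<And>\<epsilon>. 0 \<le> \<epsilon> \<Longrightarrow> 2 * \<epsilon> * (norm W + 1) \<le> s \<Longrightarrow> norm (\<Gamma> \<epsilon> W - \<gamma> 0 *\<^sub>R W ^ n) \<le> \<epsilon> * L"
    by (rule \<Gamma>_strict_derivative) blast
  \<comment> \<open>K r \<le> r1 / 2 leaves the other half of the radius r1 to the corrections
    \<open>D\<close>.\<close>
  define r where "r = min 1 (r1 / (2 * K))"
  define A where "A = (real n * \<gamma> 0) *\<^sub>R W ^ (n - 1)"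
  define M where "M = norm p1 + norm b * K + norm fd"
  have r: "0 < r" "r \<le> 1" "K * r \<le> r1 / 2"
    using r1 K by (auto simp: r_def min_def field_simps)
  have M: "M \<ge> 0" using K by (simp add: M_def)
  \<comment> \<open>Sums every coefficient that meets a factor \<epsilon> below, so that the single
    condition \<epsilon> \<le> q / Q bounds each product by q.\<close>
  define Q where "Q = 1 + norm b + 2 * K * L + (2 * norm b + norm A * norm b * K) + M
    + (norm A * M + M / (8 * K) + L) + 2 * (norm W + 1)"
  define q where "q = min (1 / 8) (min (r / 2) (min (r1 / 2) s))"
  have q: "q > 0" "q \<le> 1 / 8" "q \<le> r / 2" "q \<le> r1 / 2" "q \<le> s" using r r1 s by (auto simp: q_def)
  have parts: "0 \<le> norm b" "0 \<le> 2 * K * L" "0 \<le> 2 * norm b + norm A * norm b * K"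
    "0 \<le> norm A * M + M / (8 * K) + L" "0 \<le> 2 * (norm W + 1)"
    using K L M by auto
  then have Q: "Q \<ge> 1" using M unfolding Q_def by linarith
  define \<epsilon>0 where "\<epsilon>0 = min \<epsilon>1 (q / Q)"
  have \<epsilon>0: "\<epsilon>0 > 0" "\<epsilon>0 \<le> \<epsilon>1" using q Q \<epsilon>1 by (auto simp: \<epsilon>0_def)
  have small: "\<epsilon> * c \<le> q" if "0 \<le> \<epsilon>" "\<epsilon> \<le> \<epsilon>0" "0 \<le> c" "c \<le> Q" for \<epsilon> c
  proof -
    have "\<epsilon> * c \<le> (q / Q) * Q" using that q Q by (intro mult_mono) (auto simp: \<epsilon>0_def)
    then show ?thesis using Q by simp
  qed
  have s1: "\<epsilon> * 1 \<le> q" "\<epsilon> * norm b \<le> q" "\<epsilon> * (2 * K * L) \<le> q" "\<epsilon> * (2 * norm b + norm A * norm b * K) \<le> q"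
    "\<epsilon> * M \<le> q" "\<epsilon> * (norm A * M + M / (8 * K) + L) \<le> q" "\<epsilon> * (2 * (norm W + 1)) \<le> q"
    if "0 \<le> \<epsilon>" "\<epsilon> \<le> \<epsilon>0" for \<epsilon>
  proof -
    have "c \<le> q" if "c = \<epsilon> * c'" "0 \<le> c'" "c' \<le> Q" for c c'
      using small[OF \<open>0 \<le> \<epsilon>\<close> \<open>\<epsilon> \<le> \<epsilon>0\<close> that(2,3)] that(1) by simp
    note * = this[OF refl]
    have Qs: "0 \<le> M" "1 \<le> Q" "norm b \<le> Q" "2 * K * L \<le> Q" "2 * norm b + norm A * norm b * K \<le> Q" "M \<le> Q"
      "norm A * M + M / (8 * K) + L \<le> Q" "2 * (norm W + 1) \<le> Q"
      using parts M unfolding Q_def by linarith+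
    show "\<epsilon> * 1 \<le> q" "\<epsilon> * norm b \<le> q" "\<epsilon> * (2 * K * L) \<le> q" "\<epsilon> * (2 * norm b + norm A * norm b * K) \<le> q"
      "\<epsilon> * M \<le> q" "\<epsilon> * (norm A * M + M / (8 * K) + L) \<le> q" "\<epsilon> * (2 * (norm W + 1)) \<le> q"
      by (rule *, (rule parts Qs zero_le_one)+)+
  qed
  \<comment> \<open>\<open>D\<close> gathers the corrections of order \<epsilon>; the power
    \<epsilon>^n counts as \<epsilon>, since n > 0 and \<epsilon> \<le> 1.\<close>
  define D where "D = (\<lambda>\<epsilon> \<rho>. \<epsilon> ^ n *\<^sub>R P \<epsilon> (p1 + b * S \<epsilon> \<rho>) + \<epsilon> *\<^sub>R P \<epsilon> fd)"
  define H where "H = (\<lambda>\<epsilon> \<rho>. S \<epsilon> \<rho> - D \<epsilon> \<rho>)"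
  have Yf: "Yf \<epsilon> \<rho> = W + H \<epsilon> \<rho>" for \<epsilon> \<rho>
    by (simp add: Yf_def H_def D_def)
  have e2: "0 < \<epsilon>" "\<epsilon> < \<epsilon>1" "\<epsilon> \<le> \<epsilon>0" "0 \<le> \<epsilon>" "\<epsilon> ^ n \<le> \<epsilon>" "2 * \<epsilon> * (norm W + 1) \<le> s" "\<epsilon> \<le> 1"
    if "\<epsilon> \<in> {0<..<\<epsilon>0}" for \<epsilon>
  proof -
    show b: "0 < \<epsilon>" "\<epsilon> < \<epsilon>1" "\<epsilon> \<le> \<epsilon>0" "0 \<le> \<epsilon>" using that \<epsilon>0 by auto
    show e1: "\<epsilon> \<le> 1" using s1(1)[OF b(4,3)] q by simp
    show "\<epsilon> ^ n \<le> \<epsilon>" using power_decreasing[of 1 n \<epsilon>] n b e1 by simp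
    show "2 * \<epsilon> * (norm W + 1) \<le> s" using s1(7)[OF b(4,3)] q by (simp add: mult_ac)
  qed
  have Dle: "norm (D \<epsilon> \<rho>) \<le> \<epsilon> * M" if \<epsilon>: "\<epsilon> \<in> {0<..<\<epsilon>0}" and \<rho>: "norm \<rho> \<le> r" for \<epsilon> \<rho>
  proof -
    note e = e2[OF \<epsilon>]
    have "norm (S \<epsilon> \<rho>) \<le> K * 1"
      using S[OF e(1,2), of \<rho>] mult_left_mono[of "norm \<rho>" 1 K] \<rho> r K by linarith
    then have "norm (b * S \<epsilon> \<rho>) \<le> norm b * K"
      by (intro order_trans[OF norm_mult_ineq] mult_left_mono) auto
    then have "norm (P \<epsilon> (p1 + b * S \<epsilon> \<rho>)) \<le> norm p1 + norm b * K"
      using P[OF e(1,2), of "p1 + b * S \<epsilon> \<rho>"] norm_triangle_ineq[of p1 "b * S \<epsilon> \<rho>"] by linarith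
    then have "norm (\<epsilon> ^ n *\<^sub>R P \<epsilon> (p1 + b * S \<epsilon> \<rho>)) \<le> \<epsilon> * (norm p1 + norm b * K)"
      using e by (simp add: mult_mono)
    moreover have "norm (\<epsilon> *\<^sub>R P \<epsilon> fd) \<le> \<epsilon> * norm fd"
      using P[OF e(1,2), of fd] e by (simp add: mult_left_mono)
    ultimately have "norm (D \<epsilon> \<rho>) \<le> \<epsilon> * (norm p1 + norm b * K) + \<epsilon> * norm fd"
      unfolding D_def by (rule norm_triangle_mono)
    then show ?thesis by (simp add: M_def distrib_left)
  qed
  have Ddiff: "norm (D \<epsilon> \<rho> - D \<epsilon> \<rho>') \<le> \<epsilon> * norm b * K * norm (\<rho> - \<rho>')"
    and Sdiff: "S \<epsilon> \<rho> - S \<epsilon> \<rho>' = S \<epsilon> (\<rho> - \<rho>')" and Ediff: "E \<epsilon> \<rho> - E \<epsilon> \<rho>' = E \<epsilon> (\<rho> - \<rho>')"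
    and Pdiff: "P \<epsilon> \<rho> - P \<epsilon> \<rho>' = P \<epsilon> (\<rho> - \<rho>')"
    if \<epsilon>: "\<epsilon> \<in> {0<..<\<epsilon>0}" for \<epsilon> \<rho> \<rho>'
  proof -
    note e = e2[OF \<epsilon>]
    show Sd: "S \<epsilon> \<rho> - S \<epsilon> \<rho>' = S \<epsilon> (\<rho> - \<rho>')"
      using linS[OF e(1,2)] by (simp add: linear_diff bounded_linear.linear)
    show "E \<epsilon> \<rho> - E \<epsilon> \<rho>' = E \<epsilon> (\<rho> - \<rho>')"
      using linE[OF e(1,2)] by (simp add: linear_diff bounded_linear.linear)
    have Pd: "P \<epsilon> x - P \<epsilon> y = P \<epsilon> (x - y)" for x y
      using linP[OF e(1,2)] by (simp add: linear_diff bounded_linear.linear)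
    then show "P \<epsilon> \<rho> - P \<epsilon> \<rho>' = P \<epsilon> (\<rho> - \<rho>')" .
    have "D \<epsilon> \<rho> - D \<epsilon> \<rho>' = \<epsilon> ^ n *\<^sub>R (P \<epsilon> (p1 + b * S \<epsilon> \<rho>) - P \<epsilon> (p1 + b * S \<epsilon> \<rho>'))"
      by (simp add: D_def scaleR_diff_right)
    also have "\<dots> = \<epsilon> ^ n *\<^sub>R P \<epsilon> (b * S \<epsilon> (\<rho> - \<rho>'))"
      unfolding Pd by (simp add: Sd[symmetric] right_diff_distrib)
    finally have "norm (D \<epsilon> \<rho> - D \<epsilon> \<rho>') = \<epsilon> ^ n * norm (P \<epsilon> (b * S \<epsilon> (\<rho> - \<rho>')))"
      using e by simp
    also have "\<dots> \<le> \<epsilon> * (norm b * (K * norm (\<rho> - \<rho>')))"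
      using e P[OF e(1,2)] S[OF e(1,2)]
      by (intro mult_mono order_trans[OF P[OF e(1,2)]] order_trans[OF norm_mult_ineq] mult_left_mono) auto
    finally show "norm (D \<epsilon> \<rho> - D \<epsilon> \<rho>') \<le> \<epsilon> * norm b * K * norm (\<rho> - \<rho>')" by (simp add: mult_ac)
  qed
  have Hle: "norm (H \<epsilon> \<rho>) \<le> r1" if \<epsilon>: "\<epsilon> \<in> {0<..<\<epsilon>0}" and \<rho>: "norm \<rho> \<le> r" for \<epsilon> \<rho>
  proof -
    note e = e2[OF \<epsilon>]
    have "norm (S \<epsilon> \<rho>) \<le> r1 / 2"
      using S[OF e(1,2), of \<rho>] mult_left_mono[OF \<rho>, of K] r K by linarith
    moreover have "norm (D \<epsilon> \<rho>) \<le> r1 / 2"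
      using Dle[OF that] s1(5)[OF e(4,3)] q by linarith
    ultimately show ?thesis unfolding H_def using norm_triangle_ineq4[of "S \<epsilon> \<rho>" "D \<epsilon> \<rho>"] by linarith
  qed
  \<comment> \<open>The product of A with S \<rho> is split into A D and A H, so that A H can be
    paired with the linear part of \<Gamma> at W.\<close>
  have \<Phi>: "\<Phi> \<epsilon> \<rho> = P \<epsilon> (\<epsilon> ^ n *\<^sub>R (b * E \<epsilon> \<rho>) + A * D \<epsilon> \<rho>
      - (\<Gamma> \<epsilon> (W + H \<epsilon> \<rho>) - \<gamma> 0 *\<^sub>R W ^ n - A * H \<epsilon> \<rho>))" for \<epsilon> \<rho>
  proof -
    have *: "A * D \<epsilon> \<rho> + A * H \<epsilon> \<rho> = (real n * \<gamma> 0) *\<^sub>R (W ^ (n - 1) * S \<epsilon> \<rho>)"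
      by (simp add: H_def A_def right_diff_distrib scaleR_diff_right)
    show ?thesis unfolding \<Phi>_def Yf *[symmetric] by (simp add: algebra_simps)
  qed
  have lip: "norm (\<Phi> \<epsilon> \<rho> - \<Phi> \<epsilon> \<rho>') \<le> norm (\<rho> - \<rho>') / 2"
    if \<epsilon>: "\<epsilon> \<in> {0<..<\<epsilon>0}" and \<rho>: "norm \<rho> \<le> r" "norm \<rho>' \<le> r" for \<epsilon> \<rho> \<rho>'
  proof -
    note e = e2[OF \<epsilon>]
    let ?d = "norm (\<rho> - \<rho>')"
    have "norm (H \<epsilon> \<rho> - H \<epsilon> \<rho>') \<le> norm (S \<epsilon> (\<rho> - \<rho>')) + norm (D \<epsilon> \<rho> - D \<epsilon> \<rho>')"
      unfolding H_def Sdiff[OF \<epsilon>, symmetric]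
      using norm_triangle_ineq4[of "S \<epsilon> \<rho> - S \<epsilon> \<rho>'" "D \<epsilon> \<rho> - D \<epsilon> \<rho>'"] by (simp add: algebra_simps)
    also have "\<dots> \<le> K * ?d + \<epsilon> * norm b * K * ?d"
      by (intro add_mono S[OF e(1,2)] Ddiff[OF \<epsilon>])
    also have "\<epsilon> * norm b * K * ?d \<le> 1 * K * ?d"
      using s1(2)[OF e(4,3)] q K by (intro mult_right_mono) auto
    finally have Hd: "norm (H \<epsilon> \<rho> - H \<epsilon> \<rho>') \<le> 2 * K * ?d" by simp
    have "norm ((\<Gamma> \<epsilon> (W + H \<epsilon> \<rho>) - \<Gamma> \<epsilon> (W + H \<epsilon> \<rho>')) - A * (H \<epsilon> \<rho> - H \<epsilon> \<rho>'))
        \<le> (1 / (16 * K) + \<epsilon> * L) * norm (H \<epsilon> \<rho> - H \<epsilon> \<rho>')"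
      using strict[OF e(4,6) Hle[OF \<epsilon> \<rho>(1)] Hle[OF \<epsilon> \<rho>(2)]] by (simp add: A_def)
    also have "\<dots> \<le> (1 / (16 * K) + \<epsilon> * L) * (2 * K * ?d)"
      using K e L by (intro mult_left_mono Hd) auto
    also have "\<dots> = (1 / 8 + \<epsilon> * (2 * K * L)) * ?d" using K by (simp add: field_simps)
    also have "\<dots> \<le> (1 / 4) * ?d"
      using s1(3)[OF e(4,3)] q by (intro mult_right_mono) auto
    finally have g: "norm ((\<Gamma> \<epsilon> (W + H \<epsilon> \<rho>) - \<Gamma> \<epsilon> (W + H \<epsilon> \<rho>')) - A * (H \<epsilon> \<rho> - H \<epsilon> \<rho>')) \<le> (1 / 4) * ?d" .
    have "norm (\<epsilon> ^ n *\<^sub>R (b * E \<epsilon> (\<rho> - \<rho>'))) \<le> \<epsilon> * (norm b * (2 * ?d))"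
      using e E[OF e(1,2), of "\<rho> - \<rho>'"]
      by (auto intro!: mult_mono order_trans[OF norm_mult_ineq] mult_left_mono)
    moreover have "norm (A * (D \<epsilon> \<rho> - D \<epsilon> \<rho>')) \<le> norm A * (\<epsilon> * norm b * K * ?d)"
      by (intro order_trans[OF norm_mult_ineq] mult_left_mono Ddiff[OF \<epsilon>]) auto
    ultimately have "norm (\<epsilon> ^ n *\<^sub>R (b * E \<epsilon> (\<rho> - \<rho>')) + A * (D \<epsilon> \<rho> - D \<epsilon> \<rho>'))
        \<le> \<epsilon> * (norm b * (2 * ?d)) + norm A * (\<epsilon> * norm b * K * ?d)"
      by (rule norm_triangle_mono)
    also have "\<dots> = \<epsilon> * (2 * norm b + norm A * norm b * K) * ?d" by (simp add: algebra_simps)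
    also have "\<dots> \<le> (1 / 4) * ?d"
      using s1(4)[OF e(4,3)] q by (intro mult_right_mono) auto
    finally have f: "norm (\<epsilon> ^ n *\<^sub>R (b * E \<epsilon> (\<rho> - \<rho>')) + A * (D \<epsilon> \<rho> - D \<epsilon> \<rho>')) \<le> (1 / 4) * ?d" .
    have "\<Phi> \<epsilon> \<rho> - \<Phi> \<epsilon> \<rho>' = P \<epsilon> ((\<epsilon> ^ n *\<^sub>R (b * E \<epsilon> (\<rho> - \<rho>')) + A * (D \<epsilon> \<rho> - D \<epsilon> \<rho>'))
        - ((\<Gamma> \<epsilon> (W + H \<epsilon> \<rho>) - \<Gamma> \<epsilon> (W + H \<epsilon> \<rho>')) - A * (H \<epsilon> \<rho> - H \<epsilon> \<rho>')))"
      unfolding \<Phi> Pdiff[OF \<epsilon>] Ediff[OF \<epsilon>, symmetric] by (simp add: algebra_simps)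
    then have "norm (\<Phi> \<epsilon> \<rho> - \<Phi> \<epsilon> \<rho>') \<le> norm ((\<epsilon> ^ n *\<^sub>R (b * E \<epsilon> (\<rho> - \<rho>')) + A * (D \<epsilon> \<rho> - D \<epsilon> \<rho>'))
        - ((\<Gamma> \<epsilon> (W + H \<epsilon> \<rho>) - \<Gamma> \<epsilon> (W + H \<epsilon> \<rho>')) - A * (H \<epsilon> \<rho> - H \<epsilon> \<rho>')))"
      using P[OF e(1,2)] by simp
    also have "\<dots> \<le> (1 / 4) * ?d + (1 / 4) * ?d"
      by (rule order_trans[OF norm_triangle_ineq4 add_mono[OF f g]])
    finally show ?thesis by simp
  qed
  \<comment> \<open>At \<rho> = 0 only corrections of order \<epsilon> are left, among them the
    deviation of \<Gamma> at W from its leading term. This uses half of the radius and leaves the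
    other half to the contraction.\<close>
  have self0: "norm (\<Phi> \<epsilon> 0) \<le> r / 2" if \<epsilon>: "\<epsilon> \<in> {0<..<\<epsilon>0}" for \<epsilon>
  proof -
    note e = e2[OF \<epsilon>]
    have z: "S \<epsilon> 0 = 0" "E \<epsilon> 0 = 0"
      using linS[OF e(1,2)] linE[OF e(1,2)] by (simp_all add: linear_0 bounded_linear.linear)
    have D0: "norm (D \<epsilon> 0) \<le> \<epsilon> * M" by (rule Dle[OF \<epsilon>]) (use r in simp)
    then have H0: "norm (H \<epsilon> 0) \<le> \<epsilon> * M" by (simp add: H_def z)
    have "norm ((\<Gamma> \<epsilon> (W + H \<epsilon> 0) - \<Gamma> \<epsilon> (W + 0)) - A * (H \<epsilon> 0 - 0))
        \<le> (1 / (16 * K) + \<epsilon> * L) * norm (H \<epsilon> 0 - 0)"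
      using strict[OF e(4,6) Hle[OF \<epsilon>, of 0], of 0] r r1 by (simp add: A_def)
    also have "\<dots> \<le> (1 / (8 * K)) * (\<epsilon> * M)"
    proof (rule mult_mono)
      have "\<epsilon> * (2 * K * L) \<le> 1 / 8" using s1(3)[OF e(4,3)] q by linarith
      then show "1 / (16 * K) + \<epsilon> * L \<le> 1 / (8 * K)" using K by (simp add: field_simps)
    qed (use H0 K in auto)
    finally have g1: "norm ((\<Gamma> \<epsilon> (W + H \<epsilon> 0) - \<Gamma> \<epsilon> W) - A * H \<epsilon> 0) \<le> \<epsilon> * (M / (8 * K))"
      by (simp add: mult_ac)
    have g2: "norm (\<Gamma> \<epsilon> W - \<gamma> 0 *\<^sub>R W ^ n) \<le> \<epsilon> * L" by (rule base[OF e(4,6)])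
    have g3: "norm (A * D \<epsilon> 0) \<le> norm A * (\<epsilon> * M)"
      by (intro order_trans[OF norm_mult_ineq] mult_left_mono D0) auto
    have "\<Phi> \<epsilon> 0 = P \<epsilon> (A * D \<epsilon> 0 - (((\<Gamma> \<epsilon> (W + H \<epsilon> 0) - \<Gamma> \<epsilon> W) - A * H \<epsilon> 0) + (\<Gamma> \<epsilon> W - \<gamma> 0 *\<^sub>R W ^ n)))"
      unfolding \<Phi> z by (simp add: algebra_simps)
    then have "norm (\<Phi> \<epsilon> 0) \<le> norm (A * D \<epsilon> 0 - (((\<Gamma> \<epsilon> (W + H \<epsilon> 0) - \<Gamma> \<epsilon> W) - A * H \<epsilon> 0) + (\<Gamma> \<epsilon> W - \<gamma> 0 *\<^sub>R W ^ n)))"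
      using P[OF e(1,2)] by simp
    also have "\<dots> \<le> norm A * (\<epsilon> * M) + (\<epsilon> * (M / (8 * K)) + \<epsilon> * L)"
      by (rule order_trans[OF norm_triangle_ineq4 add_mono[OF g3 norm_triangle_mono[OF g1 g2]]])
    also have "\<dots> = \<epsilon> * (norm A * M + M / (8 * K) + L)" by (simp add: algebra_simps)
    also have "\<dots> \<le> r / 2" using s1(6)[OF e(4,3)] q by linarith
    finally show ?thesis .
  qed
  show ?thesis
  proof
    show "0 < \<epsilon>0" "\<epsilon>0 \<le> \<epsilon>1" "0 < r" using \<epsilon>0 r by auto
    show "\<epsilon>0 \<le> 1" using s1(1)[of \<epsilon>0] \<epsilon>0 q by simp
    show "2 * \<epsilon>0 * (norm W + 1) \<le> s" using s1(7)[of \<epsilon>0] \<epsilon>0 q by (simp add: mult_ac)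
    fix \<epsilon> :: real and \<rho> \<rho>' :: 'a assume \<epsilon>: "\<epsilon> \<in> {0<..<\<epsilon>0}" and \<rho>: "norm \<rho> \<le> r"
    show "norm (Yf \<epsilon> \<rho>) \<le> norm W + 1"
      unfolding Yf using Hle[OF \<epsilon> \<rho>] r1 norm_triangle_ineq[of W "H \<epsilon> \<rho>"] by linarith
    show "norm (\<Phi> \<epsilon> \<rho>) \<le> r"
      using lip[OF \<epsilon> \<rho>, of 0] self0[OF \<epsilon>] norm_triangle_ineq[of "\<Phi> \<epsilon> \<rho> - \<Phi> \<epsilon> 0" "\<Phi> \<epsilon> 0"] r \<rho> by simp
    show "norm (\<Phi> \<epsilon> \<rho> - \<Phi> \<epsilon> \<rho>') \<le> norm (\<rho> - \<rho>') / 2" if "norm \<rho>' \<le> r"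
      by (rule lip[OF \<epsilon> \<rho> that])
  qed
qed

text \<open>The iterates and their bounds are exported along with the fixed point: reality and
  translation are transported along the iterates, and \<Gamma> must converge at each of
  them.\<close>

lemma fixed_point_branch:
  obtains \<epsilon>0 \<rho> where "0 < \<epsilon>0" "\<epsilon>0 \<le> \<epsilon>1" "\<epsilon>0 \<le> 1" "2 * \<epsilon>0 * (norm W + 1) \<le> s"
    and "\<And>\<epsilon>. \<epsilon> \<in> {0<..<\<epsilon>0} \<Longrightarrow> \<Phi> \<epsilon> (\<rho> \<epsilon>) = \<rho> \<epsilon>"
    and "\<And>\<epsilon>. \<epsilon> \<in> {0<..<\<epsilon>0} \<Longrightarrow> (\<lambda>k. (\<Phi> \<epsilon> ^^ k) 0) \<longlonglongrightarrow> \<rho> \<epsilon>"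
    and "\<And>\<epsilon> k. \<epsilon> \<in> {0<..<\<epsilon>0} \<Longrightarrow> norm (Yf \<epsilon> ((\<Phi> \<epsilon> ^^ k) 0)) \<le> norm W + 1"
    and "\<And>\<epsilon>. \<epsilon> \<in> {0<..<\<epsilon>0} \<Longrightarrow> norm (Yf \<epsilon> (\<rho> \<epsilon>)) \<le> norm W + 1"
    and "continuous_on {0<..<\<epsilon>0} (\<lambda>\<epsilon>. Yf \<epsilon> (\<rho> \<epsilon>))"
proof -
  obtain \<epsilon>0 r where \<epsilon>0: "0 < \<epsilon>0" "\<epsilon>0 \<le> \<epsilon>1" "\<epsilon>0 \<le> 1" "0 < r" "2 * \<epsilon>0 * (norm W + 1) \<le> s"
    and Y: "\<And>\<epsilon> \<rho>. \<epsilon> \<in> {0<..<\<epsilon>0} \<Longrightarrow> norm \<rho> \<le> r \<Longrightarrow> norm (Yf \<epsilon> \<rho>) \<le> norm W + 1"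
    and self: "\<And>\<epsilon> \<rho>. \<epsilon> \<in> {0<..<\<epsilon>0} \<Longrightarrow> norm \<rho> \<le> r \<Longrightarrow> norm (\<Phi> \<epsilon> \<rho>) \<le> r"
    and lip: "\<And>\<epsilon> \<rho> \<rho>'. \<epsilon> \<in> {0<..<\<epsilon>0} \<Longrightarrow> norm \<rho> \<le> r \<Longrightarrow> norm \<rho>' \<le> r \<Longrightarrow>
      norm (\<Phi> \<epsilon> \<rho> - \<Phi> \<epsilon> \<rho>') \<le> norm (\<rho> - \<rho>') / 2"
    using \<Phi>_contraction by metis
  let ?I = "{0<..<\<epsilon>0}"
  have sub: "?I \<subseteq> {0<..<\<epsilon>1}" using \<epsilon>0 by auto
  have cP: "continuous_on ?I (\<lambda>\<epsilon>. P \<epsilon> (y \<epsilon>))" if "continuous_on ?I y" for y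
    by (rule continuous_on_operator_family[where K = 1])
       (use that sub linP P continuous_on_subset[OF contP sub] in \<open>auto simp: subset_iff\<close>)
  have cE: "continuous_on ?I (\<lambda>\<epsilon>. E \<epsilon> (y \<epsilon>))" if "continuous_on ?I y" for y
    by (rule continuous_on_operator_family[where K = 2])
       (use that sub linE E continuous_on_subset[OF contE sub] in \<open>auto simp: subset_iff\<close>)
  have cS: "continuous_on ?I (\<lambda>\<epsilon>. S \<epsilon> (y \<epsilon>))" if "continuous_on ?I y" for y
    by (rule continuous_on_operator_family[where K = K])
       (use that sub linS S continuous_on_subset[OF contS sub] in \<open>auto simp: subset_iff\<close>)
  have cY: "continuous_on ?I (\<lambda>\<epsilon>. Yf \<epsilon> (y \<epsilon>))" if "continuous_on ?I y" for y
    unfolding Yf_def by (intro continuous_intros cP cS that)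
  have c\<Phi>: "continuous_on ?I (\<lambda>\<epsilon>. \<Phi> \<epsilon> x)" if "norm x \<le> r" for x
  proof -
    have "2 * \<epsilon> * (norm W + 1) \<le> s" if "\<epsilon> \<in> ?I" for \<epsilon>
    proof -
      have "2 * \<epsilon> * (norm W + 1) \<le> 2 * \<epsilon>0 * (norm W + 1)" using that by (intro mult_right_mono) auto
      then show ?thesis using \<epsilon>0 by linarith
    qed
    then have "continuous_on ?I (\<lambda>\<epsilon>. \<Gamma> \<epsilon> (Yf \<epsilon> x))"
      by (intro \<Gamma>_continuous[where R = "norm W + 1"] cY) (use that Y in auto)
    then show ?thesis
      unfolding \<Phi>_def by (intro cP continuous_intros cE cS)
  qed
  obtain \<rho> where \<rho>: "\<And>\<epsilon>. \<epsilon> \<in> ?I \<Longrightarrow> norm (\<rho> \<epsilon>) \<le> r" "\<And>\<epsilon>. \<epsilon> \<in> ?I \<Longrightarrow> \<Phi> \<epsilon> (\<rho> \<epsilon>) = \<rho> \<epsilon>"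
    "\<And>\<epsilon>. \<epsilon> \<in> ?I \<Longrightarrow> (\<lambda>k. (\<Phi> \<epsilon> ^^ k) 0) \<longlonglongrightarrow> \<rho> \<epsilon>" "continuous_on ?I \<rho>"
    by (rule contraction_family[OF less_imp_le[OF \<epsilon>0(4)] self lip c\<Phi>]) blast+
  have it: "norm ((\<Phi> \<epsilon> ^^ k) 0) \<le> r" if "\<epsilon> \<in> ?I" for \<epsilon> k
    by (induction k) (use self[OF that] \<epsilon>0 in auto)
  show ?thesis
    by (rule that[of \<epsilon>0 \<rho>]) (use \<epsilon>0 \<rho> Y it cY[OF \<rho>(4)] in auto)
qed

end

section \<open>Fourier series of functions analytic on a strip\<close>

definition strip :: "real \<Rightarrow> complex set" where
  "strip \<xi> = {z. \<bar>Im z\<bar> < \<xi>}"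

lemma open_strip: "open (strip \<xi>)" and convex_strip: "convex (strip \<xi>)"
proof -
  have s: "strip \<xi> = {z. Im z < \<xi>} \<inter> {z. - \<xi> < Im z}" by (auto simp: strip_def)
  show "open (strip \<xi>)" unfolding s by (intro open_Int open_halfspace_Im_lt open_halfspace_Im_gt)
  show "convex (strip \<xi>)" unfolding s by (intro convex_Int convex_halfspace_Im_lt convex_halfspace_Im_gt)
qed

definition fourier_coeff :: "(complex \<Rightarrow> complex) \<Rightarrow> int \<Rightarrow> complex" where
  "fourier_coeff \<phi> j = integral {0..2 * pi} (\<lambda>u. \<phi> (of_real u) * exp (- \<i> * of_int j * of_real u)) / (2 * pi)"

locale periodic_holomorphic =
  fixes \<phi> :: "complex \<Rightarrow> complex" and \<xi> :: real
  assumes holo: "\<phi> holomorphic_on strip \<xi>"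
    and periodic: "\<And>z. z \<in> strip \<xi> \<Longrightarrow> \<phi> (z + 2 * pi) = \<phi> z"
    and \<xi>: "\<xi> > 0"
begin

text \<open>A primitive \<Psi> replaces the contour argument: the integral over one period is the
  increment \<Psi>(z + 2 pi) - \<Psi>(z), whose derivative vanishes by periodicity, so that it does
  not depend on z.\<close>

lemma integral_shift:
  fixes \<zeta> :: complex
  assumes "\<zeta> \<in> strip \<xi>"
  shows "integral {0..2 * pi} (\<lambda>u. \<phi> (of_real u + \<zeta>)) = integral {0..2 * pi} (\<lambda>u. \<phi> (of_real u))"
proof -
  obtain \<Psi> where \<Psi>: "\<And>z. z \<in> strip \<xi> \<Longrightarrow> (\<Psi> has_field_derivative \<phi> z) (at z within strip \<xi>)"
    using holomorphic_convex_primitive'[OF convex_strip open_strip holo] by blast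
  then have \<Psi>: "(\<Psi> has_field_derivative \<phi> z) (at z)" if "z \<in> strip \<xi>" for z
    using at_within_open[OF that open_strip] that by metis
  have int: "integral {0..2 * pi} (\<lambda>u. \<phi> (of_real u + \<zeta>)) = \<Psi> (2 * pi + \<zeta>) - \<Psi> \<zeta>"
    if "\<zeta> \<in> strip \<xi>" for \<zeta> :: complex
  proof -
    have "((\<lambda>u. \<Psi> (of_real u + \<zeta>)) has_vector_derivative \<phi> (of_real u + \<zeta>)) (at u within {0..2 * pi})" for u
    proof -
      have "of_real u + \<zeta> \<in> strip \<xi>" using that by (simp add: strip_def)
      then have "((\<lambda>z. \<Psi> (z + \<zeta>)) has_field_derivative \<phi> (of_real u + \<zeta>)) (at (of_real u))"
        using DERIV_shift[of \<Psi> "\<phi> (of_real u + \<zeta>)" "of_real u" \<zeta>] \<Psi> by simp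
      then show ?thesis by (rule has_field_derivative_at_within[THEN has_vector_derivative_real_field])
    qed
    then have "((\<lambda>u. \<phi> (of_real u + \<zeta>)) has_integral \<Psi> (of_real (2 * pi) + \<zeta>) - \<Psi> (of_real 0 + \<zeta>)) {0..2 * pi}"
      by (intro fundamental_theorem_of_calculus) auto
    then show ?thesis by (simp add: integral_unique)
  qed
  obtain c where c: "\<And>z. z \<in> strip \<xi> \<Longrightarrow> \<Psi> (z + 2 * pi) - \<Psi> z = c"
  proof (rule has_field_derivative_zero_constant[OF convex_strip[of \<xi>], THEN exE])
    fix z assume z: "z \<in> strip \<xi>"
    then have z': "z + 2 * pi \<in> strip \<xi>" by (simp add: strip_def)
    have "((\<lambda>z. \<Psi> (z + 2 * pi)) has_field_derivative \<phi> (z + 2 * pi)) (at z)"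
      using \<Psi>[OF z'] unfolding DERIV_shift .
    then have "((\<lambda>z. \<Psi> (z + 2 * pi) - \<Psi> z) has_field_derivative \<phi> (z + 2 * pi) - \<phi> z) (at z within strip \<xi>)"
      using \<Psi>[OF z] by (intro derivative_intros) (auto intro: has_field_derivative_at_within)
    then show "((\<lambda>z. \<Psi> (z + 2 * pi) - \<Psi> z) has_field_derivative 0) (at z within strip \<xi>)"
      using periodic[OF z] by simp
  qed blast
  have "0 \<in> strip \<xi>" using \<xi> by (simp add: strip_def)
  then show ?thesis using int[OF assms] int[of 0] c[OF assms] c[of 0] by (simp add: add.commute)
qed

lemma continuous: "continuous_on (strip \<xi>) \<phi>"
  using holo by (rule holomorphic_on_imp_continuous_on)

lemma times_exp: "periodic_holomorphic (\<lambda>z. \<phi> z * exp (- \<i> * of_int j * z)) \<xi>"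
proof
  show "(\<lambda>z. \<phi> z * exp (- \<i> * of_int j * z)) holomorphic_on strip \<xi>"
    by (intro holomorphic_intros holo)
  show "\<phi> (z + 2 * pi) * exp (- \<i> * of_int j * (z + 2 * pi)) = \<phi> z * exp (- \<i> * of_int j * z)"
    if "z \<in> strip \<xi>" for z
  proof -
    have "exp (- \<i> * of_int j * (z + 2 * pi)) = exp (- \<i> * of_int j * z) * exp (2 * of_int (- j) * pi * \<i>)"
      by (simp add: exp_add[symmetric] algebra_simps)
    also have "exp (2 * of_int (- j) * pi * \<i>) = 1" by (rule exp_integer_2pi) auto
    finally show ?thesis using periodic[OF that] by simp
  qed
qed (rule \<xi>)

lemma fourier_coeff_shift:
  fixes \<zeta> :: complex
  assumes "\<zeta> \<in> strip \<xi>"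
  shows "fourier_coeff \<phi> j
    = integral {0..2 * pi} (\<lambda>u. \<phi> (of_real u + \<zeta>) * exp (- \<i> * of_int j * (of_real u + \<zeta>))) / (2 * pi)"
  unfolding fourier_coeff_def using periodic_holomorphic.integral_shift[OF times_exp assms, of j] by simp

lemma continuous_shifted:
  fixes \<zeta> :: complex
  assumes "\<zeta> \<in> strip \<xi>" shows "continuous_on S (\<lambda>u::real. \<phi> (of_real u + \<zeta>))"
  by (rule continuous_on_compose2[OF continuous]) (use assms in \<open>auto intro!: continuous_intros simp: strip_def\<close>)

text \<open>The line of integration is moved down for nonnegative j and up otherwise, in the
  direction in which the exponential decays; hence only the two lines at heights \<eta> and -\<eta>
  matter.\<close>

lemma fourier_coeff_bound:
  assumes \<eta>: "0 \<le> \<eta>" "\<eta> < \<xi>"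
    and B: "\<And>u. u \<in> {0..2 * pi} \<Longrightarrow> norm (\<phi> (of_real u + \<i> * \<eta>)) \<le> B"
    "\<And>u. u \<in> {0..2 * pi} \<Longrightarrow> norm (\<phi> (of_real u - \<i> * \<eta>)) \<le> B"
  shows "norm (fourier_coeff \<phi> j) \<le> B * exp (- \<eta> * \<bar>j\<bar>)"
proof -
  define \<zeta> :: complex where "\<zeta> = (if j \<ge> 0 then - \<i> * \<eta> else \<i> * \<eta>)"
  have z: "\<zeta> \<in> strip \<xi>" using \<eta> by (simp add: \<zeta>_def strip_def)
  have "norm (integral {0..2 * pi} (\<lambda>u. \<phi> (of_real u + \<zeta>) * exp (- \<i> * of_int j * (of_real u + \<zeta>))))
      \<le> B * exp (- \<eta> * \<bar>j\<bar>) * (2 * pi - 0)"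
  proof (rule integral_bound)
    show "continuous_on {0..2 * pi} (\<lambda>u. \<phi> (of_real u + \<zeta>) * exp (- \<i> * of_int j * (of_real u + \<zeta>)))"
      by (intro continuous_intros continuous_shifted[OF z])
    fix u assume u: "u \<in> {0..2 * pi}"
    have "norm (exp (- \<i> * of_int j * (of_real u + \<zeta>))) = exp (- \<eta> * \<bar>j\<bar>)"
      by (auto simp: \<zeta>_def algebra_simps)
    moreover have "norm (\<phi> (of_real u + \<zeta>)) \<le> B" using B u by (simp add: \<zeta>_def)
    ultimately show "norm (\<phi> (of_real u + \<zeta>) * exp (- \<i> * of_int j * (of_real u + \<zeta>))) \<le> B * exp (- \<eta> * \<bar>j\<bar>)"
      by (simp add: norm_mult mult_right_mono)
  qed simp
  then show ?thesis
    unfolding fourier_coeff_shift[OF z] by (simp add: norm_divide divide_le_eq)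
qed

lemma fourier_coeff_decay:
  assumes \<eta>: "0 \<le> \<eta>" "\<eta> < \<xi>"
  obtains B where "\<And>j. norm (fourier_coeff \<phi> j) \<le> B * exp (- \<eta> * \<bar>j\<bar>)"
proof -
  have "\<exists>B. \<forall>u\<in>{0..2 * pi}. norm (\<phi> (of_real u + \<zeta>)) \<le> B" if "\<zeta> \<in> strip \<xi>" for \<zeta> :: complex
  proof -
    have "compact ((\<lambda>u. \<phi> (of_real u + \<zeta>)) ` {0..2 * pi})"
      by (intro compact_continuous_image continuous_shifted[OF that] compact_Icc)
    then show ?thesis by (auto dest!: compact_imp_bounded simp: bounded_iff)
  qed
  from this[of "\<i> * \<eta>"] this[of "- \<i> * \<eta>"] obtain B C where
    "\<forall>u\<in>{0..2 * pi}. norm (\<phi> (of_real u + \<i> * \<eta>)) \<le> B" "\<forall>u\<in>{0..2 * pi}. norm (\<phi> (of_real u - \<i> * \<eta>)) \<le> C"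
    using \<eta> by (auto simp: strip_def)
  then have "norm (fourier_coeff \<phi> j) \<le> max B C * exp (- \<eta> * \<bar>j\<bar>)" for j
    by (intro fourier_coeff_bound[OF \<eta>]) (auto simp: le_max_iff_disj)
  then show ?thesis by (rule that)
qed

end

lemma exp_neg_abs_summable_int:
  fixes c :: real
  assumes "c > 0"
  shows "(\<lambda>j::int. exp (- c * \<bar>j\<bar>)) summable_on UNIV"
proof -
  have g: "(\<lambda>n::nat. exp (- c * n)) summable_on UNIV"
  proof (rule summable_nonneg_imp_summable_on)
    have "summable (\<lambda>n. exp (- c) ^ n)" using assms by (intro summable_geometric) simp
    then show "summable (\<lambda>n::nat. exp (- c * n))" by (simp add: exp_of_nat2_mult[symmetric] mult.commute)
  qed simp
  have "(\<lambda>j::int. exp (- c * \<bar>j\<bar>)) summable_on range int"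
    by (subst summable_on_reindex) (use g in \<open>auto simp: o_def\<close>)
  moreover have "(\<lambda>j::int. exp (- c * \<bar>j\<bar>)) summable_on (\<lambda>n. - int n) ` {1..}"
    by (subst summable_on_reindex)
       (use summable_on_subset_banach[OF g] in \<open>auto simp: o_def inj_on_def\<close>)
  moreover have "range int \<inter> (\<lambda>n. - int n) ` {1..} = {}" by auto
  moreover have "j \<in> range int \<union> (\<lambda>n. - int n) ` {1..}" for j
  proof (cases "j \<ge> 0")
    case True
    then have "j = int (nat j)" by simp
    then show ?thesis by blast
  next
    case False
    then have "j = - int (nat (- j))" "nat (- j) \<in> {1..}" by auto
    then show ?thesis by blast
  qed
  then have "range int \<union> (\<lambda>n. - int n) ` {1..} = UNIV" by blast
  ultimately show ?thesis using summable_on_Un_disjoint by metis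
qed

text \<open>An unconditional sum over the integers may be computed along symmetric intervals, where
  telescoping partial sums are available.\<close>

lemma filterlim_symmetric_intervals:
  "filterlim (\<lambda>J. {- int J..int J}) (finite_subsets_at_top UNIV) sequentially"
  unfolding filterlim_finite_subsets_at_top
proof (intro allI impI)
  fix X :: "int set" assume X: "finite X \<and> X \<subseteq> UNIV"
  then have M: "\<bar>x\<bar> \<le> Max (abs ` X)" if "x \<in> X" for x
    using that by (intro Max_ge) auto
  have "\<forall>\<^sub>F J in sequentially. J \<ge> nat (Max (abs ` X))" by (rule eventually_ge_at_top)
  then show "\<forall>\<^sub>F J in sequentially. finite {- int J..int J} \<and> X \<subseteq> {- int J..int J} \<and> {- int J..int J} \<subseteq> UNIV"
    by eventually_elim (use M in \<open>force simp: abs_le_iff\<close>)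
qed

lemma isCont_eventually_nonzero:
  fixes f :: "complex \<Rightarrow> complex"
  assumes "isCont f a" "f a \<noteq> 0"
  shows "\<forall>\<^sub>F z in nhds a. f z \<noteq> 0"
proof -
  have "(f \<longlongrightarrow> f a) (nhds a)"
    using assms(1) by (simp add: isCont_def tendsto_at_iff_tendsto_nhds)
  then show ?thesis using assms(2) by (rule tendsto_imp_eventually_ne)
qed

text \<open>The zeros of the denominator are simple and are cancelled by zeros of the numerator; the
  value there is the one of l'Hopital, as exp (\<i> z) = 1. Near such a point the quotient is
  rewritten with the divided differences of numerator and denominator, both holomorphic and the
  lower one nonzero.\<close>

lemma holomorphic_div_exp_minus_1:
  assumes "\<phi> holomorphic_on S" "open S" "\<And>z. z \<in> S \<Longrightarrow> exp (\<i> * z) = 1 \<Longrightarrow> \<phi> z = 0"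
  shows "(\<lambda>z. if exp (\<i> * z) = 1 then deriv \<phi> z / \<i> else \<phi> z / (exp (\<i> * z) - 1)) holomorphic_on S"
proof -
  define e :: "complex \<Rightarrow> complex" where "e = (\<lambda>z. exp (\<i> * z) - 1)"
  define \<kappa> where "\<kappa> = (\<lambda>z. if e z = 0 then deriv \<phi> z / \<i> else \<phi> z / e z)"
  have de: "(e has_field_derivative \<i> * exp (\<i> * z)) (at z)" for z
    unfolding e_def by (auto intro!: derivative_eq_intros)
  have he: "e holomorphic_on T" for T unfolding e_def by (intro holomorphic_intros)
  have diff: "\<phi> field_differentiable at z" if "z \<in> S" for z
    using assms(1,2) that by (simp add: holomorphic_on_imp_differentiable_at)
  have "\<kappa> holomorphic_on S"
    unfolding holomorphic_on_open[OF assms(2)]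
  proof
    fix a assume a: "a \<in> S"
    define f where "f = (\<lambda>z. if z = a then deriv \<phi> a else (\<phi> z - \<phi> a) / (z - a))"
    define h where "h = (\<lambda>z. if z = a then deriv e a else (e z - e a) / (z - a))"
    have fh: "f holomorphic_on S" "h holomorphic_on S"
      unfolding f_def h_def using pole_lemma_open[OF _ assms(2)] assms(1) he by blast+
    show "\<exists>D. (\<kappa> has_field_derivative D) (at a)"
    proof (cases "e a = 0")
      case True
      have ha: "h a \<noteq> 0" using DERIV_imp_deriv[OF de, of a] by (simp add: h_def)
      have "isCont h a"
        using holomorphic_on_imp_continuous_on[OF fh(2)] a assms(2) by (simp add: continuous_on_eq_continuous_at)
      then have "\<forall>\<^sub>F z in nhds a. h z \<noteq> 0" using ha by (rule isCont_eventually_nonzero)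
      moreover have "\<forall>\<^sub>F z in nhds a. z \<in> S" using a assms(2) by (rule eventually_nhds_in_open[rotated])
      ultimately have ev: "\<forall>\<^sub>F z in nhds a. \<kappa> z = f z / h z"
      proof eventually_elim
        case (elim z)
        show ?case
        proof (cases "z = a")
          case True
          have "deriv e a = \<i> * (e a + 1)" using DERIV_imp_deriv[OF de, of a] by (simp add: e_def)
          then show ?thesis using True \<open>e a = 0\<close> by (simp add: \<kappa>_def f_def h_def)
        next
          case False
          have "\<phi> a = 0" using assms(3)[OF a] True by (simp add: e_def)
          then show ?thesis using False True elim by (auto simp: \<kappa>_def f_def h_def)
        qed
      qed
      have "(\<lambda>z. f z / h z) field_differentiable at a"
        using fh ha a assms(2) by (intro derivative_intros) (auto simp: holomorphic_on_imp_differentiable_at)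
      then show ?thesis
        using ev DERIV_cong_ev[OF refl ev refl] unfolding field_differentiable_def by blast
    next
      case False
      then have "\<forall>\<^sub>F z in nhds a. e z \<noteq> 0"
        using DERIV_isCont[OF de, of a] by (intro isCont_eventually_nonzero)
      then have ev: "\<forall>\<^sub>F z in nhds a. \<kappa> z = \<phi> z / e z"
        by eventually_elim (simp add: \<kappa>_def)
      have "(\<lambda>z. \<phi> z / e z) field_differentiable at a"
        using False diff[OF a] de by (intro derivative_intros) (auto simp: field_differentiable_def)
      then show ?thesis
        using DERIV_cong_ev[OF refl ev refl] unfolding field_differentiable_def by blast
    qed
  qed
  then show ?thesis unfolding \<kappa>_def e_def by simp
qed

context periodic_holomorphic
begin

lemma fourier_coeff_summable: "fourier_coeff \<phi> summable_on UNIV"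
proof -
  obtain B where B: "\<And>j. norm (fourier_coeff \<phi> j) \<le> B * exp (- (\<xi> / 2) * \<bar>j\<bar>)"
    using fourier_coeff_decay[of "\<xi> / 2"] \<xi> by auto
  have "(\<lambda>j::int. B * exp (- (\<xi> / 2) * \<bar>j\<bar>)) summable_on UNIV"
    by (rule summable_on_cmult_right[OF exp_neg_abs_summable_int]) (use \<xi> in simp)
  then have "(\<lambda>j. norm (fourier_coeff \<phi> j)) summable_on UNIV"
    by (rule summable_on_comparison_test) (use B in auto)
  then show ?thesis by (rule Infinite_Sum.abs_summable_summable)
qed

text \<open>Chernoff's argument: dividing by \<open>exp (i z) - 1\<close> makes the Fourier coefficients telescope.\<close>

lemma fourier_series_zero:
  assumes "\<phi> 0 = 0"
  shows "(fourier_coeff \<phi> has_sum 0) UNIV"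
proof -
  have per: "\<phi> (z + 2 * pi * of_nat k) = \<phi> z" if "z \<in> strip \<xi>" for z k
  proof (induction k)
    case (Suc k)
    have "z + 2 * pi * of_nat k \<in> strip \<xi>" using that by (simp add: strip_def)
    from periodic[OF this] show ?case using Suc by (simp add: algebra_simps)
  qed simp
  have zero: "\<phi> z = 0" if z: "z \<in> strip \<xi>" "exp (\<i> * z) = 1" for z
  proof -
    obtain m :: int where m: "z = 2 * pi * of_int m"
      using z(2) unfolding exp_eq_1 by (auto simp: complex_eq_iff)
    have 0: "0 \<in> strip \<xi>" using \<xi> by (simp add: strip_def)
    show ?thesis
    proof (cases "m \<ge> 0")
      case True
      then show ?thesis using per[OF 0, of "nat m"] assms m by simp
    next
      case False
      then show ?thesis using per[OF z(1), of "nat (- m)"] assms m by simp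
    qed
  qed
  define \<kappa> where "\<kappa> = (\<lambda>z. if exp (\<i> * z) = 1 then deriv \<phi> z / \<i> else \<phi> z / (exp (\<i> * z) - 1))"
  have \<kappa>: "\<kappa> holomorphic_on strip \<xi>"
    unfolding \<kappa>_def by (rule holomorphic_div_exp_minus_1[OF holo open_strip zero])
  have \<phi>: "\<phi> z = (exp (\<i> * z) - 1) * \<kappa> z" if "z \<in> strip \<xi>" for z
    using zero[OF that] by (simp add: \<kappa>_def)
  have "\<kappa> (z + 2 * pi) = \<kappa> z" if z: "z \<in> strip \<xi>" for z
  proof -
    have z': "z + 2 * pi \<in> strip \<xi>" using z by (simp add: strip_def)
    have "(\<phi> has_field_derivative deriv \<phi> (z + 2 * pi)) (at (z + 2 * pi))"
      by (rule holomorphic_derivI[OF holo open_strip z'])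
    then have "((\<lambda>w. \<phi> (w + 2 * pi)) has_field_derivative deriv \<phi> (z + 2 * pi)) (at z)"
      by (simp add: DERIV_shift)
    moreover have "\<forall>\<^sub>F w in nhds z. \<phi> (w + 2 * pi) = \<phi> w"
      using eventually_nhds_in_open[OF open_strip z] by eventually_elim (rule periodic)
    ultimately have "(\<phi> has_field_derivative deriv \<phi> (z + 2 * pi)) (at z)"
      by (subst (asm) DERIV_cong_ev[OF refl _ refl]) auto
    then have "deriv \<phi> (z + 2 * pi) = deriv \<phi> z" by (simp add: DERIV_imp_deriv)
    moreover have "exp (\<i> * (z + 2 * pi)) = exp (\<i> * z)"
      by (simp add: distrib_left exp_add mult.commute)
    ultimately show ?thesis using periodic[OF z] by (simp add: \<kappa>_def)
  qed
  then interpret \<kappa>: periodic_holomorphic \<kappa> \<xi>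
    by unfold_locales (use \<kappa> \<xi> in auto)
  have tele: "fourier_coeff \<phi> j = fourier_coeff \<kappa> (j - 1) - fourier_coeff \<kappa> j" for j
  proof -
    have r: "of_real u \<in> strip \<xi>" for u using \<xi> by (simp add: strip_def)
    have "integral {0..2 * pi} (\<lambda>u. \<phi> (of_real u) * exp (- \<i> * of_int j * of_real u))
        = integral {0..2 * pi} (\<lambda>u. \<kappa> (of_real u) * exp (- \<i> * of_int (j - 1) * of_real u)
            - \<kappa> (of_real u) * exp (- \<i> * of_int j * of_real u))"
      by (rule integral_cong) (auto simp: \<phi>[OF r] algebra_simps exp_add[symmetric])
    also have "\<dots> = integral {0..2 * pi} (\<lambda>u. \<kappa> (of_real u) * exp (- \<i> * of_int (j - 1) * of_real u))
        - integral {0..2 * pi} (\<lambda>u. \<kappa> (of_real u) * exp (- \<i> * of_int j * of_real u))"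
      using \<kappa>.continuous_shifted[OF r[of 0]]
      by (intro integral_diff integrable_continuous_real continuous_intros) auto
    finally show ?thesis by (simp add: fourier_coeff_def diff_divide_distrib)
  qed
  \<comment> \<open>Only the two extreme coefficients of the quotient survive, and they
    decay.\<close>
  have sum: "(\<Sum>j\<in>{- int J..int J}. fourier_coeff \<phi> j) = fourier_coeff \<kappa> (- int (Suc J)) - fourier_coeff \<kappa> (int J)" for J
  proof (induction J)
    case (Suc J)
    have "{- int (Suc J)..int (Suc J)} = insert (int (Suc J)) (insert (- int (Suc J)) {- int J..int J})" by auto
    then show ?case using Suc by (simp add: tele algebra_simps)
  qed (simp add: tele)
  obtain B where B: "\<And>j. norm (fourier_coeff \<kappa> j) \<le> B * exp (- (\<xi> / 2) * \<bar>j\<bar>)"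
    using \<kappa>.fourier_coeff_decay[of "\<xi> / 2"] \<xi> by auto
  have ex: "(\<lambda>J. exp (- (\<xi> / 2) * real J)) \<longlonglongrightarrow> 0"
    using \<xi> by real_asymp
  have B1: "norm (fourier_coeff \<kappa> (int J)) \<le> B * exp (- (\<xi> / 2) * real J)"
    and B2: "norm (fourier_coeff \<kappa> (- int (Suc J))) \<le> B * exp (- (\<xi> / 2) * real (Suc J))" for J
    using B[of "int J"] B[of "- int (Suc J)"] by (simp_all add: add.commute)
  have "(\<lambda>J. fourier_coeff \<kappa> (int J)) \<longlonglongrightarrow> 0"
    by (rule Lim_null_comparison[OF always_eventually tendsto_mult_right_zero[OF ex, of B]]) (rule allI B1)+
  moreover have "(\<lambda>J. fourier_coeff \<kappa> (- int (Suc J))) \<longlonglongrightarrow> 0"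
    by (rule Lim_null_comparison[OF always_eventually tendsto_mult_right_zero[OF LIMSEQ_Suc[OF ex], of B]]) (rule allI B2)+
  ultimately have "(\<lambda>J. \<Sum>j\<in>{- int J..int J}. fourier_coeff \<phi> j) \<longlonglongrightarrow> 0 - 0"
    unfolding sum by (intro tendsto_diff)
  moreover obtain S where S: "(fourier_coeff \<phi> has_sum S) UNIV"
    using fourier_coeff_summable by (auto simp: summable_on_def)
  have "(\<lambda>J. \<Sum>j\<in>{- int J..int J}. fourier_coeff \<phi> j) \<longlonglongrightarrow> S"
    by (rule filterlim_compose[OF S[unfolded has_sum_def] filterlim_symmetric_intervals])
  ultimately have "S = 0" using LIMSEQ_unique by fastforce
  then show ?thesis using S by simp
qed

end

context periodic_holomorphic
begin

text \<open>Translating \<phi> by u and subtracting its value at u reduces the claim to the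
  vanishing case at 0. Each coefficient acquires a phase, and only the one of index 0 sees the
  subtracted constant.\<close>

lemma fourier_series:
  "((\<lambda>j. fourier_coeff \<phi> j * exp (\<i> * of_int j * of_real u)) has_sum \<phi> (of_real u)) UNIV"
proof -
  let ?\<psi> = "\<lambda>z. \<phi> (z + of_real u) - \<phi> (of_real u)"
  have r: "of_real t \<in> strip \<xi>" for t using \<xi> by (simp add: strip_def)
  have "(\<lambda>z. \<phi> (z + of_real u)) holomorphic_on strip \<xi>"
  proof -
    have a: "(\<lambda>z. z + complex_of_real u) holomorphic_on strip \<xi>" by (intro holomorphic_intros)
    have b: "(\<lambda>z. z + complex_of_real u) ` strip \<xi> \<subseteq> strip \<xi>" by (auto simp: strip_def)
    have "(\<phi> \<circ> (\<lambda>z. z + complex_of_real u)) holomorphic_on strip \<xi>"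
      by (rule holomorphic_on_compose_gen[OF a holo b])
    then show ?thesis by (simp add: o_def)
  qed
  moreover have "\<phi> (z + 2 * pi + of_real u) = \<phi> (z + of_real u)" if "z \<in> strip \<xi>" for z
    using periodic[of "z + of_real u"] that by (simp add: strip_def algebra_simps)
  ultimately interpret \<psi>: periodic_holomorphic ?\<psi> \<xi>
    by unfold_locales (auto intro!: holomorphic_intros \<xi>)
  \<comment> \<open>The constant is holomorphic on strips of every width, so the decay estimate with
    \<eta> tending to infinity makes all coefficients of nonzero index vanish.\<close>
  have one: "fourier_coeff (\<lambda>_. 1) j = (if j = 0 then 1 else 0)" for j
  proof (cases "j = 0")
    case True
    then show ?thesis by (simp add: fourier_coeff_def scaleR_conv_of_real)
  next
    case False
    have le: "norm (fourier_coeff (\<lambda>_. 1) j) \<le> exp (- \<eta>)" if "\<eta> > 0" for \<eta>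
    proof -
      interpret c: periodic_holomorphic "\<lambda>_. 1" "\<eta> + 1" by unfold_locales (use that in auto)
      have "norm (fourier_coeff (\<lambda>_. 1) j) \<le> 1 * exp (- \<eta> * \<bar>j\<bar>)"
        using that by (intro c.fourier_coeff_bound) auto
      also have "\<dots> \<le> exp (- \<eta>)" using False that by simp
      finally show ?thesis .
    qed
    have "norm (fourier_coeff (\<lambda>_. 1) j) \<le> 0"
    proof (rule tendsto_lowerbound)
      show "((\<lambda>\<eta>::real. exp (- \<eta>)) \<longlongrightarrow> 0) at_top" by real_asymp
      show "\<forall>\<^sub>F \<eta> in at_top. norm (fourier_coeff (\<lambda>_. 1) j) \<le> exp (- \<eta>)"
        using eventually_gt_at_top[of 0] by eventually_elim (rule le)
    qed simp
    then show ?thesis using False by simp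
  qed
  have "fourier_coeff ?\<psi> j = fourier_coeff \<phi> j * exp (\<i> * of_int j * of_real u) - \<phi> (of_real u) * (if j = 0 then 1 else 0)" for j
  proof -
    let ?e = "\<lambda>t. exp (- \<i> * of_int j * of_real t)"
    have "integral {0..2 * pi} (\<lambda>t. ?\<psi> (of_real t) * ?e t)
        = integral {0..2 * pi} (\<lambda>t. \<phi> (of_real t + of_real u) * ?e t - \<phi> (of_real u) * (1 * ?e t))"
      by (rule integral_cong) (simp add: algebra_simps)
    also have "\<dots> = integral {0..2 * pi} (\<lambda>t. \<phi> (of_real t + of_real u) * ?e t) - integral {0..2 * pi} (\<lambda>t. \<phi> (of_real u) * (1 * ?e t))"
      by (intro integral_diff integrable_continuous_real continuous_intros continuous_shifted r)
    also have "integral {0..2 * pi} (\<lambda>t. \<phi> (of_real u) * (1 * ?e t)) = \<phi> (of_real u) * integral {0..2 * pi} (\<lambda>t. 1 * ?e t)"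
      by (rule integral_mult_right)
    finally have "fourier_coeff ?\<psi> j = integral {0..2 * pi} (\<lambda>t. \<phi> (of_real t + of_real u) * ?e t) / (2 * pi)
        - \<phi> (of_real u) * fourier_coeff (\<lambda>_. 1) j"
      by (simp add: fourier_coeff_def diff_divide_distrib)
    also have "integral {0..2 * pi} (\<lambda>t. \<phi> (of_real t + of_real u) * ?e t) / (2 * pi) = fourier_coeff \<phi> j * exp (\<i> * of_int j * of_real u)"
    proof -
      have "fourier_coeff \<phi> j * exp (\<i> * of_int j * of_real u)
        = exp (\<i> * of_int j * of_real u) * integral {0..2 * pi} (\<lambda>t. \<phi> (of_real t + of_real u) * exp (- \<i> * of_int j * (of_real t + of_real u))) / (2 * pi)"
        unfolding fourier_coeff_shift[OF r[of u]] by simp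
      also have "\<dots> = integral {0..2 * pi} (\<lambda>t. exp (\<i> * of_int j * of_real u) * (\<phi> (of_real t + of_real u) * exp (- \<i> * of_int j * (of_real t + of_real u)))) / (2 * pi)"
        by (subst integral_mult_right) simp
      also have "\<dots> = integral {0..2 * pi} (\<lambda>t. \<phi> (of_real t + of_real u) * ?e t) / (2 * pi)"
        by (intro arg_cong2[where f = "(/)"] integral_cong refl) (simp add: algebra_simps exp_add[symmetric])
      finally show ?thesis by simp
    qed
    finally show ?thesis by (simp add: one)
  qed
  moreover have "(fourier_coeff ?\<psi> has_sum 0) UNIV" by (rule \<psi>.fourier_series_zero) simp
  ultimately have "((\<lambda>j. fourier_coeff \<phi> j * exp (\<i> * of_int j * of_real u) - \<phi> (of_real u) * (if j = 0 then 1 else 0)) has_sum 0) UNIV"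
    by (subst (asm) has_sum_cong) auto
  moreover have "((\<lambda>j::int. \<phi> (of_real u) * (if j = 0 then 1 else 0)) has_sum \<phi> (of_real u)) UNIV"
  proof -
    have "((\<lambda>j::int. \<phi> (of_real u) * (if j = 0 then 1 else 0)) has_sum \<phi> (of_real u)) {0}"
      by (simp add: has_sum_finite_iff)
    then show ?thesis by (rule has_sum_cong_neutral[THEN iffD1, rotated -1]) auto
  qed
  ultimately show ?thesis
    using has_sum_add by fastforce
qed

end

section \<open>Fourier series in two variables\<close>

definition fourier_coeff2 :: "(complex \<times> complex \<Rightarrow> complex) \<Rightarrow> int \<times> int \<Rightarrow> complex" where
  "fourier_coeff2 F p = fourier_coeff (\<lambda>v. fourier_coeff (\<lambda>u. F (u, v)) (fst p)) (snd p)"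

lemma exp_neg_abs_summable_int2:
  fixes c :: real
  assumes "c > 0"
  shows "(\<lambda>p::int \<times> int. exp (- c * (\<bar>real_of_int (fst p)\<bar> + \<bar>real_of_int (snd p)\<bar>))) summable_on UNIV"
proof -
  note s = exp_neg_abs_summable_int[OF assms]
  have "(\<lambda>p. exp (- c * \<bar>real_of_int (fst p)\<bar>) * exp (- c * \<bar>real_of_int (snd p)\<bar>)) summable_on UNIV \<times> UNIV"
  proof (rule summable_on_SigmaI)
    show "((\<lambda>y. exp (- c * \<bar>real_of_int (fst (x, y))\<bar>) * exp (- c * \<bar>real_of_int (snd (x, y))\<bar>)) has_sum
        exp (- c * \<bar>real_of_int x\<bar>) * (\<Sum>\<^sub>\<infinity>j::int. exp (- c * \<bar>real_of_int j\<bar>))) UNIV" for x :: int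
      unfolding fst_conv snd_conv by (intro has_sum_cmult_right has_sum_infsum s)
    show "(\<lambda>x::int. exp (- c * \<bar>real_of_int x\<bar>) * (\<Sum>\<^sub>\<infinity>j::int. exp (- c * \<bar>real_of_int j\<bar>))) summable_on UNIV"
      by (intro summable_on_cmult_left s)
  qed auto
  then show ?thesis by (simp add: algebra_simps exp_add[symmetric])
qed

text \<open>Lines of integration are shifted one variable at a time, which separate holomorphy
  permits; joint continuity serves Fubini and integrals depending on a parameter.\<close>

locale periodic_holomorphic2 =
  fixes F :: "complex \<times> complex \<Rightarrow> complex" and \<xi> :: real
  assumes holo1: "\<And>b. b \<in> strip \<xi> \<Longrightarrow> (\<lambda>a. F (a, b)) holomorphic_on strip \<xi>"
    and holo2: "\<And>a. a \<in> strip \<xi> \<Longrightarrow> (\<lambda>b. F (a, b)) holomorphic_on strip \<xi>"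
    and periodic1: "\<And>a b. a \<in> strip \<xi> \<Longrightarrow> b \<in> strip \<xi> \<Longrightarrow> F (a + 2 * pi, b) = F (a, b)"
    and periodic2: "\<And>a b. a \<in> strip \<xi> \<Longrightarrow> b \<in> strip \<xi> \<Longrightarrow> F (a, b + 2 * pi) = F (a, b)"
    and cont: "continuous_on (strip \<xi> \<times> strip \<xi>) F"
    and \<xi>: "\<xi> > 0"
begin

lemma of_real_strip [simp]: "of_real u \<in> strip \<xi>"
  using \<xi> by (simp add: strip_def)

lemma of_real_add_strip [simp]: "of_real u + \<zeta> \<in> strip \<xi> \<longleftrightarrow> \<zeta> \<in> strip \<xi>"
  by (simp add: strip_def)

lemma periodic_holomorphic1: "b \<in> strip \<xi> \<Longrightarrow> periodic_holomorphic (\<lambda>a. F (a, b)) \<xi>"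
  by unfold_locales (use holo1 periodic1 \<xi> in auto)

lemma periodic_holomorphic2: "a \<in> strip \<xi> \<Longrightarrow> periodic_holomorphic (\<lambda>b. F (a, b)) \<xi>"
  by unfold_locales (use holo2 periodic2 \<xi> in auto)

lemma continuous_shifted2:
  fixes \<zeta> \<zeta>' :: complex
  assumes "\<zeta> \<in> strip \<xi>" "\<zeta>' \<in> strip \<xi>"
    and "continuous_on S h" "continuous_on S k"
  shows "continuous_on S (\<lambda>x. F (complex_of_real (h x) + \<zeta>, complex_of_real (k x) + \<zeta>'))"
  by (rule continuous_on_compose2[OF cont]) (use assms in \<open>auto intro!: continuous_intros\<close>)

lemma continuous_fourier_coeff1:
  assumes "\<zeta> \<in> strip \<xi>"
  shows "continuous_on S (\<lambda>u::real. fourier_coeff (\<lambda>b. F (of_real u + \<zeta>, b)) k)"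
    and "continuous_on S (\<lambda>v::real. fourier_coeff (\<lambda>a. F (a, of_real v + \<zeta>)) k)"
proof -
  have z: "0 \<in> strip \<xi>" using of_real_strip[of 0] by simp
  have "continuous_on (S \<times> cbox 0 (2 * pi)) (\<lambda>(u, v). F (of_real u + \<zeta>, of_real v) * exp (- \<i> * of_int k * of_real v))"
    using continuous_shifted2[OF assms z continuous_on_fst[OF continuous_on_id] continuous_on_snd[OF continuous_on_id], of "S \<times> {0..2 * pi}"]
    by (auto simp: case_prod_unfold intro!: continuous_intros)
  from integral_continuous_on_param[OF this]
  show "continuous_on S (\<lambda>u::real. fourier_coeff (\<lambda>b. F (of_real u + \<zeta>, b)) k)"
    unfolding fourier_coeff_def by (auto intro!: continuous_intros)
  have "continuous_on (S \<times> cbox 0 (2 * pi)) (\<lambda>(v, u). F (of_real u, of_real v + \<zeta>) * exp (- \<i> * of_int k * of_real u))"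
    using continuous_shifted2[OF z assms continuous_on_snd[OF continuous_on_id] continuous_on_fst[OF continuous_on_id], of "S \<times> {0..2 * pi}"]
    by (auto simp: case_prod_unfold intro!: continuous_intros)
  from integral_continuous_on_param[OF this]
  show "continuous_on S (\<lambda>v::real. fourier_coeff (\<lambda>a. F (a, of_real v + \<zeta>)) k)"
    unfolding fourier_coeff_def by (auto intro!: continuous_intros)
qed

text \<open>By definition the second variable is integrated last. Exchanging the integrals puts the
  first variable outside, on a line moved by \<zeta>, so that both variables can be shifted and
  estimated in turn.\<close>

lemma fourier_coeff2_shift:
  assumes \<zeta>: "\<zeta> \<in> strip \<xi>"
  shows "fourier_coeff2 F (j, k) = integral {0..2 * pi} (\<lambda>u. exp (- \<i> * of_int j * (of_real u + \<zeta>))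
    * fourier_coeff (\<lambda>b. F (of_real u + \<zeta>, b)) k) / (2 * pi)"
proof -
  have z: "0 \<in> strip \<xi>" using of_real_strip[of 0] by simp
  let ?e = "\<lambda>u. exp (- \<i> * of_int j * (of_real u + \<zeta>))" and ?e' = "\<lambda>v. exp (- \<i> * of_int k * of_real v)"
  have c: "fourier_coeff (\<lambda>u. F (u, of_real v)) j = integral {0..2 * pi} (\<lambda>u. F (of_real u + \<zeta>, of_real v) * ?e u) / (2 * pi)" for v
    by (rule periodic_holomorphic.fourier_coeff_shift[OF periodic_holomorphic1 \<zeta>]) simp
  have "fourier_coeff2 F (j, k) = integral {0..2 * pi} (\<lambda>v. integral {0..2 * pi} (\<lambda>u. F (of_real u + \<zeta>, of_real v) * ?e u) / (2 * pi) * ?e' v) / (2 * pi)"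
    unfolding fourier_coeff2_def fst_conv snd_conv by (subst fourier_coeff_def) (simp only: c)
  also have "\<dots> = integral {0..2 * pi} (\<lambda>v. integral {0..2 * pi} (\<lambda>u. F (of_real u + \<zeta>, of_real v) * ?e u * ?e' v / (2 * pi))) / (2 * pi)"
  proof (intro arg_cong2[where f = "(/)"] integral_cong refl)
    fix v
    have "integral {0..2 * pi} (\<lambda>u. F (of_real u + \<zeta>, of_real v) * ?e u * (?e' v / (2 * pi)))
      = integral {0..2 * pi} (\<lambda>u. F (of_real u + \<zeta>, of_real v) * ?e u) * (?e' v / (2 * pi))"
      by (rule integral_mult_left)
    then show "integral {0..2 * pi} (\<lambda>u. F (of_real u + \<zeta>, of_real v) * ?e u) / (2 * pi) * ?e' v
      = integral {0..2 * pi} (\<lambda>u. F (of_real u + \<zeta>, of_real v) * ?e u * ?e' v / (2 * pi))"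
      by simp
  qed
  also have "integral {0..2 * pi} (\<lambda>v. integral {0..2 * pi} (\<lambda>u. F (of_real u + \<zeta>, of_real v) * ?e u * ?e' v / (2 * pi)))
      = integral {0..2 * pi} (\<lambda>u. integral {0..2 * pi} (\<lambda>v. F (of_real u + \<zeta>, of_real v) * ?e u * ?e' v / (2 * pi)))"
    unfolding cbox_interval[symmetric]
    by (rule integral_swap_continuous)
       (use continuous_shifted2[OF \<zeta> z continuous_on_snd[OF continuous_on_id] continuous_on_fst[OF continuous_on_id], of "cbox (0, 0) (2 * pi, 2 * pi)"] in \<open>auto simp: case_prod_unfold intro!: continuous_intros\<close>)
  also have "\<dots> = integral {0..2 * pi} (\<lambda>u. ?e u * fourier_coeff (\<lambda>b. F (of_real u + \<zeta>, b)) k)"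
  proof (rule integral_cong)
    fix u
    have "integral {0..2 * pi} (\<lambda>v. F (of_real u + \<zeta>, of_real v) * ?e u * ?e' v / (2 * pi))
      = integral {0..2 * pi} (\<lambda>v. (?e u / (2 * pi)) * (F (of_real u + \<zeta>, of_real v) * ?e' v))"
      by (rule integral_cong) simp
    also have "\<dots> = (?e u / (2 * pi)) * integral {0..2 * pi} (\<lambda>v. F (of_real u + \<zeta>, of_real v) * ?e' v)"
      by (rule integral_mult_right)
    finally show "integral {0..2 * pi} (\<lambda>v. F (of_real u + \<zeta>, of_real v) * ?e u * ?e' v / (2 * pi))
      = ?e u * fourier_coeff (\<lambda>b. F (of_real u + \<zeta>, b)) k" by (simp add: fourier_coeff_def)
  qed
  finally show ?thesis .
qed

lemma bounded_on_strip:
  assumes \<eta>: "0 \<le> \<eta>" "\<eta> < \<xi>"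
  obtains B where "B \<ge> 0" "\<And>a b. Re a \<in> {0..2 * pi} \<Longrightarrow> Re b \<in> {0..2 * pi} \<Longrightarrow> \<bar>Im a\<bar> \<le> \<eta> \<Longrightarrow> \<bar>Im b\<bar> \<le> \<eta> \<Longrightarrow> norm (F (a, b)) \<le> B"
proof -
  let ?K = "cbox (Complex 0 (- \<eta>)) (Complex (2 * pi) \<eta>)"
  have K: "z \<in> ?K \<longleftrightarrow> Re z \<in> {0..2 * pi} \<and> \<bar>Im z\<bar> \<le> \<eta>" for z
    by (auto simp: in_cbox_complex_iff abs_le_iff)
  have "compact (F ` (?K \<times> ?K))"
    by (intro compact_continuous_image continuous_on_subset[OF cont] compact_Times compact_cbox)
       (use \<eta> K in \<open>auto simp: strip_def\<close>)
  then have "bounded (F ` (?K \<times> ?K))" by (rule compact_imp_bounded)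
  then obtain B where B: "\<And>x. x \<in> F ` (?K \<times> ?K) \<Longrightarrow> norm x \<le> B"
    unfolding bounded_iff by blast
  show ?thesis
  proof (rule that[of "max 0 B"])
    fix a b assume "Re a \<in> {0..2 * pi}" "Re b \<in> {0..2 * pi}" "\<bar>Im a\<bar> \<le> \<eta>" "\<bar>Im b\<bar> \<le> \<eta>"
    then have "(a, b) \<in> ?K \<times> ?K" using K by blast
    then show "norm (F (a, b)) \<le> max 0 B" using B[OF imageI] by (simp add: le_max_iff_disj)
  qed simp
qed

context
  fixes \<eta> B :: real
  assumes \<eta>: "0 < \<eta>" "\<eta> < \<xi>" and B0: "B \<ge> 0"
    and B: "\<And>a b. Re a \<in> {0..2 * pi} \<Longrightarrow> Re b \<in> {0..2 * pi} \<Longrightarrow> \<bar>Im a\<bar> \<le> \<eta> \<Longrightarrow> \<bar>Im b\<bar> \<le> \<eta> \<Longrightarrow> norm (F (a, b)) \<le> B"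
begin

lemma fourier_coeff_bound1:
  assumes "Re b \<in> {0..2 * pi}" "\<bar>Im b\<bar> \<le> \<eta>"
  shows "norm (fourier_coeff (\<lambda>a. F (a, b)) j) \<le> B * exp (- \<eta> * \<bar>real_of_int j\<bar>)"
    and "norm (fourier_coeff (\<lambda>a. F (b, a)) j) \<le> B * exp (- \<eta> * \<bar>real_of_int j\<bar>)"
proof -
  have b: "b \<in> strip \<xi>" using assms \<eta> by (simp add: strip_def)
  have "norm (fourier_coeff (\<lambda>a. F (a, b)) j) \<le> B * exp (- \<eta> * \<bar>j\<bar>)"
    by (rule periodic_holomorphic.fourier_coeff_bound[OF periodic_holomorphic1[OF b]])
       (use assms \<eta> in \<open>auto intro!: B\<close>)
  then show "norm (fourier_coeff (\<lambda>a. F (a, b)) j) \<le> B * exp (- \<eta> * \<bar>real_of_int j\<bar>)" by simp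
  have "norm (fourier_coeff (\<lambda>a. F (b, a)) j) \<le> B * exp (- \<eta> * \<bar>j\<bar>)"
    by (rule periodic_holomorphic.fourier_coeff_bound[OF periodic_holomorphic2[OF b]])
       (use assms \<eta> in \<open>auto intro!: B\<close>)
  then show "norm (fourier_coeff (\<lambda>a. F (b, a)) j) \<le> B * exp (- \<eta> * \<bar>real_of_int j\<bar>)" by simp
qed

lemma fourier_coeff2_bound:
  "norm (fourier_coeff2 F (j, k)) \<le> B * exp (- \<eta> * (\<bar>real_of_int j\<bar> + \<bar>real_of_int k\<bar>))"
proof -
  define \<zeta> :: complex where "\<zeta> = (if j \<ge> 0 then - \<i> * \<eta> else \<i> * \<eta>)"
  have z: "\<zeta> \<in> strip \<xi>" "\<bar>Im \<zeta>\<bar> \<le> \<eta>" "Re \<zeta> = 0" using \<eta> by (simp_all add: \<zeta>_def strip_def)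
  let ?M = "exp (- \<eta> * \<bar>real_of_int j\<bar>) * (B * exp (- \<eta> * \<bar>real_of_int k\<bar>))"
  have "norm (integral {0..2 * pi} (\<lambda>u. exp (- \<i> * of_int j * (of_real u + \<zeta>)) * fourier_coeff (\<lambda>b. F (of_real u + \<zeta>, b)) k))
      \<le> ?M * (2 * pi - 0)"
  proof (rule integral_bound)
    show "continuous_on {0..2 * pi} (\<lambda>u. exp (- \<i> * of_int j * (of_real u + \<zeta>)) * fourier_coeff (\<lambda>b. F (of_real u + \<zeta>, b)) k)"
      by (intro continuous_intros continuous_fourier_coeff1[OF z(1)])
    fix u assume u: "u \<in> {0..2 * pi}"
    have "norm (exp (- \<i> * of_int j * (of_real u + \<zeta>))) = exp (- \<eta> * \<bar>real_of_int j\<bar>)"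
      by (auto simp: \<zeta>_def algebra_simps)
    moreover have "norm (fourier_coeff (\<lambda>b. F (of_real u + \<zeta>, b)) k) \<le> B * exp (- \<eta> * \<bar>real_of_int k\<bar>)"
      by (rule fourier_coeff_bound1) (use u z in auto)
    ultimately show "norm (exp (- \<i> * of_int j * (of_real u + \<zeta>)) * fourier_coeff (\<lambda>b. F (of_real u + \<zeta>, b)) k) \<le> ?M"
      by (simp only: norm_mult) (rule mult_left_mono, auto)
  qed simp
  then have "norm (fourier_coeff2 F (j, k)) \<le> ?M"
    unfolding fourier_coeff2_shift[OF z(1)] by (simp add: norm_divide divide_le_eq)
  then show ?thesis by (simp add: algebra_simps exp_add[symmetric])
qed

text \<open>The coefficient in the second variable, as a function of the first, is not known to be
  holomorphic here, so this is not an instance of \<open>fourier_series\<close>. Instead the series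
  of F in the first variable, which converges uniformly in the second, is integrated term by
  term.\<close>

lemma fourier_coeff_series:
  "((\<lambda>j. fourier_coeff2 F (j, k) * exp (\<i> * of_int j * of_real u)) has_sum fourier_coeff (\<lambda>b. F (of_real u, b)) k) UNIV"
proof -
  let ?e = "\<lambda>j. exp (\<i> * of_int j * of_real u)" and ?e' = "\<lambda>v. exp (- \<i> * of_int k * of_real v)"
  let ?c = "\<lambda>j v. fourier_coeff (\<lambda>a. F (a, of_real v)) j"
  have z: "0 \<in> strip \<xi>" using of_real_strip[of 0] by simp
  have s: "((\<lambda>j. ?c j v * ?e j) has_sum F (of_real u, of_real v)) UNIV" for v
    by (rule periodic_holomorphic.fourier_series[OF periodic_holomorphic1]) simp
  have "uniform_limit {0..2 * pi} (\<lambda>X v. \<Sum>j\<in>X. ?c j v * ?e j * ?e' v) (\<lambda>v. \<Sum>\<^sub>\<infinity>j. ?c j v * ?e j * ?e' v) (finite_subsets_at_top UNIV)"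
  proof (rule Weierstrass_m_test_general)
    show "norm (?c j v * ?e j * ?e' v) \<le> B * exp (- \<eta> * \<bar>real_of_int j\<bar>)" if "v \<in> {0..2 * pi}" for j v
      using fourier_coeff_bound1(1)[of "of_real v" j] that \<eta> by (simp add: norm_mult)
    show "(\<lambda>j::int. B * exp (- \<eta> * \<bar>real_of_int j\<bar>)) summable_on UNIV"
      by (intro summable_on_cmult_right exp_neg_abs_summable_int \<eta>)
  qed
  moreover have "(\<Sum>\<^sub>\<infinity>j. ?c j v * ?e j * ?e' v) = F (of_real u, of_real v) * ?e' v" for v
    using infsumI[OF s] by (simp add: infsum_cmult_left')
  ultimately have ul: "uniform_limit {0..2 * pi} (\<lambda>X v. \<Sum>j\<in>X. ?c j v * ?e j * ?e' v) (\<lambda>v. F (of_real u, of_real v) * ?e' v) (finite_subsets_at_top UNIV)"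
    by simp
  have cc: "continuous_on {0..2 * pi} (\<lambda>v. ?c j v)" for j
    using continuous_fourier_coeff1(2)[OF z] by simp
  have ct: "continuous_on {0..2 * pi} (\<lambda>v. \<Sum>j\<in>X. ?c j v * ?e j * ?e' v)" for X
    by (intro continuous_intros cc)
  obtain I J where I: "\<And>X. ((\<lambda>v. \<Sum>j\<in>X. ?c j v * ?e j * ?e' v) has_integral I X) {0..2 * pi}"
    and J: "((\<lambda>v. F (of_real u, of_real v) * ?e' v) has_integral J) {0..2 * pi}"
    and lim: "(I \<longlongrightarrow> J) (finite_subsets_at_top UNIV)"
    using uniform_limit_integral[OF ul ct] by auto
  have "((\<lambda>v. \<Sum>j\<in>X. ?c j v * ?e j * ?e' v) has_integral (\<Sum>j\<in>X. fourier_coeff2 F (j, k) * (2 * pi) * ?e j)) {0..2 * pi}" if "finite X" for X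
  proof (rule has_integral_sum[OF that])
    fix j
    have "(\<lambda>v. ?c j v * ?e' v) integrable_on {0..2 * pi}"
      by (intro integrable_continuous_real continuous_intros cc)
    then have "((\<lambda>v. ?c j v * ?e' v) has_integral fourier_coeff2 F (j, k) * (2 * pi)) {0..2 * pi}"
      unfolding fourier_coeff2_def fst_conv snd_conv by (subst fourier_coeff_def) (simp add: has_integral_integral)
    then have "((\<lambda>v. (?c j v * ?e' v) * ?e j) has_integral fourier_coeff2 F (j, k) * (2 * pi) * ?e j) {0..2 * pi}"
      by (rule has_integral_mult_left)
    then show "((\<lambda>v. ?c j v * ?e j * ?e' v) has_integral fourier_coeff2 F (j, k) * (2 * pi) * ?e j) {0..2 * pi}"
      by (simp add: mult_ac)
  qed
  then have "I X = (\<Sum>j\<in>X. fourier_coeff2 F (j, k) * (2 * pi) * ?e j)" if "finite X" for X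
    using has_integral_unique[OF I] that by blast
  then have IX: "I X = (\<Sum>j\<in>X. fourier_coeff2 F (j, k) * ?e j) * (2 * pi)" if "finite X" for X
    unfolding sum_distrib_right using that by (simp add: mult_ac)
  have "((\<lambda>X. I X / (2 * pi)) \<longlongrightarrow> J / (2 * pi)) (finite_subsets_at_top UNIV)"
    by (intro tendsto_intros lim) simp
  then have "((\<lambda>X. \<Sum>j\<in>X. fourier_coeff2 F (j, k) * ?e j) \<longlongrightarrow> J / (2 * pi)) (finite_subsets_at_top UNIV)"
    by (rule Lim_transform_eventually) (auto intro!: eventually_finite_subsets_at_top_weakI simp: IX)
  moreover have "J / (2 * pi) = fourier_coeff (\<lambda>b. F (of_real u, b)) k"
    using J by (simp add: fourier_coeff_def integral_unique)
  ultimately show ?thesis by (simp add: has_sum_def)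
qed

text \<open>Absolute summability allows summing over j first and over k afterwards; each of the two
  stages is a one-variable expansion.\<close>

lemma fourier_series2:
  "((\<lambda>p. fourier_coeff2 F p * exp (\<i> * (of_int (fst p) * of_real u + of_int (snd p) * of_real v))) has_sum F (of_real u, of_real v)) UNIV"
proof -
  let ?g = "\<lambda>p. fourier_coeff2 F p * exp (\<i> * (of_int (fst p) * of_real u + of_int (snd p) * of_real v))"
  have "(\<lambda>p. norm (?g p)) summable_on UNIV"
  proof (rule summable_on_comparison_test[OF summable_on_cmult_right[OF exp_neg_abs_summable_int2[OF \<eta>(1)], of B]])
    show "norm (?g p) \<le> B * exp (- \<eta> * (\<bar>real_of_int (fst p)\<bar> + \<bar>real_of_int (snd p)\<bar>))" for p
      using fourier_coeff2_bound[of "fst p" "snd p"] by (simp add: norm_mult)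
  qed auto
  then have "?g summable_on UNIV" by (rule Infinite_Sum.abs_summable_summable)
  then obtain S where S: "(?g has_sum S) UNIV" by (auto simp: summable_on_def)
  have sw: "((\<lambda>(k, j). ?g (j, k)) has_sum S) (UNIV \<times> UNIV)"
    using has_sum_reindex_bij_betw[of "\<lambda>(k, j). (j, k)" UNIV UNIV ?g S] S
    by (simp add: case_prod_unfold bij_betw_def inj_on_def surj_def)
  have inner: "((\<lambda>j. ?g (j, k)) has_sum fourier_coeff (\<lambda>b. F (of_real u, b)) k * exp (\<i> * of_int k * of_real v)) UNIV" for k
    using has_sum_cmult_left[OF fourier_coeff_series[of k u], of "exp (\<i> * of_int k * of_real v)"]
    by (simp add: distrib_left exp_add mult_ac)
  have "((\<lambda>k. fourier_coeff (\<lambda>b. F (of_real u, b)) k * exp (\<i> * of_int k * of_real v)) has_sum S) UNIV"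
    by (rule has_sum_SigmaD[OF sw]) (simp only: case_prod_conv inner)
  moreover have "((\<lambda>k. fourier_coeff (\<lambda>b. F (of_real u, b)) k * exp (\<i> * of_int k * of_real v)) has_sum F (of_real u, of_real v)) UNIV"
    by (rule periodic_holomorphic.fourier_series[OF periodic_holomorphic2]) simp
  ultimately have "S = F (of_real u, of_real v)" by (rule has_sum_unique)
  then show ?thesis using S by simp
qed

end

end

section \<open>From double power series to holomorphy\<close>

lemma analytic2_on_holomorphic:
  fixes F :: "complex \<times> complex \<Rightarrow> complex"
  assumes "analytic2_on F S" "(a, b) \<in> S"
  obtains r where "r > 0" "(\<lambda>u. F (u, b)) holomorphic_on ball a r" "(\<lambda>v. F (a, v)) holomorphic_on ball b r"
    "isCont F (a, b)"
proof -
  obtain r C where r: "r > 0" and C: "\<And>u v. norm (u - a) < r \<Longrightarrow> norm (v - b) < r \<Longrightarrow>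
      ((\<lambda>(j, k). C j k * (u - a) ^ j * (v - b) ^ k) has_sum F (u, v)) UNIV"
    using assms unfolding analytic2_on_def by blast
  have 1: "(\<lambda>j. C j 0 * (u - a) ^ j) sums F (u, b)" if "u \<in> ball a r" for u
  proof -
    have "((\<lambda>(j, k). C j k * (u - a) ^ j * (b - b) ^ k) has_sum F (u, b)) (range (\<lambda>j. (j, 0::nat)))"
      by (rule has_sum_cong_neutral[THEN iffD1, rotated -1, OF C[of u b]])
         (use that r in \<open>auto simp: dist_norm norm_minus_commute image_iff power_0_left split: if_splits\<close>)
    then have "((\<lambda>j. C j 0 * (u - a) ^ j) has_sum F (u, b)) UNIV"
      by (subst (asm) has_sum_reindex) (auto simp: inj_on_def o_def)
    then show ?thesis by (rule has_sum_imp_sums)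
  qed
  have 2: "(\<lambda>k. C 0 k * (v - b) ^ k) sums F (a, v)" if "v \<in> ball b r" for v
  proof -
    have "((\<lambda>(j, k). C j k * (a - a) ^ j * (v - b) ^ k) has_sum F (a, v)) (range (\<lambda>k. (0::nat, k)))"
      by (rule has_sum_cong_neutral[THEN iffD1, rotated -1, OF C[of a v]])
         (use that r in \<open>auto simp: dist_norm norm_minus_commute image_iff power_0_left split: if_splits\<close>)
    then have "((\<lambda>k. C 0 k * (v - b) ^ k) has_sum F (a, v)) UNIV"
      by (subst (asm) has_sum_reindex) (auto simp: inj_on_def o_def)
    then show ?thesis by (rule has_sum_imp_sums)
  qed
  \<comment> \<open>The majorant is the absolute convergence of the series at the interior point
    displaced by r / 2 in both variables.\<close>
  have M: "(\<lambda>p. norm (C (fst p) (snd p)) * (r / 2) ^ fst p * (r / 2) ^ snd p) summable_on UNIV"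
  proof -
    have "((\<lambda>(j, k). C j k * (a + of_real (r / 2) - a) ^ j * (b + of_real (r / 2) - b) ^ k)
        has_sum F (a + of_real (r / 2), b + of_real (r / 2))) UNIV"
      by (rule C) (use r in auto)
    then have "(\<lambda>(j, k). C j k * of_real (r / 2) ^ j * of_real (r / 2) ^ k) abs_summable_on UNIV"
      unfolding summable_on_iff_abs_summable_on_complex[symmetric] by (auto simp: summable_on_def)
    then show ?thesis using r by (simp add: case_prod_unfold norm_mult norm_power norm_divide)
  qed
  let ?B = "ball a (r / 2) \<times> ball b (r / 2)"
  have "uniform_limit ?B (\<lambda>X q. \<Sum>p\<in>X. C (fst p) (snd p) * (fst q - a) ^ fst p * (snd q - b) ^ snd p)
      (\<lambda>q. \<Sum>\<^sub>\<infinity>p. C (fst p) (snd p) * (fst q - a) ^ fst p * (snd q - b) ^ snd p) (finite_subsets_at_top UNIV)"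
  proof (rule Weierstrass_m_test_general[OF _ M])
    fix p q assume "q \<in> ?B"
    then have "norm (fst q - a) \<le> r / 2" "norm (snd q - b) \<le> r / 2"
      by (auto simp: dist_norm norm_minus_commute)
    then show "norm (C (fst p) (snd p) * (fst q - a) ^ fst p * (snd q - b) ^ snd p)
        \<le> norm (C (fst p) (snd p)) * (r / 2) ^ fst p * (r / 2) ^ snd p"
      unfolding norm_mult norm_power using r by (intro mult_mono power_mono) auto
  qed
  then have "continuous_on ?B (\<lambda>q. \<Sum>\<^sub>\<infinity>p. C (fst p) (snd p) * (fst q - a) ^ fst p * (snd q - b) ^ snd p)"
    by (rule uniform_limit_theorem[rotated]) (auto intro!: always_eventually continuous_intros)
  moreover have "(\<Sum>\<^sub>\<infinity>p. C (fst p) (snd p) * (fst q - a) ^ fst p * (snd q - b) ^ snd p) = F q" if "q \<in> ?B" for q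
    using C[of "fst q" "snd q"] that r
    by (intro infsumI) (auto simp: dist_norm norm_minus_commute case_prod_unfold)
  ultimately have "continuous_on ?B F" by simp
  moreover have "open ?B" by (intro open_Times open_ball)
  moreover have "(a, b) \<in> ?B" using r by simp
  ultimately have "isCont F (a, b)" by (simp add: continuous_on_eq_continuous_at)
  moreover have "(\<lambda>u. F (u, b)) holomorphic_on ball a r"
    by (rule power_series_holomorphic) (rule 1)
  moreover have "(\<lambda>v. F (a, v)) holomorphic_on ball b r"
    by (rule power_series_holomorphic) (rule 2)
  ultimately show ?thesis using that r by blast
qed

lemma analytic2_on_periodic_holomorphic2:
  assumes "analytic2_on F (torus_strip \<xi>)" "periodic2_on F (torus_strip \<xi>)" "\<xi> > 0"
  shows "periodic_holomorphic2 F \<xi>"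
proof
  have mem: "(a, b) \<in> torus_strip \<xi>" if "a \<in> strip \<xi>" "b \<in> strip \<xi>" for a b
    using that by (simp add: torus_strip_def strip_def)
  show "(\<lambda>a. F (a, b)) holomorphic_on strip \<xi>" if b: "b \<in> strip \<xi>" for b
    unfolding holomorphic_on_def
  proof
    fix a assume "a \<in> strip \<xi>"
    then obtain r where "r > 0" "(\<lambda>u. F (u, b)) holomorphic_on ball a r"
      using analytic2_on_holomorphic[OF assms(1) mem] b by metis
    then show "(\<lambda>a. F (a, b)) field_differentiable at a within strip \<xi>"
      using holomorphic_on_imp_differentiable_at[of _ "ball a r" a]
      by (auto intro: field_differentiable_at_within)
  qed
  show "(\<lambda>b. F (a, b)) holomorphic_on strip \<xi>" if a: "a \<in> strip \<xi>" for a
    unfolding holomorphic_on_def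
  proof
    fix b assume "b \<in> strip \<xi>"
    then obtain r where "r > 0" "(\<lambda>v. F (a, v)) holomorphic_on ball b r"
      using analytic2_on_holomorphic[OF assms(1) mem] a by metis
    then show "(\<lambda>b. F (a, b)) field_differentiable at b within strip \<xi>"
      using holomorphic_on_imp_differentiable_at[of _ "ball b r" b]
      by (auto intro: field_differentiable_at_within)
  qed
  show "F (a + 2 * pi, b) = F (a, b)" "F (a, b + 2 * pi) = F (a, b)" if "a \<in> strip \<xi>" "b \<in> strip \<xi>" for a b
    using assms(2) mem[OF that] by (auto simp: periodic2_on_def)
  show "continuous_on (strip \<xi> \<times> strip \<xi>) F"
  proof (rule continuous_at_imp_continuous_on, rule ballI)
    fix p assume "p \<in> strip \<xi> \<times> strip \<xi>"
    then obtain a b where p: "p = (a, b)" "(a, b) \<in> torus_strip \<xi>" using mem by auto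
    show "isCont F p" using analytic2_on_holomorphic[OF assms(1) p(2)] p(1) by metis
  qed
qed (rule assms)

context periodic_holomorphic2
begin

lemma fourier_coeff2_0:
  assumes real: "\<And>u v :: real. F (of_real u, of_real v) = of_real (f (u, v))"
  shows "fourier_coeff2 F (0, 0) = of_real (torus_mean f)"
proof -
  have z: "0 \<in> strip \<xi>" using of_real_strip[of 0] by simp
  have cF: "continuous_on S (\<lambda>x. F (of_real (fst x), of_real (snd x)))" for S :: "(real \<times> real) set"
    using continuous_shifted2[OF z z continuous_on_fst[OF continuous_on_id] continuous_on_snd[OF continuous_on_id], of S] by simp
  have "continuous_on S (\<lambda>x. Re (F (of_real (fst x), of_real (snd x))))" for S :: "(real \<times> real) set"
    by (intro continuous_intros cF)
  then have cf: "continuous_on S f" for S by (simp add: real)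
  have "fourier_coeff2 F (0, 0) = integral {0..2 * pi} (\<lambda>v. integral {0..2 * pi} (\<lambda>u. F (of_real u, of_real v)) / (2 * pi)) / (2 * pi)"
    by (simp add: fourier_coeff2_def fourier_coeff_def)
  also have "\<dots> = integral {0..2 * pi} (\<lambda>v. integral {0..2 * pi} (\<lambda>u. F (of_real u, of_real v))) / (2 * pi)\<^sup>2"
    by (simp add: power2_eq_square integral_divide)
  also have "integral {0..2 * pi} (\<lambda>v. integral {0..2 * pi} (\<lambda>u. F (of_real u, of_real v)))
      = integral {0..2 * pi} (\<lambda>u. integral {0..2 * pi} (\<lambda>v. F (of_real u, of_real v)))"
    unfolding cbox_interval[symmetric]
    by (rule integral_swap_continuous[symmetric]) (use cF in \<open>simp add: case_prod_unfold\<close>)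
  also have "\<dots> = integral {0..2 * pi} (\<lambda>u. of_real (integral {0..2 * pi} (\<lambda>v. f (u, v))))"
  proof (rule integral_cong)
    fix u
    have "(\<lambda>v. f (u, v)) integrable_on {0..2 * pi}"
      by (intro integrable_continuous_real continuous_on_compose2[OF cf[of UNIV]] continuous_intros) auto
    then have "((\<lambda>v. complex_of_real (f (u, v))) has_integral of_real (integral {0..2 * pi} (\<lambda>v. f (u, v)))) {0..2 * pi}"
      by (intro has_integral_of_real integrable_integral)
    then show "integral {0..2 * pi} (\<lambda>v. F (of_real u, of_real v)) = of_real (integral {0..2 * pi} (\<lambda>v. f (u, v)))"
      by (simp add: real integral_unique)
  qed
  also have "\<dots> = of_real (integral {0..2 * pi} (\<lambda>u. integral {0..2 * pi} (\<lambda>v. f (u, v))))"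
  proof (rule integral_unique, rule has_integral_of_real, rule integrable_integral)
    show "(\<lambda>u. integral {0..2 * pi} (\<lambda>v. f (u, v))) integrable_on {0..2 * pi}"
      using integral_integrable_2dim[OF cf, where a = 0 and b = "2 * pi" and c = 0 and d = "2 * pi"] by simp
  qed
  also have "integral {0..2 * pi} (\<lambda>u. integral {0..2 * pi} (\<lambda>v. f (u, v))) = integral ({0..2 * pi} \<times> {0..2 * pi}) f"
    using integral_prod_continuous[OF cf, where a = 0 and b = "2 * pi" and c = 0 and d = "2 * pi"] by (simp add: cbox_Pair_eq)
  finally show ?thesis by (simp add: torus_mean_def)
qed

lemma fourier_coeff2_cnj:
  assumes real: "\<And>u v :: real. F (of_real u, of_real v) \<in> \<real>"
  shows "fourier_coeff2 F (- p) = cnj (fourier_coeff2 F p)"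
proof -
  have "cnj (fourier_coeff \<phi> j) = fourier_coeff (\<lambda>z. cnj (\<phi> z)) (- j)" for \<phi> j
    unfolding fourier_coeff_def by (simp add: integral_cnj exp_cnj)
  moreover have "fourier_coeff (\<lambda>u. cnj (F (u, of_real v))) j = fourier_coeff (\<lambda>u. F (u, of_real v)) j" for v j
    unfolding fourier_coeff_def using real by (simp add: complex_is_Real_iff[symmetric] Reals_cnj_iff)
  ultimately have "cnj (fourier_coeff2 F p) = integral {0..2 * pi} (\<lambda>v. fourier_coeff (\<lambda>u. F (u, of_real v)) (- fst p) * exp (- \<i> * of_int (- snd p) * of_real v)) / (2 * pi)"
    unfolding fourier_coeff2_def by (simp add: fourier_coeff_def[of _ "- snd p"])
  also have "\<dots> = fourier_coeff2 F (- p)"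
    unfolding fourier_coeff2_def fst_uminus snd_uminus by (subst (2) fourier_coeff_def) simp
  finally show ?thesis by simp
qed

end

section \<open>Trigonometric series\<close>

lemma has_sum_diff:
  fixes f g :: "'a \<Rightarrow> 'b::topological_ab_group_add"
  assumes "(f has_sum a) A" "(g has_sum b) A"
  shows "((\<lambda>x. f x - g x) has_sum (a - b)) A"
  using has_sum_add[OF assms(1), of "\<lambda>x. - g x" "- b"] assms(2) by (simp add: has_sum_uminus)

lemma exp_has_sum:
  fixes z :: "'a::{banach, real_normed_field}"
  shows "((\<lambda>j. z ^ j / fact j) has_sum exp z) UNIV"
proof (rule norm_summable_imp_has_sum)
  show "summable (\<lambda>j. norm (z ^ j / fact j))"
    using summable_norm_exp[of z] by (simp add: scaleR_conv_of_real field_simps of_real_fact)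
  show "(\<lambda>j. z ^ j / fact j) sums exp z"
    using exp_converges[of z] by (simp add: scaleR_conv_of_real field_simps)
qed

text \<open>Supplies the double power series of a single Fourier mode and the sum of the absolute
  values of its terms, used as a majorant in \<open>trig_sum_analytic\<close>.\<close>

lemma exp_times_exp_has_sum:
  fixes z w :: complex
  shows "(\<lambda>(j, k). (z ^ j / fact j) * (w ^ k / fact k)) abs_summable_on UNIV"
    and "((\<lambda>(j, k). (z ^ j / fact j) * (w ^ k / fact k)) has_sum exp z * exp w) UNIV"
    and "(\<Sum>\<^sub>\<infinity>(j, k). norm ((z ^ j / fact j) * (w ^ k / fact k))) = exp (norm z) * exp (norm w)"
proof -
  have n: "norm (z ^ j / fact j) = norm z ^ j / fact j" for z :: complex and j
    by (simp add: norm_divide norm_power)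
  have a: "(\<lambda>j. z ^ j / fact j) abs_summable_on UNIV" for z :: complex
    unfolding n using exp_has_sum[of "norm z"] by (auto simp: summable_on_def)
  show s: "(\<lambda>(j, k). (z ^ j / fact j) * (w ^ k / fact k)) abs_summable_on UNIV"
    using abs_summable_product_Times[OF a[of z] a[of w]] by simp
  then obtain S where S: "((\<lambda>(j, k). (z ^ j / fact j) * (w ^ k / fact k)) has_sum S) (UNIV \<times> UNIV)"
    using Infinite_Sum.abs_summable_summable[OF s] by (auto simp: summable_on_def)
  have "((\<lambda>j. (z ^ j / fact j) * exp w) has_sum S) UNIV"
    by (rule has_sum_SigmaD[OF S]) (simp only: case_prod_conv has_sum_cmult_right exp_has_sum)
  then have "S = exp z * exp w"
    using has_sum_cmult_left[OF exp_has_sum[of z], of "exp w"] has_sum_unique by blast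
  then show "((\<lambda>(j, k). (z ^ j / fact j) * (w ^ k / fact k)) has_sum exp z * exp w) UNIV" using S by simp
  have "(\<lambda>(j, k). (norm z ^ j / fact j) * (norm w ^ k / fact k)) summable_on UNIV"
    using s by (simp only: case_prod_unfold norm_mult n)
  then obtain S' where S': "((\<lambda>(j, k). (norm z ^ j / fact j) * (norm w ^ k / fact k)) has_sum S') (UNIV \<times> UNIV)"
    by (auto simp: summable_on_def)
  have "((\<lambda>j. (norm z ^ j / fact j) * exp (norm w)) has_sum S') UNIV"
    by (rule has_sum_SigmaD[OF S']) (simp only: case_prod_conv has_sum_cmult_right exp_has_sum)
  then have "S' = exp (norm z) * exp (norm w)"
    using has_sum_cmult_left[OF exp_has_sum[of "norm z"], of "exp (norm w)"] has_sum_unique by blast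
  then show "(\<Sum>\<^sub>\<infinity>(j, k). norm ((z ^ j / fact j) * (w ^ k / fact k))) = exp (norm z) * exp (norm w)"
    using infsumI[OF S'] by (simp only: norm_mult n UNIV_Times_UNIV)
qed

definition trig_sum :: "(int \<times> int \<Rightarrow> complex) \<Rightarrow> complex \<times> complex \<Rightarrow> complex" where
  "trig_sum x \<psi> = (\<Sum>\<^sub>\<infinity>p. x p * exp (\<i> * (of_int (fst p) * fst \<psi> + of_int (snd p) * snd \<psi>)))"

lemma norm_exp_strip_le:
  assumes "(a, b) \<in> torus_strip \<xi>"
  shows "norm (exp (\<i> * (of_int (fst p) * a + of_int (snd p) * b)))
    \<le> exp (\<xi> * (\<bar>real_of_int (fst p)\<bar> + \<bar>real_of_int (snd p)\<bar>))"
proof -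
  have "- (of_int (fst p) * Im a) \<le> \<bar>real_of_int (fst p)\<bar> * \<xi>"
    using assms mult_left_mono[of "\<bar>Im a\<bar>" \<xi> "\<bar>real_of_int (fst p)\<bar>"] abs_ge_minus_self[of "of_int (fst p) * Im a"]
    by (simp add: torus_strip_def abs_mult)
  moreover have "- (of_int (snd p) * Im b) \<le> \<bar>real_of_int (snd p)\<bar> * \<xi>"
    using assms mult_left_mono[of "\<bar>Im b\<bar>" \<xi> "\<bar>real_of_int (snd p)\<bar>"] abs_ge_minus_self[of "of_int (snd p) * Im b"]
    by (simp add: torus_strip_def abs_mult)
  ultimately show ?thesis by (simp add: algebra_simps)
qed

lemma trig_sum_periodic: "periodic2_on (trig_sum x) S"
proof -
  have e: "exp (\<i> * (of_int j * (u + of_real (2 * pi)) + w)) = exp (\<i> * (of_int j * u + w))" for j u w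
  proof -
    have "exp (\<i> * (of_int j * (u + of_real (2 * pi)) + w)) = exp (\<i> * (of_int j * u + w)) * exp (2 * of_int j * pi * \<i>)"
      unfolding exp_add[symmetric] by (rule arg_cong[where f = exp]) (simp add: algebra_simps)
    also have "exp (2 * of_int j * pi * \<i>) = 1" by (rule exp_integer_2pi) auto
    finally show ?thesis by (simp only: mult_1_right)
  qed
  have e': "exp (\<i> * (w + of_int j * (u + of_real (2 * pi)))) = exp (\<i> * (w + of_int j * u))" for j u w
    using e[of j u w] by (simp only: add.commute)
  show ?thesis
    unfolding periodic2_on_def trig_sum_def fst_conv snd_conv e e' by auto
qed

text \<open>Each mode is expanded about (a, b). On the polydisc of radius \<rho> - \<xi> the
  absolute values of the terms of one mode add up to at most its weight at width \<rho>, so the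
  family over modes and exponents is absolutely summable and the two summations may be
  exchanged.\<close>

lemma trig_sum_analytic:
  assumes x: "(\<lambda>p. norm (x p) * exp (\<rho> * (\<bar>real_of_int (fst p)\<bar> + \<bar>real_of_int (snd p)\<bar>))) summable_on UNIV"
    and "\<xi> < \<rho>"
  shows "analytic2_on (trig_sum x) (torus_strip \<xi>)"
  unfolding analytic2_on_def
proof (intro ballI, clarify)
  fix a b assume ab: "(a, b) \<in> torus_strip \<xi>"
  define E where "E = (\<lambda>p::int \<times> int. exp (\<i> * (of_int (fst p) * a + of_int (snd p) * b)))"
  define C where "C = (\<lambda>j k. \<Sum>\<^sub>\<infinity>p. x p * E p * ((\<i> * of_int (fst p)) ^ j / fact j) * ((\<i> * of_int (snd p)) ^ k / fact k))"
  show "\<exists>r>0. \<exists>C. \<forall>u v. norm (u - a) < r \<longrightarrow> norm (v - b) < r \<longrightarrow>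
    ((\<lambda>(j, k). C j k * (u - a) ^ j * (v - b) ^ k) has_sum trig_sum x (u, v)) UNIV"
  proof (intro exI[of _ "\<rho> - \<xi>"] exI[of _ C] conjI allI impI)
    show "\<rho> - \<xi> > 0" using assms by simp
    fix u v assume uv: "norm (u - a) < \<rho> - \<xi>" "norm (v - b) < \<rho> - \<xi>"
    define z w where "z = (\<lambda>p::int \<times> int. \<i> * of_int (fst p) * (u - a))" and "w = (\<lambda>p::int \<times> int. \<i> * of_int (snd p) * (v - b))"
    define T where "T = (\<lambda>p q. x p * E p * ((z p ^ fst q / fact (fst q)) * (w p ^ snd q / fact (snd q))))"
    have Ts: "((\<lambda>q. T p q) has_sum x p * exp (\<i> * (of_int (fst p) * u + of_int (snd p) * v))) UNIV" for p
    proof -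
      have "exp (\<i> * (of_int (fst p) * u + of_int (snd p) * v)) = E p * (exp (z p) * exp (w p))"
        by (simp add: E_def z_def w_def exp_add[symmetric] algebra_simps)
      then show ?thesis
        unfolding T_def using has_sum_cmult_right[OF exp_times_exp_has_sum(2)[of "z p" "w p"], of "x p * E p"]
        by (simp add: case_prod_unfold mult.assoc)
    qed
    have Tn: "(\<Sum>\<^sub>\<infinity>q. norm (T p q)) \<le> norm (x p) * exp (\<rho> * (\<bar>real_of_int (fst p)\<bar> + \<bar>real_of_int (snd p)\<bar>))"
      and Ta: "T p abs_summable_on UNIV" for p
    proof -
      let ?l = "\<bar>real_of_int (fst p)\<bar> + \<bar>real_of_int (snd p)\<bar>"
      show "T p abs_summable_on UNIV"
        unfolding T_def norm_mult[of "x p * E p"] using exp_times_exp_has_sum(1)[of "z p" "w p"]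
        by (intro summable_on_cmult_right) (simp add: case_prod_unfold)
      have "(\<Sum>\<^sub>\<infinity>q. norm (T p q)) = norm (x p) * norm (E p) * (exp (norm (z p)) * exp (norm (w p)))"
        unfolding T_def norm_mult[of "x p * E p"] infsum_cmult_right'
        using exp_times_exp_has_sum(3)[of "z p" "w p"] by (simp add: case_prod_unfold norm_mult)
      also have "\<dots> \<le> norm (x p) * exp (\<xi> * ?l) * exp ((\<rho> - \<xi>) * ?l)"
      proof (intro mult_mono mult_left_mono)
        show "norm (E p) \<le> exp (\<xi> * ?l)" unfolding E_def by (rule norm_exp_strip_le[OF ab])
        have "norm (z p) \<le> \<bar>real_of_int (fst p)\<bar> * (\<rho> - \<xi>)" "norm (w p) \<le> \<bar>real_of_int (snd p)\<bar> * (\<rho> - \<xi>)"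
          unfolding z_def w_def norm_mult using uv by (auto intro!: mult_left_mono)
        then show "exp (norm (z p)) * exp (norm (w p)) \<le> exp ((\<rho> - \<xi>) * ?l)"
          by (simp add: exp_add[symmetric] algebra_simps)
      qed auto
      also have "\<dots> = norm (x p) * exp (\<rho> * ?l)"
        by (simp add: mult.assoc exp_add[symmetric] distrib_right[symmetric])
      finally show "(\<Sum>\<^sub>\<infinity>q. norm (T p q)) \<le> norm (x p) * exp (\<rho> * ?l)" .
    qed
    have "(\<lambda>(p, q). T p q) abs_summable_on UNIV \<times> UNIV"
    proof (rule Infinite_Sum.abs_summable_on_Sigma_iff[THEN iffD2], intro conjI ballI)
      show "(\<lambda>q. case (p, q) of (p, q) \<Rightarrow> T p q) abs_summable_on UNIV" for p using Ta by simp
      have "(\<lambda>p. \<Sum>\<^sub>\<infinity>q. norm (T p q)) summable_on UNIV"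
        by (rule summable_on_comparison_test[OF x Tn]) (simp add: infsum_nonneg)
      then show "(\<lambda>p. \<Sum>\<^sub>\<infinity>q. norm (case (p, q) of (p, q) \<Rightarrow> T p q)) abs_summable_on UNIV"
        by (simp add: infsum_nonneg)
    qed
    then have Tsum: "(\<lambda>(p, q). T p q) summable_on UNIV \<times> UNIV" by (rule Infinite_Sum.abs_summable_summable)
    then obtain S where S: "((\<lambda>(p, q). T p q) has_sum S) (UNIV \<times> UNIV)" by (auto simp: summable_on_def)
    have "((\<lambda>p. x p * exp (\<i> * (of_int (fst p) * u + of_int (snd p) * v))) has_sum S) UNIV"
      by (rule has_sum_SigmaD[OF S]) (simp only: case_prod_conv Ts)
    then have S': "trig_sum x (u, v) = S" by (simp add: trig_sum_def infsumI)
    have "((\<lambda>(q, p). T p q) has_sum S) (UNIV \<times> UNIV)"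
      using has_sum_reindex_bij_betw[of "\<lambda>(q, p). (p, q)" UNIV UNIV "\<lambda>(p, q). T p q" S] S
      by (simp add: case_prod_unfold bij_betw_def inj_on_def surj_def)
    moreover have "((\<lambda>p. T p q) has_sum C (fst q) (snd q) * (u - a) ^ fst q * (v - b) ^ snd q) UNIV" for q
    proof -
      have "(\<lambda>(q, p). T p q) summable_on UNIV \<times> UNIV" using calculation by (auto simp: summable_on_def)
      then have s: "(\<lambda>p. T p q) summable_on UNIV"
        using summable_on_SigmaD1[of "\<lambda>q p. T p q" UNIV "\<lambda>_. UNIV"] by simp
      have "(\<Sum>\<^sub>\<infinity>p. T p q) = (\<Sum>\<^sub>\<infinity>p. x p * E p * ((\<i> * of_int (fst p)) ^ fst q / fact (fst q)) * ((\<i> * of_int (snd p)) ^ snd q / fact (snd q)) * ((u - a) ^ fst q * (v - b) ^ snd q))"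
        by (rule infsum_cong) (simp add: T_def z_def w_def power_mult_distrib)
      also have "\<dots> = C (fst q) (snd q) * ((u - a) ^ fst q * (v - b) ^ snd q)"
        unfolding C_def by (rule infsum_cmult_left')
      finally show ?thesis using has_sum_infsum[OF s] by (simp add: mult.assoc)
    qed
    ultimately have "((\<lambda>q. C (fst q) (snd q) * (u - a) ^ fst q * (v - b) ^ snd q) has_sum S) UNIV"
      by (intro has_sum_SigmaD[where f = "\<lambda>(q, p). T p q"]) (simp_all only: case_prod_conv)
    then show "((\<lambda>(j, k). C j k * (u - a) ^ j * (v - b) ^ k) has_sum trig_sum x (u, v)) UNIV"
      unfolding S' by (simp add: case_prod_unfold)
  qed
qed

text \<open>Differentiation under the sum, with the quadratic Taylor remainder of each exponential
  as majorant; it is summable because the twice differentiated series \<open>x''\<close> is an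
  element of \<open>l1\<close>.\<close>

lemma eval_char_has_derivative:
  fixes y :: "'i \<Rightarrow> real"
  assumes x': "\<And>p. coef x' p = \<i> * y p * coef x p" and x'': "\<And>p. coef x'' p = \<i> * y p * coef x' p"
  shows "((\<lambda>t. eval_char (\<lambda>p. exp (\<i> * of_real (y p * t))) x) has_vector_derivative
    eval_char (\<lambda>p. exp (\<i> * of_real (y p * t))) x') (at t)"
proof -
  let ?e = "\<lambda>t p. exp (\<i> * complex_of_real (y p * t))"
  have e1: "norm (?e t p) = 1" for t p by simp
  have s: "(\<lambda>p. coef x p * ?e t p) summable_on UNIV" for x t
    by (rule Infinite_Sum.abs_summable_summable[OF eval_char_summable]) simp
  have le: "norm (eval_char (?e (t + h)) x - eval_char (?e t) x - h *\<^sub>R eval_char (?e t) x') \<le> norm x'' * h\<^sup>2" for h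
  proof -
    let ?d = "\<lambda>p. coef x p * ?e (t + h) p - coef x p * ?e t p - h *\<^sub>R (coef x' p * ?e t p)"
    have "((\<lambda>p. ?d p) has_sum eval_char (?e (t + h)) x - eval_char (?e t) x - h *\<^sub>R eval_char (?e t) x') UNIV"
      unfolding eval_char_def
      by (intro has_sum_diff has_sum_scaleR has_sum_infsum s)
    moreover have "((\<lambda>p. norm (coef x'' p) * h\<^sup>2) has_sum norm x'' * h\<^sup>2) UNIV"
      unfolding norm_l1_def by (intro has_sum_cmult_left has_sum_infsum) simp
    moreover have "norm (?d p) \<le> norm (coef x'' p) * h\<^sup>2" for p
    proof -
      let ?z = "\<i> * complex_of_real (y p * h)"
      have "?d p = coef x p * ?e t p * (exp ?z - (1 + ?z))"
        by (simp add: x' algebra_simps exp_add scaleR_conv_of_real)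
      moreover have "norm (exp ?z - (\<Sum>k\<le>1. ?z ^ k / fact k)) \<le> exp \<bar>Re ?z\<bar> * (norm ?z ^ Suc 1) / fact 1"
        by (rule Taylor_exp)
      then have "norm (exp ?z - (1 + ?z)) \<le> (norm ?z)\<^sup>2" by (simp add: power2_eq_square)
      ultimately have "norm (?d p) \<le> norm (coef x p) * (norm ?z)\<^sup>2"
        by (simp add: norm_mult mult_left_mono)
      also have "\<dots> = norm (coef x'' p) * h\<^sup>2"
        by (simp add: x' x'' norm_mult power2_eq_square abs_mult)
      finally show ?thesis .
    qed
    ultimately show ?thesis by (rule norm_infsum_le)
  qed
  show ?thesis
    unfolding has_vector_derivative_def has_derivative_at
  proof (intro conjI bounded_linear_scaleR_left)
    show "(\<lambda>h. norm (eval_char (?e (t + h)) x - eval_char (?e t) x - h *\<^sub>R eval_char (?e t) x') / norm h) \<midarrow>0\<rightarrow> 0"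
    proof (rule Lim_null_comparison)
      show "\<forall>\<^sub>F h in at 0. norm (norm (eval_char (?e (t + h)) x - eval_char (?e t) x - h *\<^sub>R eval_char (?e t) x') / norm h) \<le> norm x'' * \<bar>h\<bar>"
        unfolding eventually_at_filter
      proof (rule always_eventually, intro allI impI)
        fix h :: real assume "h \<noteq> 0"
        then show "norm (norm (eval_char (?e (t + h)) x - eval_char (?e t) x - h *\<^sub>R eval_char (?e t) x') / norm h) \<le> norm x'' * \<bar>h\<bar>"
          using le[of h] by (simp add: divide_le_eq mult.assoc power2_eq_square)
      qed
      show "((\<lambda>h::real. norm x'' * \<bar>h\<bar>) \<longlongrightarrow> 0) (at 0)"
        by (auto intro!: tendsto_eq_intros)
    qed
  qed
qed

section \<open>The leading order and the linearised operator\<close>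

abbreviation real_l1 :: "'i::ab_group_add l1 \<Rightarrow> bool" where
  "real_l1 x \<equiv> cnj_twist (\<lambda>_. 1) x x"

lemma real_l1_power: "real_l1 x \<Longrightarrow> real_l1 (x ^ n)"
  by (rule cnj_twist_power) auto

lemma real_l1_one: "real_l1 1"
  by (rule cnj_twist_one) auto

lemma real_l1_coef_0: "real_l1 x \<Longrightarrow> coef x 0 = of_real (Re (coef x 0))"
  unfolding cnj_twist_def by (metis Reals_cnj_iff add.inverse_neutral mult_1 of_real_Re)

text \<open>Parseval; hence real elements are not nilpotent.\<close>

lemma real_l1_square_coef_0:
  assumes "real_l1 x" "x \<noteq> 0"
  shows "Re (coef (x * x) 0) > 0"
proof -
  have eq: "coef x j * coef x (0 - j) = of_real ((norm (coef x j))\<^sup>2)" for j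
  proof -
    have "coef x (- j) = cnj (coef x j)" using assms(1) unfolding cnj_twist_def by (metis complex_cnj_cnj mult_1)
    then show ?thesis by (simp only: complex_norm_square diff_0)
  qed
  have "(\<lambda>j. coef x j * coef x (0 - j)) abs_summable_on UNIV"
    by (rule conv_terms_summable) auto
  then have s: "(\<lambda>j. (norm (coef x j))\<^sup>2) summable_on UNIV"
    unfolding eq norm_of_real by simp
  have "coef (x * x) 0 = (\<Sum>\<^sub>\<infinity>j. complex_of_real ((norm (coef x j))\<^sup>2))"
    unfolding coef_mult conv_def eq ..
  also have "\<dots> = of_real (\<Sum>\<^sub>\<infinity>j. (norm (coef x j))\<^sup>2)"
    by (rule infsumI has_sum_of_real has_sum_infsum s)+
  finally have *: "Re (coef (x * x) 0) = (\<Sum>\<^sub>\<infinity>j. (norm (coef x j))\<^sup>2)" by simp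
  obtain k where "coef x k \<noteq> 0" using assms(2) by (metis coef_zero l1_eqI)
  then have "0 < (norm (coef x k))\<^sup>2" by simp
  also have "\<dots> \<le> (\<Sum>\<^sub>\<infinity>j. (norm (coef x j))\<^sup>2)"
    using finite_sum_le_infsum[OF s, of "{k}"] by simp
  finally show ?thesis using * by simp
qed

text \<open>Repeated squaring produces nonzero powers whose exponents are powers of two, since the
  square of a nonzero real element has positive mean; and \<open>x ^ m\<close> divides one of
  them.\<close>

lemma real_l1_power_nonzero:
  assumes "real_l1 x" "x \<noteq> 0"
  shows "x ^ m \<noteq> 0"
proof -
  have "x ^ (2 ^ k) \<noteq> 0" for k :: nat
  proof (induction k)
    case (Suc k)
    have "Re (coef (x ^ 2 ^ k * x ^ 2 ^ k) 0) > 0"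
      by (rule real_l1_square_coef_0[OF real_l1_power[OF assms(1)] Suc])
    then have "x ^ 2 ^ k * x ^ 2 ^ k \<noteq> 0" by force
    then show ?case by (simp add: power_add[symmetric] mult_2)
  qed (use assms in simp)
  moreover have "x ^ (2 ^ m) = x ^ m * x ^ (2 ^ m - m)"
    using less_imp_le[OF less_exp[of m]] by (simp add: power_add[symmetric])
  ultimately show ?thesis by (metis mult_zero_left)
qed

text \<open>For large |z| the mean behaves like z^n, which takes both signs as n is odd, and the
  intermediate value theorem applies. Large z is reached through t = 1 / z, where \<psi> is
  continuous at 0 with value 1.\<close>

lemma odd_power_mean_zero:
  fixes U :: "'i::ab_group_add l1"
  assumes "odd n"
  obtains z :: real where "Re (coef ((U + z *\<^sub>R 1) ^ n) 0) = 0"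
proof -
  define \<phi> where "\<phi> = (\<lambda>z::real. Re (coef ((U + z *\<^sub>R 1) ^ n) 0))"
  define \<psi> where "\<psi> = (\<lambda>t::real. Re (coef ((1 + t *\<^sub>R U) ^ n) 0))"
  have cc: "continuous_on S f \<Longrightarrow> continuous_on S (\<lambda>x. coef (f x) 0)" for S :: "real set" and f :: "real \<Rightarrow> 'i l1"
    by (rule bounded_linear.continuous_on[OF bounded_linear_coef])
  have c\<phi>: "continuous_on S \<phi>" and c\<psi>: "continuous_on S \<psi>" for S
    unfolding \<phi>_def \<psi>_def by (intro continuous_intros cc)+
  have "\<psi> 0 = 1" by (simp add: \<psi>_def)
  then obtain d where d: "d > 0" "\<And>t. \<bar>t\<bar> < d \<Longrightarrow> \<psi> t > 0"
    using c\<psi>[of UNIV] unfolding continuous_on_iff dist_real_def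
    by (metis (no_types, opaque_lifting) UNIV_I abs_diff_less_iff diff_zero diff_self zero_less_one)
  have eq: "\<phi> z = z ^ n * \<psi> (1 / z)" if "z \<noteq> 0" for z
  proof -
    have "U + z *\<^sub>R 1 = z *\<^sub>R (1 + (1 / z) *\<^sub>R U)" using that by (simp add: scaleR_add_right)
    then show ?thesis by (simp add: \<phi>_def \<psi>_def scaleR_power)
  qed
  have "\<phi> (2 / d) \<ge> 0"
    using eq[of "2 / d"] d(2)[of "d / 2"] d(1) by simp
  moreover have "\<phi> (- (2 / d)) \<le> 0"
    using eq[of "- (2 / d)"] d(2)[of "- (d / 2)"] d(1) assms by (simp add: mult_nonpos_nonneg)
  ultimately obtain z where "\<phi> z = 0"
    using IVT'[of \<phi> "- (2 / d)" 0 "2 / d", OF _ _ _ c\<phi>] d(1) by auto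
  then show ?thesis using that by (simp add: \<phi>_def)
qed

text \<open>Where |\<epsilon> y| \<le> 1 the real part retains half of \<kappa>; elsewhere |y|
  itself is at least |\<kappa>|. The two bounds make S and E bounded, whatever the arithmetic of the
  frequencies. Both signs of \<kappa> are covered because \<open>abar\<close> has the sign of
  \<open>\<gamma> 0\<close>.\<close>

lemma damped_symbol_bounds:
  fixes y \<kappa> \<epsilon> :: real
  assumes "\<epsilon> > 0" "\<bar>\<kappa>\<bar> * \<epsilon> \<le> 1 / 2"
  defines "D \<equiv> \<i> * of_real y + of_real \<kappa> / (1 + \<i> * of_real (\<epsilon> * y))"
  shows "norm D \<ge> \<bar>\<kappa>\<bar> / 2" "norm D \<ge> \<bar>y\<bar> / 2"
proof -
  define q where "q = 1 + (\<epsilon> * y)\<^sup>2"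
  have q: "q \<ge> 1" by (simp add: q_def)
  have Re: "Re D = \<kappa> / q" and Im: "Im D = y * (1 - \<kappa> * \<epsilon> / q)"
    by (auto simp: D_def q_def Re_divide Im_divide power2_eq_square field_simps)
  have "\<bar>\<kappa> * \<epsilon> / q\<bar> \<le> \<bar>\<kappa> * \<epsilon>\<bar> / 1"
    unfolding abs_divide using q by (intro divide_left_mono) (auto simp: abs_mult)
  also have "\<dots> \<le> 1 / 2" using assms(1,2) by (simp add: abs_mult)
  finally have h: "\<bar>1 - \<kappa> * \<epsilon> / q\<bar> \<ge> 1 / 2"
    using abs_ge_self[of "\<kappa> * \<epsilon> / q"] by linarith
  have "\<bar>Im D\<bar> \<ge> \<bar>y\<bar> * (1 / 2)"
    unfolding Im abs_mult by (rule mult_left_mono[OF h abs_ge_zero])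
  then show y: "norm D \<ge> \<bar>y\<bar> / 2" using abs_Im_le_cmod[of D] by linarith
  show "norm D \<ge> \<bar>\<kappa>\<bar> / 2"
  proof (cases "\<bar>\<epsilon> * y\<bar> \<le> 1")
    case True
    then have "q \<le> 2" by (simp add: q_def abs_square_le_1[symmetric])
    then have "\<bar>\<kappa>\<bar> / 2 \<le> \<bar>\<kappa>\<bar> / q" using q by (intro divide_left_mono) auto
    also have "\<dots> = \<bar>Re D\<bar>" using q by (simp add: Re abs_divide)
    finally show ?thesis using abs_Re_le_cmod[of D] by linarith
  next
    case False
    then have "\<epsilon> * \<bar>y\<bar> > 1" using assms(1) by (simp add: abs_mult)
    then have "\<epsilon> * \<bar>\<kappa>\<bar> \<le> \<epsilon> * \<bar>y\<bar>" using assms(2) by (simp add: mult.commute)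
    then have "\<bar>\<kappa>\<bar> \<le> \<bar>y\<bar>" using assms(1) by (rule mult_left_le_imp_le)
    then show ?thesis using y by linarith
  qed
qed

section \<open>The data and the widths of their strips\<close>

text \<open>\<open>fh\<close> holds the Fourier coefficients of f - f0. The widths are \<rho> + 2
  \<sigma> for \<open>fd\<close>, \<rho> + \<sigma> for \<open>W\<close>, \<open>a\<close> and
  \<open>p0\<close>, and \<rho> for \<open>b\<close>, \<open>p1\<close> and the solution.
  \<open>fh_nonzero\<close> makes \<open>W\<close> nonzero and thereby \<open>abar\<close>
  nonzero.\<close>

locale response_setting =
  fixes \<alpha> K \<sigma> \<eta> \<rho> s B :: real and n :: nat and \<gamma> :: "nat \<Rightarrow> real" and fh :: "int \<times> int \<Rightarrow> complex"
  assumes K: "K > 0" and \<sigma>: "\<sigma> \<ge> 0" and \<rho>: "\<rho> \<ge> 0" "\<rho> + 2 * \<sigma> < \<eta>"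
    and small_divisor: "\<And>p. p \<noteq> 0 \<Longrightarrow> exp (- \<sigma> * (\<bar>real_of_int (fst p)\<bar> + \<bar>real_of_int (snd p)\<bar>))
        \<le> K * \<bar>of_int (fst p) + \<alpha> * of_int (snd p)\<bar>"
    and fh: "\<And>p. norm (fh p) \<le> B * exp (- \<eta> * (\<bar>real_of_int (fst p)\<bar> + \<bar>real_of_int (snd p)\<bar>))"
    and fh_cnj: "\<And>p. fh (- p) = cnj (fh p)" and fh_0: "fh 0 = 0" and fh_nonzero: "\<exists>p. fh p \<noteq> 0"
    and n: "odd n" "n > 1" and \<gamma>_0: "\<gamma> 0 \<noteq> 0" and s: "s > 0"
    and \<gamma>: "summable (\<lambda>j. \<bar>\<gamma> j\<bar> * s ^ j)"
begin

definition len :: "int \<times> int \<Rightarrow> real" where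
  "len p = \<bar>real_of_int (fst p)\<bar> + \<bar>real_of_int (snd p)\<bar>"

definition frq :: "int \<times> int \<Rightarrow> real" where
  "frq p = of_int (fst p) + \<alpha> * of_int (snd p)"

definition wt :: "real \<Rightarrow> int \<times> int \<Rightarrow> real" where
  "wt r p = exp (r * len p)"

lemma len: "len p \<ge> 0" "len (p + q) \<le> len p + len q" "len (- p) = len p"
  by (auto simp: len_def)

lemma frq: "frq (p + q) = frq p + frq q" "frq (- p) = - frq p" "frq 0 = 0"
  by (auto simp: frq_def algebra_simps)

lemma frq_lower: "p \<noteq> 0 \<Longrightarrow> exp (- \<sigma> * len p) \<le> K * \<bar>frq p\<bar>"
  using small_divisor by (simp add: len_def frq_def)

lemma frq_nonzero: "p \<noteq> 0 \<Longrightarrow> frq p \<noteq> 0"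
  using frq_lower[of p] exp_gt_zero[of "- \<sigma> * len p"] by auto

lemma wt: "wt r p \<ge> 0" "r \<ge> 0 \<Longrightarrow> wt r p \<ge> 1" "r \<ge> 0 \<Longrightarrow> wt r (p + q) \<le> wt r p * wt r q"
  using len by (auto simp: wt_def exp_add[symmetric] distrib_left[symmetric] mult_left_mono)

lemma wt_add: "wt (r + r') p = wt r p * exp (r' * len p)"
  by (simp add: wt_def distrib_right exp_add)

lemma wsummable_power_wt: "r \<ge> 0 \<Longrightarrow> wsummable (wt r) x \<Longrightarrow> wsummable (wt r) (x ^ m)"
  by (rule wsummable_power) (auto simp: wt)

lemma wsummable_wt_mono:
  assumes "r \<le> r'" "wsummable (wt r') x"
  shows "wsummable (wt r) x"
proof (rule wsummable_mono[OF assms(2), where C = 1])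
  have "wt r p \<le> wt r' p" for p
    unfolding wt_def using mult_right_mono[OF assms(1) len(1)[of p]] by simp
  then show "norm (coef x p) * wt r p \<le> 1 * (norm (coef x p) * wt r' p)" for p
    using mult_left_mono[of "wt r p" "wt r' p" "norm (coef x p)"] by simp
qed (rule wt)

text \<open>The coefficient of index 0 is discarded, so this inverts the derivative along the flow
  only on families of mean zero. It is meaningful when the quotients are summable, which the lemma
  of the same name derives from a weight wider by \<sigma>.\<close>

definition dinv :: "(int \<times> int) l1 \<Rightarrow> (int \<times> int) l1" where
  "dinv x = Abs_l1 (\<lambda>p. if p = 0 then 0 else coef x p / (\<i> * frq p))"

lemma dinv:
  assumes r: "r \<ge> 0" and x: "wsummable (wt (r + \<sigma>)) x"
  shows "coef (dinv x) p = (if p = 0 then 0 else coef x p / (\<i> * frq p))" "wsummable (wt r) (dinv x)"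
proof -
  let ?d = "\<lambda>p. if p = 0 then 0 else coef x p / (\<i> * frq p)"
  have le: "norm (?d p) * wt r p \<le> K * (norm (coef x p) * wt (r + \<sigma>) p)" for p
  proof (cases "p = 0")
    case False
    have "1 \<le> K * \<bar>frq p\<bar> * exp (\<sigma> * len p)"
      using mult_right_mono[OF frq_lower[OF False], of "exp (\<sigma> * len p)"] by (simp add: exp_add[symmetric])
    then have "1 / \<bar>frq p\<bar> \<le> K * exp (\<sigma> * len p)" using frq_nonzero[OF False] by (simp add: field_simps)
    then have "norm (coef x p) * wt r p * (1 / \<bar>frq p\<bar>) \<le> norm (coef x p) * wt r p * (K * exp (\<sigma> * len p))"
      using wt by (intro mult_left_mono) auto
    then show ?thesis using False
      by (simp add: norm_divide norm_mult wt_add mult_ac)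
  qed (use K wt in \<open>auto intro!: mult_nonneg_nonneg\<close>)
  have s: "(\<lambda>p. K * (norm (coef x p) * wt (r + \<sigma>) p)) summable_on UNIV"
    using x unfolding wsummable_def by (rule summable_on_cmult_right)
  have "?d abs_summable_on UNIV"
  proof (rule summable_on_comparison_test[OF s])
    show "norm (?d p) \<le> K * (norm (coef x p) * wt (r + \<sigma>) p)" for p
      using le[of p] mult_left_mono[OF wt(2)[OF r, of p] norm_ge_zero[of "?d p"]] by linarith
  qed auto
  then show c: "coef (dinv x) p = ?d p" for p by (simp add: dinv_def coef_Abs_l1)
  show "wsummable (wt r) (dinv x)"
    by (rule wsummable_mono[OF x, where C = K]) (unfold c, use le wt in auto)
qed

lemma dinv_real:
  assumes "r \<ge> 0" "wsummable (wt (r + \<sigma>)) x" "real_l1 x" shows "real_l1 (dinv x)"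
  unfolding cnj_twist_def
proof
  fix p
  have "coef x p = cnj (coef x (- p))" using assms(3) unfolding cnj_twist_def by (metis mult_1)
  then have "cnj (coef x (- p)) = coef x p" by (rule sym)
  then show "coef (dinv x) p = 1 * cnj (coef (dinv x) (- p))"
    by (simp add: dinv(1)[OF assms(1,2)] frq)
qed

definition fd :: "(int \<times> int) l1" where "fd = Abs_l1 fh"

lemma fh_wsummable: "r < \<eta> \<Longrightarrow> (\<lambda>p. norm (fh p) * wt r p) summable_on UNIV"
proof (rule summable_on_comparison_test)
  assume r: "r < \<eta>"
  show "(\<lambda>p. B * exp (- (\<eta> - r) * (\<bar>real_of_int (fst p)\<bar> + \<bar>real_of_int (snd p)\<bar>))) summable_on UNIV"
    by (rule summable_on_cmult_right[OF exp_neg_abs_summable_int2]) (use r in simp)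
  show "norm (fh p) * wt r p \<le> B * exp (- (\<eta> - r) * (\<bar>real_of_int (fst p)\<bar> + \<bar>real_of_int (snd p)\<bar>))" for p
    using mult_right_mono[OF fh wt(1), of p r p]
    by (simp add: wt_def len_def exp_add[symmetric] mult.assoc algebra_simps)
qed (use wt in auto)

lemma coef_fd: "coef fd p = fh p"
proof -
  have "0 < \<eta>" using \<rho> \<sigma> by linarith
  then have "fh abs_summable_on UNIV" using fh_wsummable[of 0] by (simp add: wt_def)
  then show ?thesis by (simp add: fd_def coef_Abs_l1)
qed

lemma fd: "wsummable (wt (\<rho> + \<sigma> + \<sigma>)) fd" "real_l1 fd"
  using fh_wsummable[of "\<rho> + \<sigma> + \<sigma>"] \<rho> fh_cnj by (auto simp: wsummable_def coef_fd cnj_twist_def)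

text \<open>The chosen constant is real, so that W stays real, and makes the mean of
  \<open>W ^ n\<close> vanish (\<open>coef_W_power_n\<close>); otherwise \<open>p1\<close> would not
  be a primitive of \<open>p0\<close>.\<close>

definition W :: "(int \<times> int) l1" where
  "W = dinv fd + (SOME z. Re (coef ((dinv fd + z *\<^sub>R 1) ^ n) 0) = 0) *\<^sub>R 1"

definition a :: "(int \<times> int) l1" where "a = (real n * \<gamma> 0) *\<^sub>R W ^ (n - 1)"

definition abar :: real where "abar = Re (coef a 0)"

definition b :: "(int \<times> int) l1" where "b = dinv a"

definition p0 :: "(int \<times> int) l1" where "p0 = \<gamma> 0 *\<^sub>R W ^ n"

definition p1 :: "(int \<times> int) l1" where "p1 = dinv p0"

lemma r0: "\<rho> + \<sigma> \<ge> 0" using \<rho> \<sigma> by simp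

lemma W: "wsummable (wt (\<rho> + \<sigma>)) W" "real_l1 W" "W \<noteq> 0"
  "\<i> * frq p * coef W p = fh p"
proof -
  note di = dinv[OF r0 fd(1)]
  show "wsummable (wt (\<rho> + \<sigma>)) W"
    unfolding W_def one_l1_def by (intro wsummable_add wsummable_scaleR di wsummable_single wt)
  show "real_l1 W"
    unfolding W_def by (intro cnj_twist_add cnj_twist_scaleR dinv_real[OF r0] fd real_l1_one)
  show eq: "\<i> * frq p * coef W p = fh p" for p
    using frq_nonzero[of p] by (auto simp: W_def di(1) coef_fd fh_0 frq)
  show "W \<noteq> 0" using fh_nonzero eq by force
qed

lemma coef_W_power_n: "coef (W ^ n) 0 = 0"
proof -
  obtain z :: real where "Re (coef ((dinv fd + z *\<^sub>R 1) ^ n) 0) = 0"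
    using odd_power_mean_zero[OF n(1)] by blast
  then have "Re (coef (W ^ n) 0) = 0" unfolding W_def by (rule someI)
  then show ?thesis using real_l1_coef_0[OF real_l1_power[OF W(2)], of n] by simp
qed

lemma a: "wsummable (wt (\<rho> + \<sigma>)) a" "real_l1 a" "coef a 0 = of_real abar" "abar \<noteq> 0"
proof -
  show "wsummable (wt (\<rho> + \<sigma>)) a" unfolding a_def by (intro wsummable_scaleR wsummable_power_wt r0 W)
  show r: "real_l1 a" unfolding a_def by (intro cnj_twist_scaleR real_l1_power W)
  show "coef a 0 = of_real abar" unfolding abar_def by (rule real_l1_coef_0[OF r])
  obtain m where m: "n = 2 * m + 1" using n(1) by (rule oddE)
  have "Re (coef (W ^ m * W ^ m) 0) > 0"
    by (rule real_l1_square_coef_0[OF real_l1_power real_l1_power_nonzero]) (rule W)+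
  moreover have "W ^ (n - 1) = W ^ m * W ^ m"
    unfolding power_add[symmetric] using m by (intro arg_cong[where f = "power W"]) simp
  ultimately show "abar \<noteq> 0"
    using n \<gamma>_0 by (simp add: abar_def a_def)
qed

lemma p0: "wsummable (wt (\<rho> + \<sigma>)) p0" "real_l1 p0" "coef p0 0 = 0"
  unfolding p0_def by (intro wsummable_scaleR wsummable_power_wt r0 W cnj_twist_scaleR real_l1_power | simp add: coef_W_power_n)+

lemma b: "wsummable (wt \<rho>) b" "real_l1 b" "\<i> * frq p * coef b p = coef a p - (if p = 0 then of_real abar else 0)"
  using dinv[OF \<rho>(1) a(1)] dinv_real[OF \<rho>(1) a(1,2)] frq_nonzero[of p] a(3) by (auto simp: b_def frq)

lemma p1: "wsummable (wt \<rho>) p1" "real_l1 p1" "\<i> * frq p * coef p1 p = coef p0 p"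
  using dinv[OF \<rho>(1) p0(1)] dinv_real[OF \<rho>(1) p0(1,2)] frq_nonzero[of p] p0(3) by (auto simp: p1_def frq)

definition Ps :: "real \<Rightarrow> int \<times> int \<Rightarrow> complex" where
  "Ps \<epsilon> p = 1 / (1 + \<i> * of_real (\<epsilon> * frq p))"

definition Ds :: "real \<Rightarrow> int \<times> int \<Rightarrow> complex" where
  "Ds \<epsilon> p = \<i> * of_real (frq p) + of_real (\<epsilon> ^ n * abar) / (1 + \<i> * of_real (\<epsilon> * frq p))"

definition Ss :: "real \<Rightarrow> int \<times> int \<Rightarrow> complex" where
  "Ss \<epsilon> p = of_real (\<epsilon> ^ n) / Ds \<epsilon> p"

definition Es :: "real \<Rightarrow> int \<times> int \<Rightarrow> complex" where
  "Es \<epsilon> p = \<i> * of_real (frq p) / Ds \<epsilon> p"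

text \<open>Ensures \<epsilon>^n |abar| \<epsilon> \<le> 1/2, the smallness required by
  \<open>damped_symbol_bounds\<close>.\<close>

definition \<epsilon>1 :: real where "\<epsilon>1 = min 1 (1 / (2 * \<bar>abar\<bar>))"

lemma \<epsilon>1: "\<epsilon>1 > 0" using a(4) by (simp add: \<epsilon>1_def)

lemma norm_one_plus_ii: "norm (1 + \<i> * complex_of_real t) \<ge> 1"
  using abs_Re_le_cmod[of "1 + \<i> * complex_of_real t"] by simp

lemma one_plus_ii_nonzero: "1 + \<i> * complex_of_real t \<noteq> 0"
  "1 + \<i> * (complex_of_real t * complex_of_real u) \<noteq> 0"
  using norm_one_plus_ii[of t] norm_one_plus_ii[of "t * u"] by auto

context
  fixes \<epsilon> :: real
  assumes \<epsilon>: "0 < \<epsilon>" "\<epsilon> < \<epsilon>1"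
begin

lemma norm_Ps: "norm (Ps \<epsilon> p) \<le> 1"
  using norm_one_plus_ii[of "\<epsilon> * frq p"] by (simp add: Ps_def norm_divide divide_le_eq_1)

lemma Ds: "norm (Ds \<epsilon> p) \<ge> \<epsilon> ^ n * \<bar>abar\<bar> / 2" "norm (Ds \<epsilon> p) \<ge> \<bar>frq p\<bar> / 2" "Ds \<epsilon> p \<noteq> 0"
proof -
  have e: "\<epsilon> \<le> 1" "\<epsilon> \<le> 1 / (2 * \<bar>abar\<bar>)" using \<epsilon> by (auto simp: \<epsilon>1_def)
  have "\<bar>\<epsilon> ^ n * abar\<bar> * \<epsilon> \<le> 1 * \<bar>abar\<bar> * \<epsilon>"
    using \<epsilon> e power_le_one[of \<epsilon> n] by (simp add: abs_mult mult_right_mono mult_left_le_one_le)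
  also have "\<dots> \<le> 1 / 2" using e a(4) by (simp add: field_simps)
  finally have k: "\<bar>\<epsilon> ^ n * abar\<bar> * \<epsilon> \<le> 1 / 2" .
  show 1: "norm (Ds \<epsilon> p) \<ge> \<epsilon> ^ n * \<bar>abar\<bar> / 2" and "norm (Ds \<epsilon> p) \<ge> \<bar>frq p\<bar> / 2"
    using damped_symbol_bounds[OF \<epsilon>(1) k, of "frq p"] \<epsilon> by (simp_all add: Ds_def abs_mult)
  have "0 < \<epsilon> ^ n * \<bar>abar\<bar> / 2" using \<epsilon> a(4) by simp
  then show "Ds \<epsilon> p \<noteq> 0" using 1 by auto
qed

lemma norm_Ss: "norm (Ss \<epsilon> p) \<le> 2 / \<bar>abar\<bar>"
proof -
  have "0 < norm (Ds \<epsilon> p)" using Ds(3) by simp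
  then show ?thesis using Ds(1)[of p] \<epsilon> a(4) by (simp add: Ss_def norm_divide norm_power field_simps)
qed

lemma norm_Es: "norm (Es \<epsilon> p) \<le> 2"
proof -
  have "0 < norm (Ds \<epsilon> p)" using Ds(3) by simp
  then show ?thesis using Ds(2)[of p] by (simp add: Es_def norm_divide norm_mult field_simps)
qed

lemmas coef_P = coef_diag[of "Ps \<epsilon>", OF norm_Ps]
lemmas coef_S = coef_diag[of "Ss \<epsilon>", OF norm_Ss]
lemmas coef_E = coef_diag[of "Es \<epsilon>", OF norm_Es]

lemma symbol_cnj: "Ps \<epsilon> (- p) = cnj (Ps \<epsilon> p)" "Ss \<epsilon> (- p) = cnj (Ss \<epsilon> p)" "Es \<epsilon> (- p) = cnj (Es \<epsilon> p)"
  by (simp_all add: Ps_def Ss_def Es_def Ds_def frq)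

end

text \<open>The locale predicate involves the operators and the series but not the data W, b, p1,
  fd. This one instance therefore serves the original problem and all translated ones.\<close>

lemma scheme: "fixed_point_scheme (\<lambda>\<epsilon>. diag (Ps \<epsilon>)) (\<lambda>\<epsilon>. diag (Es \<epsilon>)) (\<lambda>\<epsilon>. diag (Ss \<epsilon>)) \<gamma> s (2 / \<bar>abar\<bar>) \<epsilon>1 n"
  unfolding fixed_point_scheme_def
proof (intro conjI allI impI)
  show "n > 0" using n by simp
  show "2 / \<bar>abar\<bar> > 0" using a(4) by simp
  have cP: "continuous_on {0<..<\<epsilon>1} (\<lambda>\<epsilon>. Ps \<epsilon> p)" for p
    unfolding Ps_def by (intro continuous_intros) (use one_plus_ii_nonzero in auto)
  have cD: "continuous_on {0<..<\<epsilon>1} (\<lambda>\<epsilon>. Ds \<epsilon> p)" for p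
    unfolding Ds_def by (intro continuous_intros) (use one_plus_ii_nonzero in auto)
  have cS: "continuous_on {0<..<\<epsilon>1} (\<lambda>\<epsilon>. Ss \<epsilon> p)" for p
    unfolding Ss_def by (intro continuous_intros cD) (use Ds(3) in auto)
  have cE: "continuous_on {0<..<\<epsilon>1} (\<lambda>\<epsilon>. Es \<epsilon> p)" for p
    unfolding Es_def by (intro continuous_intros cD) (use Ds(3) in auto)
  show "continuous_on {0<..<\<epsilon>1} (\<lambda>\<epsilon>. diag (Ps \<epsilon>) x)" for x :: "(int \<times> int) l1"
    by (rule continuous_on_diag[OF _ cP]) (use norm_Ps in auto)
  show "continuous_on {0<..<\<epsilon>1} (\<lambda>\<epsilon>. diag (Ss \<epsilon>) x)" for x :: "(int \<times> int) l1"
    by (rule continuous_on_diag[OF _ cS]) (use norm_Ss in auto)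
  show "continuous_on {0<..<\<epsilon>1} (\<lambda>\<epsilon>. diag (Es \<epsilon>) x)" for x :: "(int \<times> int) l1"
    by (rule continuous_on_diag[OF _ cE]) (use norm_Es in auto)
  fix \<epsilon> :: real and x :: "(int \<times> int) l1" assume e: "0 < \<epsilon>" "\<epsilon> < \<epsilon>1"
  show "bounded_linear (diag (Ps \<epsilon>) :: (int \<times> int) l1 \<Rightarrow> _)" by (rule bounded_linear_diag[OF norm_Ps[OF e]])
  show "bounded_linear (diag (Es \<epsilon>) :: (int \<times> int) l1 \<Rightarrow> _)" by (rule bounded_linear_diag[OF norm_Es[OF e]])
  show "bounded_linear (diag (Ss \<epsilon>) :: (int \<times> int) l1 \<Rightarrow> _)" by (rule bounded_linear_diag[OF norm_Ss[OF e]])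
  show "norm (diag (Ps \<epsilon>) x) \<le> norm x" using norm_diag_le[OF norm_Ps[OF e]] by simp
  show "norm (diag (Es \<epsilon>) x) \<le> 2 * norm x" by (rule norm_diag_le[OF norm_Es[OF e]])
  show "norm (diag (Ss \<epsilon>) x) \<le> 2 / \<bar>abar\<bar> * norm x" by (rule norm_diag_le[OF norm_Ss[OF e]])
qed (use s \<epsilon>1 \<gamma> in auto)

end

section \<open>The branch of solutions\<close>

context response_setting
begin

abbreviation \<Phi>w where
  "\<Phi>w W' b' p' fd' \<equiv> fixed_point_scheme.\<Phi> W' b' p' fd' (\<lambda>\<epsilon>. diag (Ps \<epsilon>)) (\<lambda>\<epsilon>. diag (Es \<epsilon>)) (\<lambda>\<epsilon>. diag (Ss \<epsilon>)) \<gamma> n"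

abbreviation Yw where
  "Yw W' b' p' fd' \<equiv> fixed_point_scheme.Yf W' b' p' fd' (\<lambda>\<epsilon>. diag (Ps \<epsilon>)) (\<lambda>\<epsilon>. diag (Ss \<epsilon>)) n"

abbreviation \<Gamma>w :: "real \<Rightarrow> (int \<times> int) l1 \<Rightarrow> (int \<times> int) l1" where
  "\<Gamma>w \<equiv> fixed_point_scheme.\<Gamma> \<gamma> n"

lemmas \<Phi>w_def = fixed_point_scheme.\<Phi>_def[OF scheme]
lemmas Yw_def = fixed_point_scheme.Yf_def[OF scheme]
lemmas \<Gamma>w_def = fixed_point_scheme.\<Gamma>_def[OF scheme]

definition branch where
  "branch W' b' p' fd' \<epsilon>0 r \<longleftrightarrow> 0 < \<epsilon>0 \<and> \<epsilon>0 \<le> \<epsilon>1 \<and> 2 * \<epsilon>0 * (norm W' + 1) \<le> s \<and>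
    (\<forall>\<epsilon>\<in>{0<..<\<epsilon>0}. \<Phi>w W' b' p' fd' \<epsilon> (r \<epsilon>) = r \<epsilon> \<and>
      (\<lambda>k. (\<Phi>w W' b' p' fd' \<epsilon> ^^ k) 0) \<longlonglongrightarrow> r \<epsilon> \<and>
      (\<forall>k. norm (Yw W' b' p' fd' \<epsilon> ((\<Phi>w W' b' p' fd' \<epsilon> ^^ k) 0)) \<le> norm W' + 1) \<and>
      norm (Yw W' b' p' fd' \<epsilon> (r \<epsilon>)) \<le> norm W' + 1) \<and>
    continuous_on {0<..<\<epsilon>0} (\<lambda>\<epsilon>. Yw W' b' p' fd' \<epsilon> (r \<epsilon>))"

lemma branch_exists: "\<exists>\<epsilon>0 r. branch W' b' p' fd' \<epsilon>0 r"
  by (rule fixed_point_scheme.fixed_point_branch[OF scheme, of W' b' p' fd']) (unfold branch_def, blast)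

text \<open>Every operation of the scheme respects conjugation and translation: the multipliers
  because their symbols at p and -p are conjugate, products because w is multiplicative. The norm
  bounds serve to sum \<Gamma> term by term.\<close>

lemma \<Phi>w_twist:
  fixes W' b' p' fd' W'' b'' p'' fd'' r r' :: "(int \<times> int) l1"
  assumes w: "\<And>p q. w (p + q) = w p * w q" "w 0 = 1"
    and tw: "cnj_twist w W' W''" "cnj_twist w b' b''" "cnj_twist w p' p''" "cnj_twist w fd' fd''" "cnj_twist w r r'"
    and \<epsilon>: "0 < \<epsilon>" "\<epsilon> < \<epsilon>1" "2 * \<epsilon> * (norm W' + 1) \<le> s" "2 * \<epsilon> * (norm W'' + 1) \<le> s"
    and Y: "norm (Yw W' b' p' fd' \<epsilon> r) \<le> norm W' + 1" "norm (Yw W'' b'' p'' fd'' \<epsilon> r') \<le> norm W'' + 1"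
  shows "cnj_twist w (Yw W' b' p' fd' \<epsilon> r) (Yw W'' b'' p'' fd'' \<epsilon> r')"
    and "cnj_twist w (\<Phi>w W' b' p' fd' \<epsilon> r) (\<Phi>w W'' b'' p'' fd'' \<epsilon> r')"
proof -
  note cs = symbol_cnj[OF \<epsilon>(1,2)]
  note dP = cnj_twist_diag[where m = "Ps \<epsilon>", OF norm_Ps[OF \<epsilon>(1,2)] cs(1)]
  note dS = cnj_twist_diag[where m = "Ss \<epsilon>", OF norm_Ss[OF \<epsilon>(1,2)] cs(2)]
  note dE = cnj_twist_diag[where m = "Es \<epsilon>", OF norm_Es[OF \<epsilon>(1,2)] cs(3)]
  show Yt: "cnj_twist w (Yw W' b' p' fd' \<epsilon> r) (Yw W'' b'' p'' fd'' \<epsilon> r')"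
    unfolding Yw_def by (intro cnj_twist_add cnj_twist_diff cnj_twist_scaleR dP dS cnj_twist_mult[OF w(1)] tw)
  have "cnj_twist w (\<Gamma>w \<epsilon> (Yw W' b' p' fd' \<epsilon> r)) (\<Gamma>w \<epsilon> (Yw W'' b'' p'' fd'' \<epsilon> r'))"
    unfolding \<Gamma>w_def
    by (intro cnj_twist_suminf cnj_twist_scaleR cnj_twist_power[OF w] Yt
        fixed_point_scheme.\<Gamma>_summable[OF scheme _ \<epsilon>(3) Y(1)] fixed_point_scheme.\<Gamma>_summable[OF scheme _ \<epsilon>(4) Y(2)])
       (use \<epsilon> in auto)
  then show "cnj_twist w (\<Phi>w W' b' p' fd' \<epsilon> r) (\<Phi>w W'' b'' p'' fd'' \<epsilon> r')"
    unfolding \<Phi>w_def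
    by (intro cnj_twist_add cnj_twist_diff cnj_twist_scaleR dP dS dE cnj_twist_mult[OF w(1)] cnj_twist_power[OF w] tw)
qed

text \<open>Uniqueness of the fixed point does not give this directly, as the translate of r
  \<epsilon> is not known to be summable beforehand. The two Picard sequences, both started at 0,
  are related at every stage, and the relation passes to the limits coefficientwise.\<close>

lemma branch_twist:
  assumes w: "\<And>p q. w (p + q) = w p * w q" "w 0 = 1"
    and tw: "cnj_twist w W' W''" "cnj_twist w b' b''" "cnj_twist w p' p''" "cnj_twist w fd' fd''"
    and br: "branch W' b' p' fd' e r" "branch W'' b'' p'' fd'' e' r'"
    and \<epsilon>: "0 < \<epsilon>" "\<epsilon> < e" "\<epsilon> < e'"
  shows "cnj_twist w (Yw W' b' p' fd' \<epsilon> (r \<epsilon>)) (Yw W'' b'' p'' fd'' \<epsilon> (r' \<epsilon>))"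
proof -
  have small: "2 * \<epsilon> * (norm W' + 1) \<le> s" "2 * \<epsilon> * (norm W'' + 1) \<le> s" "\<epsilon> < \<epsilon>1"
  proof -
    have "2 * \<epsilon> * (norm W' + 1) \<le> 2 * e * (norm W' + 1)" "2 * \<epsilon> * (norm W'' + 1) \<le> 2 * e' * (norm W'' + 1)"
      using \<epsilon> by (intro mult_right_mono, auto)+
    then show "2 * \<epsilon> * (norm W' + 1) \<le> s" "2 * \<epsilon> * (norm W'' + 1) \<le> s" "\<epsilon> < \<epsilon>1"
      using br \<epsilon> by (auto simp: branch_def)
  qed
  have m: "\<epsilon> \<in> {0<..<e}" "\<epsilon> \<in> {0<..<e'}" using \<epsilon> by auto
  have it: "cnj_twist w ((\<Phi>w W' b' p' fd' \<epsilon> ^^ k) 0) ((\<Phi>w W'' b'' p'' fd'' \<epsilon> ^^ k) 0)" for k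
  proof (induction k)
    case (Suc k)
    show ?case
      unfolding funpow.simps o_apply
      by (rule \<Phi>w_twist[OF w tw Suc \<epsilon>(1) small(3,1,2)]) (use br m in \<open>auto simp: branch_def\<close>)
  qed (simp add: cnj_twist_zero)
  have "cnj_twist w (r \<epsilon>) (r' \<epsilon>)"
    by (rule cnj_twist_LIMSEQ[OF it]) (use br m in \<open>auto simp: branch_def\<close>)
  then show ?thesis
    by (rule \<Phi>w_twist(1)[OF w tw _ \<epsilon>(1) small(3,1,2)]) (use br m in \<open>auto simp: branch_def\<close>)
qed

lemmas sc = scaleR_conv_of_real[where 'a = complex]

text \<open>The frequency is additive in the index, so the multiplier is a derivation. The
  derivatives are passed as elements of \<open>l1\<close>, which makes the products on the right
  summable.\<close>

lemma Leibniz: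
  assumes "\<And>p. \<i> * frq p * coef x p = coef x' p" "\<And>p. \<i> * frq p * coef y p = coef y' p"
  shows "\<i> * frq p * coef (x * y) p = coef (x' * y + x * y') p"
proof -
  have "\<i> * frq p * coef (x * y) p = (\<Sum>\<^sub>\<infinity>j. \<i> * frq p * (coef x j * coef y (p - j)))"
    unfolding coef_mult conv_def by (rule infsum_cmult_right'[symmetric])
  also have "\<dots> = (\<Sum>\<^sub>\<infinity>j. coef x' j * coef y (p - j) + coef x j * coef y' (p - j))"
  proof (rule infsum_cong)
    fix j
    have "frq p = frq j + frq (p - j)" using frq(1)[of j "p - j"] by simp
    then show "\<i> * frq p * (coef x j * coef y (p - j)) = coef x' j * coef y (p - j) + coef x j * coef y' (p - j)"
      unfolding assms[symmetric] by (simp add: algebra_simps)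
  qed
  also have "\<dots> = coef (x' * y + x * y') p"
    unfolding coef_add coef_mult conv_def
    by (rule infsum_add) (auto intro: Infinite_Sum.abs_summable_summable[OF conv_terms_summable])
  finally show ?thesis .
qed

text \<open>The substitution read backwards; \<open>v\<close> is S applied to the fixed point and
  \<open>v'\<close> is its derivative. Differentiating b v gives a v - abar v + b v'; the term with
  \<open>abar\<close> joins v' to form \<epsilon>^n times the fixed point, and inserting the fixed
  point equation leaves only \<Gamma>. Multiplying by the inverse of P restores the second order
  operator.\<close>

lemma fixed_point_equation:
  assumes br: "branch W b p1 fd e r" and \<epsilon>: "0 < \<epsilon>" "\<epsilon> < e"
  defines "Y \<equiv> Yw W b p1 fd \<epsilon> (r \<epsilon>)"
  shows "\<i> * frq p * (1 + \<i> * of_real (\<epsilon> * frq p)) * coef Y p = fh p - \<epsilon> ^ n * coef (\<Gamma>w \<epsilon> Y) p"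
proof -
  have e1: "\<epsilon> < \<epsilon>1" using br \<epsilon> by (auto simp: branch_def)
  note cP = coef_P[OF \<epsilon>(1) e1] and cS = coef_S[OF \<epsilon>(1) e1] and cE = coef_E[OF \<epsilon>(1) e1]
  note D0 = Ds(3)[OF \<epsilon>(1) e1]
  define v where "v = diag (Ss \<epsilon>) (r \<epsilon>)"
  define R where "R = r \<epsilon>"
  define v' where "v' = \<epsilon> ^ n *\<^sub>R diag (Es \<epsilon>) R"
  have q0: "1 + \<i> * of_real (\<epsilon> * frq p) \<noteq> 0" for p by (rule one_plus_ii_nonzero)
  have dv: "\<i> * frq p * coef v p = coef v' p" for p
    by (simp add: v_def v'_def R_def cS cE Ss_def Es_def sc)
  have Sv: "\<i> * frq p * coef v p + \<epsilon> ^ n * abar * Ps \<epsilon> p * coef v p = \<epsilon> ^ n * coef R p" for p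
  proof -
    have "\<i> * frq p * coef v p + \<epsilon> ^ n * abar * Ps \<epsilon> p * coef v p = Ds \<epsilon> p * Ss \<epsilon> p * coef R p"
      by (simp add: v_def R_def cS Ds_def Ps_def algebra_simps)
    then show ?thesis using D0[of p] by (simp add: Ss_def)
  qed
  have bv: "\<i> * frq p * coef (b * v) p = coef (a * v) p - abar * coef v p + coef (b * v') p" for p
  proof -
    have "\<i> * frq p * coef b p = coef (a - abar *\<^sub>R 1) p" for p
      using b(3)[of p] by (simp add: sc)
    from Leibniz[OF this dv] show ?thesis by (simp add: left_diff_distrib sc)
  qed
  have Y: "coef Y p = coef W p + (coef v p - \<epsilon> ^ n * (Ps \<epsilon> p * (coef p1 p + coef (b * v) p))) - \<epsilon> * (Ps \<epsilon> p * fh p)"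
    unfolding Y_def Yw_def by (simp add: v_def[symmetric] cP coef_fd sc)
  have "\<Phi>w W b p1 fd \<epsilon> R = R" using br \<epsilon> by (simp add: branch_def R_def)
  then have "coef R p = coef (\<Phi>w W b p1 fd \<epsilon> R) p" by simp
  also have "\<dots> = Ps \<epsilon> p * (coef (b * v') p + coef p0 p + coef (a * v) p - coef (\<Gamma>w \<epsilon> Y) p)"
    unfolding \<Phi>w_def by (simp add: R_def Y_def[symmetric] cP p0_def a_def v_def[symmetric] v'_def)
  finally have R: "coef R p = Ps \<epsilon> p * (coef (b * v') p + coef p0 p + coef (a * v) p - coef (\<Gamma>w \<epsilon> Y) p)" .
  have "\<i> * frq p * coef Y p = \<i> * frq p * coef W p + (\<i> * frq p * coef v p
      - \<epsilon> ^ n * (Ps \<epsilon> p * (\<i> * frq p * coef p1 p + \<i> * frq p * coef (b * v) p))) - \<epsilon> * (Ps \<epsilon> p * (\<i> * frq p * fh p))"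
    unfolding Y by (simp add: algebra_simps)
  also have "\<dots> = fh p - \<epsilon> * (Ps \<epsilon> p * (\<i> * frq p * fh p)) + (\<i> * frq p * coef v p + \<epsilon> ^ n * abar * Ps \<epsilon> p * coef v p)
      - \<epsilon> ^ n * (Ps \<epsilon> p * (coef p0 p + coef (a * v) p + coef (b * v') p))"
    unfolding W(4) p1(3) bv by (simp add: algebra_simps)
  also have "\<dots> = fh p - \<epsilon> * (Ps \<epsilon> p * (\<i> * frq p * fh p)) - \<epsilon> ^ n * (Ps \<epsilon> p * coef (\<Gamma>w \<epsilon> Y) p)"
    unfolding Sv R by (simp add: algebra_simps)
  \<comment> \<open>This is 1 - \<epsilon> \<partial> P = P, the purpose of the term with P fd in
    \<open>Yf\<close>.\<close>
  also have "fh p - \<epsilon> * (Ps \<epsilon> p * (\<i> * frq p * fh p)) = Ps \<epsilon> p * fh p"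
    using q0[of p] by (simp add: Ps_def field_simps)
  finally have "\<i> * frq p * coef Y p = Ps \<epsilon> p * (fh p - \<epsilon> ^ n * coef (\<Gamma>w \<epsilon> Y) p)" by (simp add: algebra_simps)
  then have "(1 + \<i> * of_real (\<epsilon> * frq p)) * (\<i> * frq p * coef Y p)
      = ((1 + \<i> * of_real (\<epsilon> * frq p)) * Ps \<epsilon> p) * (fh p - \<epsilon> ^ n * coef (\<Gamma>w \<epsilon> Y) p)"
    by (simp only: mult.assoc)
  also have "(1 + \<i> * of_real (\<epsilon> * frq p)) * Ps \<epsilon> p = 1" using q0[of p] by (simp add: Ps_def)
  finally show ?thesis by (simp add: mult_ac)
qed

section \<open>Translation to the corners\<close>

text \<open>The factor that the mode p acquires under translation by \<i> h.\<close>

definition wc :: "real \<times> real \<Rightarrow> int \<times> int \<Rightarrow> complex" where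
  "wc h p = of_real (exp (- (fst h * of_int (fst p) + snd h * of_int (snd p))))"

definition corners :: "(real \<times> real) set" where
  "corners = {(\<rho>, \<rho>), (\<rho>, - \<rho>), (- \<rho>, \<rho>), (- \<rho>, - \<rho>)}"

lemma wc: "wc h (p + q) = wc h p * wc h q" "wc h 0 = 1"
  by (auto simp: wc_def algebra_simps exp_add[symmetric] simp flip: of_real_mult)

lemma norm_wc_le: "h \<in> corners \<Longrightarrow> norm (wc h p) \<le> wt \<rho> p"
proof -
  assume h: "h \<in> corners"
  have "- (fst h * of_int (fst p) + snd h * of_int (snd p)) \<le> \<bar>fst h\<bar> * \<bar>of_int (fst p)\<bar> + \<bar>snd h\<bar> * \<bar>of_int (snd p)\<bar>"
    unfolding abs_mult[symmetric] by linarith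
  also have "\<dots> = \<rho> * len p" using h \<rho> by (auto simp: corners_def len_def distrib_left)
  finally show ?thesis by (simp add: wc_def wt_def)
qed

text \<open>The exponential weight at p is attained at the corner whose signs are opposite to those
  of p. Hence the weighted norm is at most the sum of the norms of the four translates.\<close>

lemma wt_le_wc: obtains h where "h \<in> corners" "wt \<rho> p = norm (wc h p)"
proof -
  define h where "h = ((if fst p \<ge> 0 then - \<rho> else \<rho>), (if snd p \<ge> 0 then - \<rho> else \<rho>))"
  show ?thesis
    by (rule that[of h]) (auto simp: h_def corners_def wc_def wt_def len_def algebra_simps)
qed

text \<open>Conjugation composed with translation by \<i> h, the form that matches
  \<open>cnj_twist\<close>. On a real x it multiplies the coefficient of index p by
  \<open>wc h p\<close>.\<close>

definition tw :: "real \<times> real \<Rightarrow> (int \<times> int) l1 \<Rightarrow> (int \<times> int) l1" where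
  "tw h x = Abs_l1 (\<lambda>p. wc h p * cnj (coef x (- p)))"

lemma cnj_twist_tw:
  assumes "h \<in> corners" "wsummable (wt \<rho>) x"
  shows "cnj_twist (wc h) x (tw h x)"
proof -
  have s: "(\<lambda>p. norm (coef x (- p)) * wt \<rho> (- p)) summable_on UNIV"
    using assms(2) summable_on_reindex_bij_betw[OF bij_uminus, of "\<lambda>p. norm (coef x p) * wt \<rho> p"]
    by (simp add: wsummable_def)
  have "(\<lambda>p. wc h p * cnj (coef x (- p))) abs_summable_on UNIV"
  proof (rule summable_on_comparison_test[OF s])
    show "norm (wc h p * cnj (coef x (- p))) \<le> norm (coef x (- p)) * wt \<rho> (- p)" for p
      using mult_right_mono[OF norm_wc_le[OF assms(1), of p], of "norm (coef x (- p))"]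
      by (simp add: norm_mult wt_def len mult.commute)
  qed auto
  then show ?thesis by (simp add: cnj_twist_def tw_def coef_Abs_l1)
qed

lemma scaled_series:
  assumes "0 < \<epsilon>" "2 * \<epsilon> * R \<le> s" "norm Y \<le> R"
  shows "summable (\<lambda>j. \<gamma> j *\<^sub>R (\<epsilon> *\<^sub>R Y) ^ (n + j))"
    and "(\<Sum>j. \<gamma> j *\<^sub>R (\<epsilon> *\<^sub>R Y) ^ (n + j)) = \<epsilon> ^ n *\<^sub>R \<Gamma>w \<epsilon> Y"
proof -
  have sm: "summable (\<lambda>j. (\<gamma> j * \<epsilon> ^ j) *\<^sub>R Y ^ (n + j))"
    by (rule fixed_point_scheme.\<Gamma>_summable[OF scheme]) (use assms in auto)
  have eq: "\<gamma> j *\<^sub>R (\<epsilon> *\<^sub>R Y) ^ (n + j) = \<epsilon> ^ n *\<^sub>R ((\<gamma> j * \<epsilon> ^ j) *\<^sub>R Y ^ (n + j))" for j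
    by (simp add: scaleR_power power_add mult_ac)
  show "summable (\<lambda>j. \<gamma> j *\<^sub>R (\<epsilon> *\<^sub>R Y) ^ (n + j))" unfolding eq by (rule summable_scaleR_right[OF sm])
  show "(\<Sum>j. \<gamma> j *\<^sub>R (\<epsilon> *\<^sub>R Y) ^ (n + j)) = \<epsilon> ^ n *\<^sub>R \<Gamma>w \<epsilon> Y"
    unfolding eq \<Gamma>w_def by (rule suminf_scaleR_right[OF sm, symmetric])
qed

text \<open>\<open>Z h\<close> is the translate of X to a corner. Its existence in \<open>l1\<close>
  controls X on the closed strip, and its continuity in \<epsilon> gives continuity of X uniformly
  there. The original branch and the corner branches have thresholds of their own; the least of them
  is common to all.\<close>

lemma response_branch:
  obtains \<epsilon>0 M :: real and X :: "real \<Rightarrow> (int \<times> int) l1" and Z :: "real \<times> real \<Rightarrow> real \<Rightarrow> (int \<times> int) l1"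
  where "\<epsilon>0 > 0"
    and "\<And>\<epsilon>. 0 < \<epsilon> \<Longrightarrow> \<epsilon> < \<epsilon>0 \<Longrightarrow> real_l1 (X \<epsilon>)"
    and "\<And>\<epsilon>. 0 < \<epsilon> \<Longrightarrow> \<epsilon> < \<epsilon>0 \<Longrightarrow> summable (\<lambda>j. \<gamma> j *\<^sub>R X \<epsilon> ^ (n + j))"
    and "\<And>\<epsilon> p. 0 < \<epsilon> \<Longrightarrow> \<epsilon> < \<epsilon>0 \<Longrightarrow> \<i> * frq p * (1 + \<i> * of_real (\<epsilon> * frq p)) * coef (X \<epsilon>) p
        = \<epsilon> * (fh p - coef (\<Sum>j. \<gamma> j *\<^sub>R X \<epsilon> ^ (n + j)) p)"
    and "\<And>\<epsilon>. 0 < \<epsilon> \<Longrightarrow> \<epsilon> < \<epsilon>0 \<Longrightarrow> norm (X \<epsilon>) \<le> \<epsilon> * M"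
    and "\<And>\<epsilon> h p. 0 < \<epsilon> \<Longrightarrow> \<epsilon> < \<epsilon>0 \<Longrightarrow> h \<in> corners \<Longrightarrow> coef (Z h \<epsilon>) p = wc h p * coef (X \<epsilon>) p"
    and "\<And>\<epsilon> h. 0 < \<epsilon> \<Longrightarrow> \<epsilon> < \<epsilon>0 \<Longrightarrow> h \<in> corners \<Longrightarrow> norm (Z h \<epsilon>) \<le> \<epsilon> * M"
    and "\<And>h. h \<in> corners \<Longrightarrow> continuous_on {0<..<\<epsilon>0} (Z h)"
proof -
  obtain e r where br: "branch W b p1 fd e r" using branch_exists by blast
  obtain e' r' where br': "\<And>h. branch (tw h W) (tw h b) (tw h p1) (tw h fd) (e' h) (r' h)"
  proof -
    have "\<forall>h. \<exists>q. branch (tw h W) (tw h b) (tw h p1) (tw h fd) (fst q) (snd q)"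
      using branch_exists by simp
    from choice[OF this] obtain q where "\<And>h. branch (tw h W) (tw h b) (tw h p1) (tw h fd) (fst (q h)) (snd (q h))"
      by blast
    then show ?thesis by (rule that[of "\<lambda>h. fst (q h)" "\<lambda>h. snd (q h)"])
  qed
  define Yh where "Yh = (\<lambda>h \<epsilon>. Yw (tw h W) (tw h b) (tw h p1) (tw h fd) \<epsilon> (r' h \<epsilon>))"
  define Y where "Y = (\<lambda>\<epsilon>. Yw W b p1 fd \<epsilon> (r \<epsilon>))"
  define \<epsilon>0 where "\<epsilon>0 = Min (insert e (e' ` corners))"
  define M where "M = Max (insert (norm W + 1) ((\<lambda>h. norm (tw h W) + 1) ` corners))"
  have fin: "finite corners" by (simp add: corners_def)
  have e0: "\<epsilon>0 > 0" using br br' fin by (auto simp: \<epsilon>0_def branch_def)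
  have le: "\<epsilon>0 \<le> e" "h \<in> corners \<Longrightarrow> \<epsilon>0 \<le> e' h" for h
    using fin by (auto simp: \<epsilon>0_def)
  have Mle: "norm W + 1 \<le> M" "h \<in> corners \<Longrightarrow> norm (tw h W) + 1 \<le> M" for h
    using fin by (auto simp: M_def)
  have tws: "cnj_twist (wc h) W (tw h W)" "cnj_twist (wc h) b (tw h b)" "cnj_twist (wc h) p1 (tw h p1)"
    "cnj_twist (wc h) fd (tw h fd)" if "h \<in> corners" for h
    using W(1) b(1) p1(1) fd(1) \<sigma> by (auto intro!: cnj_twist_tw[OF that] elim: wsummable_wt_mono[rotated])
  have Yreal: "real_l1 (Y \<epsilon>)" if "0 < \<epsilon>" "\<epsilon> < \<epsilon>0" for \<epsilon>
    unfolding Y_def by (rule branch_twist[OF _ _ W(2) b(2) p1(2) fd(2) br br]) (use that le in auto)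
  have Ytw: "coef (Yh h \<epsilon>) p = wc h p * coef (Y \<epsilon>) p" if "0 < \<epsilon>" "\<epsilon> < \<epsilon>0" "h \<in> corners" for \<epsilon> h p
  proof -
    have "cnj_twist (wc h) (Y \<epsilon>) (Yh h \<epsilon>)"
      unfolding Y_def Yh_def by (rule branch_twist[OF wc tws[OF that(3)] br br']) (use that le(1) le(2)[OF that(3)] in auto)
    then show ?thesis using Yreal[OF that(1,2)] unfolding cnj_twist_def by (metis mult_1)
  qed
  have Yn: "norm (Y \<epsilon>) \<le> norm W + 1" if "0 < \<epsilon>" "\<epsilon> < \<epsilon>0" for \<epsilon>
    using br that le by (auto simp: branch_def Y_def)
  have Yhn: "norm (Yh h \<epsilon>) \<le> norm (tw h W) + 1" if "0 < \<epsilon>" "\<epsilon> < \<epsilon>0" "h \<in> corners" for \<epsilon> h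
    using br'[of h] that le(2)[OF that(3)] by (auto simp: branch_def Yh_def)
  have small: "2 * \<epsilon> * (norm W + 1) \<le> s" if "0 < \<epsilon>" "\<epsilon> < \<epsilon>0" for \<epsilon>
  proof -
    have "2 * \<epsilon> * (norm W + 1) \<le> 2 * e * (norm W + 1)" using that le by (intro mult_right_mono) auto
    then show ?thesis using br by (auto simp: branch_def)
  qed
  show ?thesis
  proof (rule that[of \<epsilon>0 "\<lambda>\<epsilon>. \<epsilon> *\<^sub>R Y \<epsilon>" M "\<lambda>h \<epsilon>. \<epsilon> *\<^sub>R Yh h \<epsilon>"])
    show "continuous_on {0<..<\<epsilon>0} (\<lambda>\<epsilon>. \<epsilon> *\<^sub>R Yh h \<epsilon>)" if "h \<in> corners" for h
    proof -
      have "continuous_on {0<..<\<epsilon>0} (Yh h)"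
        using br'[of h] le(2)[OF that] unfolding branch_def Yh_def by (auto elim!: continuous_on_subset)
      then show ?thesis by (intro continuous_intros)
    qed
    fix \<epsilon> assume \<epsilon>: "0 < \<epsilon>" "\<epsilon> < \<epsilon>0"
    show "real_l1 (\<epsilon> *\<^sub>R Y \<epsilon>)" by (rule cnj_twist_scaleR[OF Yreal[OF \<epsilon>]])
    note ss = scaled_series[OF \<epsilon>(1) small[OF \<epsilon>] Yn[OF \<epsilon>]]
    show "summable (\<lambda>j. \<gamma> j *\<^sub>R (\<epsilon> *\<^sub>R Y \<epsilon>) ^ (n + j))" by (rule ss)
    show "\<i> * frq p * (1 + \<i> * of_real (\<epsilon> * frq p)) * coef (\<epsilon> *\<^sub>R Y \<epsilon>) p
        = \<epsilon> * (fh p - coef (\<Sum>j. \<gamma> j *\<^sub>R (\<epsilon> *\<^sub>R Y \<epsilon>) ^ (n + j)) p)" for p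
    proof -
      have "\<epsilon> < e" using \<epsilon> le by simp
      then have "\<i> * frq p * (1 + \<i> * of_real (\<epsilon> * frq p)) * coef (Y \<epsilon>) p = fh p - \<epsilon> ^ n * coef (\<Gamma>w \<epsilon> (Y \<epsilon>)) p"
        using fixed_point_equation[OF br \<epsilon>(1), of p] by (simp add: Y_def)
      then show ?thesis unfolding ss(2) by (simp add: sc mult_ac)
    qed
    show "norm (\<epsilon> *\<^sub>R Y \<epsilon>) \<le> \<epsilon> * M" using Yn[OF \<epsilon>] Mle(1) \<epsilon> by (simp add: mult_left_mono)
    show "coef (\<epsilon> *\<^sub>R Yh h \<epsilon>) p = wc h p * coef (\<epsilon> *\<^sub>R Y \<epsilon>) p" if "h \<in> corners" for h p
      using Ytw[OF \<epsilon> that] by simp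
    show "norm (\<epsilon> *\<^sub>R Yh h \<epsilon>) \<le> \<epsilon> * M" if "h \<in> corners" for h
      using Yhn[OF \<epsilon> that] Mle(2)[OF that] \<epsilon> by (simp add: mult_left_mono)
  qed (rule e0)
qed

end

section \<open>The differential equation\<close>

lemma has_sum_sum:
  fixes f :: "'i \<Rightarrow> 'a \<Rightarrow> 'b::topological_comm_monoid_add"
  assumes "finite I" "\<And>i. i \<in> I \<Longrightarrow> (f i has_sum S i) A"
  shows "((\<lambda>x. \<Sum>i\<in>I. f i x) has_sum (\<Sum>i\<in>I. S i)) A"
  using assms by (induction I) (auto intro: has_sum_add)

section \<open>Taylor expansion at the zero\<close>

lemma has_fps_expansion_real_deriv:
  fixes f :: "real \<Rightarrow> real"
  assumes "f has_fps_expansion G"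
  shows "deriv f has_fps_expansion fps_deriv G"
proof -
  have r: "fps_conv_radius G > 0" and ev: "\<forall>\<^sub>F z in nhds 0. eval_fps G z = f z"
    using assms by (auto simp: has_fps_expansion_def)
  have "\<forall>\<^sub>F z in nhds 0. z \<in> eball (0::real) (fps_conv_radius G)"
    by (rule eventually_nhds_in_open) (use r in \<open>auto simp: zero_ereal_def\<close>)
  moreover have "\<forall>\<^sub>F z in nhds 0. \<forall>\<^sub>F w in nhds z. eval_fps G w = f w"
    using ev by (subst eventually_eventually)
  ultimately have "\<forall>\<^sub>F z in nhds 0. eval_fps (fps_deriv G) z = deriv f z"
  proof eventually_elim
    case (elim z)
    have "(eval_fps G has_field_derivative eval_fps (fps_deriv G) z) (at z)"
      by (rule has_field_derivative_eval_fps) (use elim in \<open>simp add: in_eball_iff dist_norm\<close>)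
    then have "(f has_field_derivative eval_fps (fps_deriv G) z) (at z)"
      using DERIV_cong_ev[OF refl elim(2) refl] by blast
    then show ?case by (simp add: DERIV_imp_deriv)
  qed
  moreover have "fps_conv_radius (fps_deriv G) > 0"
    using r fps_conv_radius_deriv[of G] by (rule less_le_trans)
  ultimately show ?thesis by (simp add: has_fps_expansion_def)
qed

lemma has_fps_expansion_real_higher_deriv:
  fixes f :: "real \<Rightarrow> real"
  assumes "f has_fps_expansion G"
  shows "(deriv ^^ j) f 0 = fact j * fps_nth G j"
  using assms
proof (induction j arbitrary: f G)
  case 0
  then have "\<forall>\<^sub>F z in nhds 0. eval_fps G z = f z" by (simp add: has_fps_expansion_def)
  then have "eval_fps G 0 = f 0" by (rule eventually_nhds_x_imp_x)
  then show ?case by (simp add: eval_fps_at_0)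
next
  case (Suc j)
  show ?case
    using Suc.IH[OF has_fps_expansion_real_deriv[OF Suc.prems]]
    by (simp add: funpow_Suc_right del: funpow.simps)
qed

lemma higher_deriv_shift:
  fixes g :: "real \<Rightarrow> real"
  shows "(deriv ^^ j) (\<lambda>h. g (c + h)) = (\<lambda>h. (deriv ^^ j) g (c + h))"
proof (induction j)
  case (Suc j)
  have "deriv (\<lambda>h. k (c + h)) = (\<lambda>h. deriv k (c + h))" for k :: "real \<Rightarrow> real"
    unfolding deriv_def using DERIV_shift[of k _ _ c] by (simp add: add.commute)
  then show ?case using Suc by simp
qed simp

text \<open>The radius s is chosen inside both the disc of convergence and the interval on which the
  series represents g, with absolute convergence at s itself, so that the series may be evaluated in
  \<open>l1\<close> at elements of norm below s.\<close>

lemma zero_of_order_expansion: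
  assumes g: "real_analytic_on g A" "c \<in> A" and z: "zero_of_order g f0 c n" and n: "n > 0"
  obtains \<gamma> :: "nat \<Rightarrow> real" and s where "s > 0" "\<gamma> 0 \<noteq> 0" "summable (\<lambda>j. \<bar>\<gamma> j\<bar> * s ^ j)"
    "\<And>h. \<bar>h\<bar> < s \<Longrightarrow> (\<lambda>j. \<gamma> j * h ^ (n + j)) sums (g (c + h) - f0)"
proof -
  obtain G where G: "(\<lambda>h. g (c + h)) has_fps_expansion G"
    using g by (auto simp: real_analytic_on_def)
  have coeff: "fact j * fps_nth G j = (deriv ^^ j) g c" for j
    using has_fps_expansion_real_higher_deriv[OF G, of j] by (simp add: higher_deriv_shift)
  have G0: "fps_nth G 0 = f0" using coeff[of 0] z by (simp add: zero_of_order_def)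
  have Gj: "fps_nth G j = 0" if "0 < j" "j < n" for j
    using coeff[of j] z that by (simp add: zero_of_order_def)
  have Gn: "fps_nth G n \<noteq> 0" using coeff[of n] z by (auto simp: zero_of_order_def)
  have r: "fps_conv_radius G > 0" and ev: "\<forall>\<^sub>F h in nhds 0. eval_fps G h = g (c + h)"
    using G by (auto simp: has_fps_expansion_def)
  obtain d where d: "d > 0" "\<And>h. \<bar>h\<bar> < d \<Longrightarrow> eval_fps G h = g (c + h)"
    using ev unfolding eventually_nhds_metric by (auto simp: dist_real_def)
  obtain s0 where s0: "0 < ereal s0" "ereal s0 < fps_conv_radius G" using ereal_dense2[OF r] by auto
  define s where "s = min d s0"
  have s: "s > 0" "s \<le> d" "ereal s < fps_conv_radius G"
    using d s0 le_less_trans[of "ereal s" "ereal s0"] by (auto simp: s_def)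
  have sm: "summable (\<lambda>j. \<bar>fps_nth G j\<bar> * s ^ j)"
  proof -
    have "summable (\<lambda>j. norm (fps_nth G j * s ^ j))"
      using s by (intro abs_summable_in_conv_radius) (simp add: fps_conv_radius_def)
    then show ?thesis using s by (simp add: abs_mult)
  qed
  show ?thesis
  proof (rule that[of s "\<lambda>j. fps_nth G (n + j)"])
    show "s > 0" by (rule s)
    show "fps_nth G (n + 0) \<noteq> 0" using Gn by simp
    have "summable (\<lambda>j. \<bar>fps_nth G (j + n)\<bar> * s ^ (j + n))"
      using sm by (subst summable_iff_shift)
    then have "summable (\<lambda>j. (\<bar>fps_nth G (j + n)\<bar> * s ^ (j + n)) * (1 / s ^ n))" by (rule summable_mult2)
    then show "summable (\<lambda>j. \<bar>fps_nth G (n + j)\<bar> * s ^ j)"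
      using s by (simp add: power_add add.commute)
    fix h :: real assume h: "\<bar>h\<bar> < s"
    then have "ereal (norm h) < fps_conv_radius G"
      using s(3) by (metis ereal_less_eq(3) less_imp_le order.strict_trans1 real_norm_def)
    then have "(\<lambda>j. fps_nth G j * h ^ j) sums eval_fps G h" by (rule sums_eval_fps)
    then have "(\<lambda>j. fps_nth G (j + n) * h ^ (j + n)) sums (eval_fps G h - (\<Sum>j<n. fps_nth G j * h ^ j))"
      by (rule sums_split_initial_segment)
    moreover have "(\<Sum>j<n. fps_nth G j * h ^ j) = (\<Sum>j\<in>{0}. fps_nth G j * h ^ j)"
      by (rule sum.mono_neutral_right) (use n Gj in auto)
    ultimately show "(\<lambda>j. fps_nth G (n + j) * h ^ (n + j)) sums (g (c + h) - f0)"
      using d(2)[of h] h s(2) G0 by (simp add: add.commute)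
  qed
qed

context response_setting
begin

section \<open>Evaluation along the orbit and time derivatives\<close>

definition ev :: "real \<Rightarrow> (int \<times> int) l1 \<Rightarrow> complex" where
  "ev t = eval_char (\<lambda>p. exp (\<i> * of_real (frq p * t)))"

lemma bounded_linear_ev: "bounded_linear (ev t)"
  unfolding ev_def by (rule bounded_linear_eval_char) simp

lemma norm_ev_le: "norm (ev t x) \<le> norm x"
proof -
  have "norm (ev t x) \<le> (\<Sum>\<^sub>\<infinity>p. norm (coef x p * exp (\<i> * of_real (frq p * t))))"
    unfolding ev_def eval_char_def by (intro norm_infsum_bound eval_char_summable) simp
  then show ?thesis by (simp add: norm_mult norm_l1_def)
qed

lemma ev_power: "ev t (x ^ m) = ev t x ^ m"
  unfolding ev_def by (rule eval_char_power) (auto simp: frq algebra_simps exp_add)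

lemma ev_real:
  assumes "real_l1 x" shows "ev t x = of_real (Re (ev t x))"
proof -
  have c: "cnj (coef x p) = coef x (- p)" for p
    using assms unfolding cnj_twist_def by (metis complex_cnj_cnj mult_1)
  have "cnj (ev t x) = (\<Sum>\<^sub>\<infinity>p. cnj (coef x p * exp (\<i> * of_real (frq p * t))))"
    unfolding ev_def eval_char_def infsum_cnj ..
  also have "\<dots> = (\<Sum>\<^sub>\<infinity>p. coef x (- p) * exp (\<i> * of_real (frq (- p) * t)))"
    by (simp add: c exp_cnj frq)
  also have "\<dots> = (\<Sum>\<^sub>\<infinity>p. coef x p * exp (\<i> * of_real (frq p * t)))"
    by (rule infsum_reindex_bij_witness[where i = uminus and j = uminus]) auto
  finally have "cnj (ev t x) = ev t x" by (simp add: ev_def eval_char_def)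
  then show ?thesis by (metis Reals_cnj_iff of_real_Re)
qed

definition dpow :: "nat \<Rightarrow> (int \<times> int) l1 \<Rightarrow> (int \<times> int) l1" where
  "dpow k x = Abs_l1 (\<lambda>p. (\<i> * frq p) ^ k * coef x p)"

text \<open>Powers of the frequency are absorbed by the exponential weight, through a single term of
  the exponential series. Positive strip width thus yields derivatives of every order.\<close>

lemma coef_dpow:
  assumes "\<rho> > 0" "wsummable (wt \<rho>) x"
  shows "coef (dpow k x) p = (\<i> * frq p) ^ k * coef x p"
proof -
  let ?C = "((1 + \<bar>\<alpha>\<bar>) / \<rho>) ^ k * fact k"
  have "(\<lambda>p. (\<i> * frq p) ^ k * coef x p) abs_summable_on UNIV"
  proof (rule summable_on_comparison_test)
    show "(\<lambda>p. ?C * (norm (coef x p) * wt \<rho> p)) summable_on UNIV"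
      using assms(2) unfolding wsummable_def by (rule summable_on_cmult_right)
    fix p
    have "\<bar>frq p\<bar> \<le> (1 + \<bar>\<alpha>\<bar>) * len p"
    proof -
      have "\<bar>frq p\<bar> \<le> \<bar>real_of_int (fst p)\<bar> + \<bar>\<alpha>\<bar> * \<bar>real_of_int (snd p)\<bar>"
        unfolding frq_def abs_mult[symmetric] by (rule abs_triangle_ineq)
      also have "\<dots> \<le> (1 + \<bar>\<alpha>\<bar>) * len p" by (simp add: len_def algebra_simps)
      finally show ?thesis .
    qed
    then have "\<bar>frq p\<bar> ^ k \<le> ((1 + \<bar>\<alpha>\<bar>) * len p) ^ k" by (rule power_mono) simp
    also have "\<dots> = ?C * ((\<rho> * len p) ^ k / fact k)"
      using assms(1) by (simp add: power_mult_distrib power_divide)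
    also have "\<dots> \<le> ?C * wt \<rho> p"
    proof (rule mult_left_mono)
      have "(\<Sum>j\<in>{k}. (\<rho> * len p) ^ j / fact j) \<le> exp (\<rho> * len p)"
        by (rule finite_sum_le_has_sum[OF exp_has_sum]) (use assms(1) len in auto)
      then show "(\<rho> * len p) ^ k / fact k \<le> wt \<rho> p" by (simp add: wt_def)
    qed (use assms(1) in simp)
    finally show "norm ((\<i> * frq p) ^ k * coef x p) \<le> ?C * (norm (coef x p) * wt \<rho> p)"
      using mult_left_mono[of "\<bar>frq p\<bar> ^ k" "?C * wt \<rho> p" "norm (coef x p)"]
      by (simp add: norm_mult norm_power mult_ac)
  qed auto
  then show ?thesis by (simp add: dpow_def coef_Abs_l1)
qed

lemma ev_dpow_derivative:
  assumes "\<rho> > 0" "wsummable (wt \<rho>) x"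
  shows "((\<lambda>t. Re (ev t (dpow k x))) has_real_derivative Re (ev t (dpow (Suc k) x))) (at t)"
proof -
  have "((\<lambda>t. ev t (dpow k x)) has_vector_derivative ev t (dpow (Suc k) x)) (at t)"
    \<comment> \<open>The derivative two orders higher bounds the quadratic remainder.\<close>
    unfolding ev_def by (rule eval_char_has_derivative[of _ _ _ "dpow (Suc (Suc k)) x"])
      (simp_all add: coef_dpow[OF assms] mult_ac)
  then show ?thesis
    unfolding has_real_derivative_iff_has_vector_derivative
    by (rule bounded_linear.has_vector_derivative[OF bounded_linear_Re])
qed

text \<open>Evaluation along (t, \<alpha> t) is a continuous algebra homomorphism that turns the
  multiplier into d/dt. It maps the coefficient equation to the differential equation, and the power
  series in x to g(c + h) - f0 at the real number h = \<open>Re (ev t x)\<close>.\<close>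

lemma response_solves:
  assumes "\<rho> > 0" "wsummable (wt \<rho>) x" "real_l1 x"
    and sm: "summable (\<lambda>j. \<gamma> j *\<^sub>R x ^ (n + j))"
    and eq: "\<And>p. \<i> * frq p * (1 + \<i> * of_real (\<epsilon> * frq p)) * coef x p = \<epsilon> * (fh p - coef (\<Sum>j. \<gamma> j *\<^sub>R x ^ (n + j)) p)"
    and g: "\<And>h. \<bar>h\<bar> < s \<Longrightarrow> (\<lambda>j. \<gamma> j * h ^ (n + j)) sums (g (c + h) - f0)"
    and f: "\<And>t. ev t fd = of_real (f (t, \<alpha> * t) - f0)"
    and "norm x < s" and A: "\<And>h. \<bar>h\<bar> \<le> norm x \<Longrightarrow> c + h \<in> A"
  shows "is_solution \<epsilon> \<alpha> A g f (\<lambda>t. c + Re (ev t x))"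
proof -
  have d0: "dpow 0 x = x" by (rule l1_eqI) (simp add: coef_dpow[OF assms(1,2)])
  have le: "\<bar>Re (ev t x)\<bar> \<le> norm x" for t
    using abs_Re_le_cmod[of "ev t x"] norm_ev_le[of t x] by linarith
  have l1eq: "dpow 1 x + \<epsilon> *\<^sub>R dpow 2 x = \<epsilon> *\<^sub>R (fd - (\<Sum>j. \<gamma> j *\<^sub>R x ^ (n + j)))"
    by (rule l1_eqI) (use eq in \<open>simp add: coef_dpow[OF assms(1,2)] coef_fd sc algebra_simps power2_eq_square\<close>)
  have ode: "\<epsilon> * Re (ev t (dpow 2 x)) + Re (ev t (dpow 1 x)) + \<epsilon> * g (c + Re (ev t x)) = \<epsilon> * f (t, \<alpha> * t)" for t
  proof -
    interpret ev: bounded_linear "ev t" by (rule bounded_linear_ev)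
    define h where "h = Re (ev t x)"
    have h: "ev t x = of_real h" unfolding h_def by (rule ev_real[OF assms(3)])
    have "\<bar>h\<bar> < s" using le[of t] assms(8) by (simp add: h_def)
    then have "(\<lambda>j. complex_of_real (\<gamma> j * h ^ (n + j))) sums of_real (g (c + h) - f0)"
      by (intro sums_of_real g)
    moreover have "(\<lambda>j. complex_of_real (\<gamma> j * h ^ (n + j))) sums ev t (\<Sum>j. \<gamma> j *\<^sub>R x ^ (n + j))"
      using ev.sums[OF summable_sums[OF sm]] by (simp add: ev.scaleR ev_power h sc)
    ultimately have G: "ev t (\<Sum>j. \<gamma> j *\<^sub>R x ^ (n + j)) = of_real (g (c + h) - f0)"
      by (rule sums_unique2[symmetric])
    have "ev t (dpow 1 x) + \<epsilon> *\<^sub>R ev t (dpow 2 x) = \<epsilon> *\<^sub>R (ev t fd - ev t (\<Sum>j. \<gamma> j *\<^sub>R x ^ (n + j)))"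
      using arg_cong[OF l1eq, of "ev t"] by (simp add: ev.add ev.scaleR ev.diff)
    then have "Re (ev t (dpow 1 x)) + \<epsilon> * Re (ev t (dpow 2 x)) = \<epsilon> * ((f (t, \<alpha> * t) - f0) - (g (c + h) - f0))"
      unfolding G f by (auto simp: complex_eq_iff simp flip: of_real_diff)
    then show ?thesis by (simp add: h_def algebra_simps)
  qed
  show ?thesis
    unfolding is_solution_def
  proof (rule exI[of _ "\<lambda>t. Re (ev t (dpow 1 x))"], rule exI[of _ "\<lambda>t. Re (ev t (dpow 2 x))"], intro allI conjI)
    fix t
    show "c + Re (ev t x) \<in> A" by (rule A[OF le])
    show "((\<lambda>t. c + Re (ev t x)) has_real_derivative Re (ev t (dpow 1 x))) (at t)"
      using DERIV_add[OF DERIV_const[of c] ev_dpow_derivative[OF assms(1,2), of 0 t]] by (simp add: d0)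
    show "((\<lambda>t. Re (ev t (dpow 1 x))) has_real_derivative Re (ev t (dpow 2 x))) (at t)"
      using ev_dpow_derivative[OF assms(1,2), of 1 t] by (simp add: numeral_2_eq_2)
    show "\<epsilon> * Re (ev t (dpow 2 x)) + Re (ev t (dpow 1 x)) + \<epsilon> * g (c + Re (ev t x)) = \<epsilon> * f (t, \<alpha> * t)" by (rule ode)
  qed
qed

lemma trig_sum_ev: "trig_sum (coef x) (of_real t, of_real (\<alpha> * t)) = ev t x"
  by (simp add: trig_sum_def ev_def eval_char_def frq_def algebra_simps)

text \<open>The translates to the corners dominate the exponential weight (\<open>wt_le_wc\<close>),
  so their norms control the sum on the whole closed strip at once.\<close>

lemma norm_trig_sum_le:
  assumes z: "\<And>h p. h \<in> corners \<Longrightarrow> coef (z h) p = wc h p * coef x p"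
  shows "wsummable (wt \<rho>) x"
    and "\<psi> \<in> torus_strip \<rho> \<Longrightarrow> norm (trig_sum (coef x) \<psi>) \<le> (\<Sum>h\<in>corners. norm (z h))"
proof -
  have fin: "finite corners" by (simp add: corners_def)
  have le: "norm (coef x p) * wt \<rho> p \<le> (\<Sum>h\<in>corners. norm (coef (z h) p))" for p
  proof -
    obtain h where h: "h \<in> corners" "wt \<rho> p = norm (wc h p)" by (rule wt_le_wc)
    have "norm (coef x p) * wt \<rho> p = norm (coef (z h) p)" using z[OF h(1)] h(2) by (simp add: norm_mult)
    also have "\<dots> \<le> (\<Sum>h\<in>corners. norm (coef (z h) p))" by (rule member_le_sum) (use h fin in auto)
    finally show ?thesis .
  qed
  have hs: "((\<lambda>p. \<Sum>h\<in>corners. norm (coef (z h) p)) has_sum (\<Sum>h\<in>corners. norm (z h))) UNIV"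
    unfolding norm_l1_def by (intro has_sum_sum has_sum_infsum) (use fin in auto)
  then show w: "wsummable (wt \<rho>) x"
    unfolding wsummable_def using le wt
    by (intro summable_on_comparison_test[OF has_sum_imp_summable[OF hs]]) auto
  assume \<psi>: "\<psi> \<in> torus_strip \<rho>"
  let ?T = "\<lambda>p. coef x p * exp (\<i> * (of_int (fst p) * fst \<psi> + of_int (snd p) * snd \<psi>))"
  have T: "norm (?T p) \<le> norm (coef x p) * wt \<rho> p" for p
    unfolding norm_mult wt_def len_def
    by (intro mult_left_mono norm_exp_strip_le) (use \<psi> in auto)
  have "?T abs_summable_on UNIV"
    by (rule summable_on_comparison_test[OF w[unfolded wsummable_def]]) (use T in auto)
  then have "?T summable_on UNIV" by (rule Infinite_Sum.abs_summable_summable)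
  then have "(?T has_sum trig_sum (coef x) \<psi>) UNIV" unfolding trig_sum_def by (rule has_sum_infsum)
  then show "norm (trig_sum (coef x) \<psi>) \<le> (\<Sum>h\<in>corners. norm (z h))"
    using hs by (rule norm_infsum_le) (use T le order_trans in blast)
qed

lemma trig_sum_diff:
  assumes "wsummable (wt \<rho>) x" "wsummable (wt \<rho>) y" "\<psi> \<in> torus_strip \<rho>"
  shows "trig_sum (coef x) \<psi> - trig_sum (coef y) \<psi> = trig_sum (coef (x - y)) \<psi>"
proof -
  have "(\<lambda>p. coef x p * exp (\<i> * (of_int (fst p) * fst \<psi> + of_int (snd p) * snd \<psi>))) summable_on UNIV"
    if "wsummable (wt \<rho>) x" for x
  proof (rule Infinite_Sum.abs_summable_summable, rule summable_on_comparison_test[OF that[unfolded wsummable_def]])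
    show "norm (coef x p * exp (\<i> * (of_int (fst p) * fst \<psi> + of_int (snd p) * snd \<psi>))) \<le> norm (coef x p) * wt \<rho> p" for p
      unfolding norm_mult wt_def len_def
      by (intro mult_left_mono norm_exp_strip_le) (use assms(3) in auto)
  qed auto
  from has_sum_diff[OF has_sum_infsum[OF this[OF assms(1)]] has_sum_infsum[OF this[OF assms(2)]]]
  show ?thesis
    unfolding trig_sum_def by (intro infsumI[symmetric]) (simp add: left_diff_distrib)
qed

end

section \<open>Existence from a small divisor bound\<close>

text \<open>The coefficients of f are used at decay rate \<xi>/2 and the solution lives at width
  \<xi>/4; two losses of \<sigma> fit in between exactly when 8 \<sigma> < \<xi>.\<close>

lemma response_exists:
  fixes \<alpha> \<xi> f0 c K \<sigma> :: real and A :: "real set" and g :: "real \<Rightarrow> real"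
    and f :: "real \<times> real \<Rightarrow> real" and F :: "complex \<times> complex \<Rightarrow> complex" and n :: nat
  assumes "open A" "real_analytic_on g A" "\<xi> > 0"
    and F: "periodic2_on F (torus_strip \<xi>)" "analytic2_on F (torus_strip \<xi>)"
    and Ff: "\<And>u v :: real. F (of_real u, of_real v) = of_real (f (u, v))"
    and f0: "f0 = torus_mean f" and "c \<in> A" and n: "odd n" "n > 1" and zero: "zero_of_order g f0 c n"
    and K: "K > 0" and \<sigma>: "\<sigma> \<ge> 0" "8 * \<sigma> < \<xi>"
    and div: "\<And>j k. (j, k) \<noteq> (0, 0) \<Longrightarrow>
      exp (- \<sigma> * (\<bar>real_of_int j\<bar> + \<bar>real_of_int k\<bar>)) \<le> K * \<bar>of_int j + \<alpha> * of_int k\<bar>"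
  shows "\<exists>\<epsilon>0>0. \<exists>X :: real \<Rightarrow> complex \<times> complex \<Rightarrow> complex.
    (\<forall>\<epsilon>\<in>{0<..<\<epsilon>0}.
      (\<exists>x. is_solution \<epsilon> \<alpha> A g f x \<and>
        (\<forall>t. of_real (x t) = of_real c + X \<epsilon> (of_real t, of_real (\<alpha> * t)))) \<and>
      (\<forall>\<xi>'. \<xi>' < \<xi> / 4 \<longrightarrow> periodic2_on (X \<epsilon>) (torus_strip \<xi>') \<and> analytic2_on (X \<epsilon>) (torus_strip \<xi>') \<and>
        uniform_limit (torus_strip \<xi>') X (X \<epsilon>) (at \<epsilon> within {0<..<\<epsilon>0}))) \<and>
    (\<forall>\<xi>'. \<xi>' < \<xi> / 4 \<longrightarrow> uniform_limit (torus_strip \<xi>') X (\<lambda>_. 0) (at_right 0))"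
proof -
  interpret F: periodic_holomorphic2 F \<xi>
    by (rule analytic2_on_periodic_holomorphic2) (rule assms)+
  have e: "0 < \<xi> / 2" "\<xi> / 2 < \<xi>" using assms(3) by auto
  obtain B where B: "B \<ge> 0" "\<And>a b. Re a \<in> {0..2 * pi} \<Longrightarrow> Re b \<in> {0..2 * pi} \<Longrightarrow> \<bar>Im a\<bar> \<le> \<xi> / 2 \<Longrightarrow> \<bar>Im b\<bar> \<le> \<xi> / 2 \<Longrightarrow> norm (F (a, b)) \<le> B"
    using F.bounded_on_strip[OF less_imp_le[OF e(1)] e(2)] by blast
  define fh where "fh = (\<lambda>p. if p = 0 then 0 else fourier_coeff2 F p)"
  have mean: "fourier_coeff2 F 0 = of_real f0"
    using F.fourier_coeff2_0[OF Ff] f0 by (simp add: zero_prod_def)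
  have series: "((\<lambda>p. fh p * exp (\<i> * (of_int (fst p) * of_real u + of_int (snd p) * of_real v))) has_sum of_real (f (u, v) - f0)) UNIV" for u v
  proof -
    have "((\<lambda>p. if p = 0 then of_real f0 else 0) has_sum complex_of_real f0) {0 :: int \<times> int}"
      by (simp add: has_sum_finite_iff)
    then have "((\<lambda>p. if p = 0 then of_real f0 else 0) has_sum complex_of_real f0) (UNIV :: (int \<times> int) set)"
      by (rule has_sum_cong_neutral[THEN iffD1, rotated -1]) auto
    from has_sum_diff[OF F.fourier_series2[OF e B, of u v] this]
    show ?thesis unfolding Ff of_real_diff
      by (rule has_sum_cong[THEN iffD1, rotated]) (auto simp: fh_def mean)
  qed
  show ?thesis
  proof (cases "\<exists>p. fh p \<noteq> 0")
    \<comment> \<open>All oscillating coefficients vanish, so f is the constant f0 and c is an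
      equilibrium; X = 0.\<close>
    case False
    have z: "fh p = 0" for p using False by blast
    have "f (u, v) = f0" for u v
    proof -
      have "((\<lambda>p::int \<times> int. 0 :: complex) has_sum of_real (f (u, v) - f0)) UNIV"
        using series[of u v] unfolding z mult_zero_left .
      then have "complex_of_real (f (u, v) - f0) = 0" by (rule has_sum_unique) simp
      then show ?thesis by (simp add: complex_eq_iff)
    qed
    moreover have "g c = f0" using zero by (simp add: zero_of_order_def)
    ultimately have sol: "is_solution \<epsilon> \<alpha> A g f (\<lambda>_. c)" for \<epsilon>
      unfolding is_solution_def using \<open>c \<in> A\<close> by (intro exI[of _ "\<lambda>_. 0"]) auto
    have an: "analytic2_on (\<lambda>_. 0 :: complex) S" for S
      unfolding analytic2_on_def by (auto intro!: exI[of _ 1] exI[of _ "\<lambda>_ _. 0"] simp: case_prod_unfold)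
    show ?thesis
      by (rule exI[of _ 1], intro conjI exI[of _ "\<lambda>_ _. 0"] ballI allI impI)
         (auto simp: periodic2_on_def an uniform_limit_const intro!: exI[of _ "\<lambda>_. c"] sol)
  next
    case True
    obtain \<gamma> :: "nat \<Rightarrow> real" and s where s: "s > 0" and \<gamma>0: "\<gamma> 0 \<noteq> 0" and \<gamma>: "summable (\<lambda>j. \<bar>\<gamma> j\<bar> * s ^ j)"
      and g: "\<And>h. \<bar>h\<bar> < s \<Longrightarrow> (\<lambda>j. \<gamma> j * h ^ (n + j)) sums (g (c + h) - f0)"
      by (rule zero_of_order_expansion[OF assms(2) \<open>c \<in> A\<close> zero]) (use n in auto)
    interpret response_setting \<alpha> K \<sigma> "\<xi> / 2" "\<xi> / 4" s B n \<gamma> fh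
    proof
      show "exp (- \<sigma> * (\<bar>real_of_int (fst p)\<bar> + \<bar>real_of_int (snd p)\<bar>)) \<le> K * \<bar>of_int (fst p) + \<alpha> * of_int (snd p)\<bar>"
        if "p \<noteq> 0" for p
        using div[of "fst p" "snd p"] that by (simp add: prod_eq_iff)
      show "norm (fh p) \<le> B * exp (- (\<xi> / 2) * (\<bar>real_of_int (fst p)\<bar> + \<bar>real_of_int (snd p)\<bar>))" for p
        using F.fourier_coeff2_bound[OF e B, of "fst p" "snd p"] B(1) by (simp add: fh_def)
      show "fh (- p) = cnj (fh p)" for p
        using F.fourier_coeff2_cnj[of p] Ff by (simp add: fh_def)
    qed (use assms n s \<gamma> \<gamma>0 True in \<open>auto simp: fh_def\<close>)
    obtain \<epsilon>0 M X Z where \<epsilon>0: "\<epsilon>0 > 0"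
      and X: "\<And>\<epsilon>. 0 < \<epsilon> \<Longrightarrow> \<epsilon> < \<epsilon>0 \<Longrightarrow> real_l1 (X \<epsilon>)"
        "\<And>\<epsilon>. 0 < \<epsilon> \<Longrightarrow> \<epsilon> < \<epsilon>0 \<Longrightarrow> summable (\<lambda>j. \<gamma> j *\<^sub>R X \<epsilon> ^ (n + j))"
        "\<And>\<epsilon> p. 0 < \<epsilon> \<Longrightarrow> \<epsilon> < \<epsilon>0 \<Longrightarrow> \<i> * frq p * (1 + \<i> * of_real (\<epsilon> * frq p)) * coef (X \<epsilon>) p
          = \<epsilon> * (fh p - coef (\<Sum>j. \<gamma> j *\<^sub>R X \<epsilon> ^ (n + j)) p)"
        "\<And>\<epsilon>. 0 < \<epsilon> \<Longrightarrow> \<epsilon> < \<epsilon>0 \<Longrightarrow> norm (X \<epsilon>) \<le> \<epsilon> * M"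
      and Z: "\<And>\<epsilon> h p. 0 < \<epsilon> \<Longrightarrow> \<epsilon> < \<epsilon>0 \<Longrightarrow> h \<in> corners \<Longrightarrow> coef (Z h \<epsilon>) p = wc h p * coef (X \<epsilon>) p"
        "\<And>\<epsilon> h. 0 < \<epsilon> \<Longrightarrow> \<epsilon> < \<epsilon>0 \<Longrightarrow> h \<in> corners \<Longrightarrow> norm (Z h \<epsilon>) \<le> \<epsilon> * M"
        "\<And>h. h \<in> corners \<Longrightarrow> continuous_on {0<..<\<epsilon>0} (Z h)"
    proof (rule response_branch, goal_cases)
      case (1 \<epsilon>0 M X Z)
      show ?thesis by (rule that[of \<epsilon>0 X M Z]) (fact 1)+
    qed
    obtain d where d: "d > 0" "\<And>h. \<bar>h\<bar> < d \<Longrightarrow> c + h \<in> A"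
    proof -
      obtain d where "d > 0" "ball c d \<subseteq> A" using \<open>open A\<close> \<open>c \<in> A\<close> by (auto simp: open_contains_ball)
      then show ?thesis by (intro that[of d]) (auto simp: subset_iff dist_real_def)
    qed
    \<comment> \<open>Keeps c + X where the expansion of g holds and inside A. The added 1 guards
      against M = 0.\<close>
    define \<epsilon>2 where "\<epsilon>2 = min \<epsilon>0 (min s d / (\<bar>M\<bar> + 1))"
    have \<epsilon>2: "\<epsilon>2 > 0" "\<epsilon>2 \<le> \<epsilon>0" using \<epsilon>0 s d by (auto simp: \<epsilon>2_def)
    have Xs: "norm (X \<epsilon>) < min s d" if "0 < \<epsilon>" "\<epsilon> < \<epsilon>2" for \<epsilon>
    proof -
      have "norm (X \<epsilon>) \<le> \<epsilon> * M" using X(4) that \<epsilon>2 by auto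
      also have "\<dots> \<le> \<epsilon> * (\<bar>M\<bar> + 1)" using that by (intro mult_left_mono) auto
      also have "\<dots> < min s d"
      proof -
        have "\<epsilon> < min s d / (\<bar>M\<bar> + 1)" using that by (simp only: \<epsilon>2_def min_less_iff_conj)
        then show ?thesis by (subst (asm) pos_less_divide_eq) auto
      qed
      finally show ?thesis .
    qed
    have ws: "wsummable (wt (\<xi> / 4)) (X \<epsilon>)" if "0 < \<epsilon>" "\<epsilon> < \<epsilon>2" for \<epsilon>
      by (rule norm_trig_sum_le(1)[where z = "\<lambda>h. Z h \<epsilon>"]) (use Z(1) that \<epsilon>2 in auto)
    have evfd: "ev t fd = of_real (f (t, \<alpha> * t) - f0)" for t
      using infsumI[OF series[of t "\<alpha> * t"]] by (simp add: ev_def eval_char_def coef_fd frq_def algebra_simps)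
    have mono: "torus_strip \<xi>' \<subseteq> torus_strip (\<xi> / 4)" if "\<xi>' < \<xi> / 4" for \<xi>'
      using that by (auto simp: torus_strip_def)
    let ?X = "\<lambda>\<epsilon>. trig_sum (coef (X \<epsilon>))"
    show ?thesis
    proof (rule exI[of _ \<epsilon>2], intro conjI exI[of _ ?X] ballI allI impI)
      show "\<epsilon>2 > 0" by (rule \<epsilon>2)
      fix \<epsilon> assume "\<epsilon> \<in> {0<..<\<epsilon>2}"
      then have \<epsilon>: "0 < \<epsilon>" "\<epsilon> < \<epsilon>2" "\<epsilon> < \<epsilon>0" using \<epsilon>2 by auto
      show "\<exists>x. is_solution \<epsilon> \<alpha> A g f x \<and> (\<forall>t. of_real (x t) = of_real c + ?X \<epsilon> (of_real t, of_real (\<alpha> * t)))"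
      proof (intro exI[of _ "\<lambda>t. c + Re (ev t (X \<epsilon>))"] conjI allI)
        show "is_solution \<epsilon> \<alpha> A g f (\<lambda>t. c + Re (ev t (X \<epsilon>)))"
          by (rule response_solves[OF _ ws[OF \<epsilon>(1,2)] X(1)[OF \<epsilon>(1,3)] X(2)[OF \<epsilon>(1,3)] X(3)[OF \<epsilon>(1,3)] g evfd])
             (use assms(3) Xs[OF \<epsilon>(1,2)] d in auto)
        show "of_real (c + Re (ev t (X \<epsilon>))) = of_real c + ?X \<epsilon> (of_real t, of_real (\<alpha> * t))" for t
          unfolding trig_sum_ev using ev_real[OF X(1)[OF \<epsilon>(1,3)], of t] by simp
      qed
      fix \<xi>' assume \<xi>': "\<xi>' < \<xi> / 4"
      show "periodic2_on (?X \<epsilon>) (torus_strip \<xi>')" by (rule trig_sum_periodic)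
      show "analytic2_on (?X \<epsilon>) (torus_strip \<xi>')"
        by (rule trig_sum_analytic[OF _ \<xi>']) (use ws[OF \<epsilon>(1,2)] in \<open>simp add: wsummable_def wt_def len_def\<close>)
      show "uniform_limit (torus_strip \<xi>') ?X (?X \<epsilon>) (at \<epsilon> within {0<..<\<epsilon>2})"
      proof (rule uniform_limitI)
        fix r :: real assume r: "r > 0"
        have "((\<lambda>\<delta>. \<Sum>h\<in>corners. norm (Z h \<delta> - Z h \<epsilon>)) \<longlongrightarrow> (\<Sum>h\<in>corners. norm (Z h \<epsilon> - Z h \<epsilon>))) (at \<epsilon> within {0<..<\<epsilon>2})"
        proof (intro tendsto_intros)
          fix h assume h: "h \<in> corners"
          have "continuous_on {0<..<\<epsilon>2} (Z h)" using Z(3)[OF h] by (rule continuous_on_subset) (use \<epsilon>2 in auto)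
          then show "(Z h \<longlongrightarrow> Z h \<epsilon>) (at \<epsilon> within {0<..<\<epsilon>2})" using \<epsilon> by (auto simp: continuous_on_def)
        qed
        then have "\<forall>\<^sub>F \<delta> in at \<epsilon> within {0<..<\<epsilon>2}. (\<Sum>h\<in>corners. norm (Z h \<delta> - Z h \<epsilon>)) < r"
          using r by (intro order_tendstoD) auto
        moreover have "\<forall>\<^sub>F \<delta> in at \<epsilon> within {0<..<\<epsilon>2}. \<delta> \<in> {0<..<\<epsilon>2}"
          by (simp add: eventually_at_filter)
        ultimately show "\<forall>\<^sub>F \<delta> in at \<epsilon> within {0<..<\<epsilon>2}. \<forall>\<psi>\<in>torus_strip \<xi>'. dist (?X \<delta> \<psi>) (?X \<epsilon> \<psi>) < r"
        proof eventually_elim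
          case (elim \<delta>)
          show ?case
          proof
            fix \<psi> assume "\<psi> \<in> torus_strip \<xi>'"
            then have \<psi>: "\<psi> \<in> torus_strip (\<xi> / 4)" using mono[OF \<xi>'] by auto
            have "?X \<delta> \<psi> - ?X \<epsilon> \<psi> = trig_sum (coef (X \<delta> - X \<epsilon>)) \<psi>"
              by (rule trig_sum_diff[OF ws ws \<psi>]) (use elim \<epsilon> in auto)
            moreover have "norm \<dots> \<le> (\<Sum>h\<in>corners. norm (Z h \<delta> - Z h \<epsilon>))"
              by (rule norm_trig_sum_le(2)[OF _ \<psi>]) (use Z(1) elim \<epsilon> \<epsilon>2 in \<open>simp add: right_diff_distrib\<close>)
            ultimately show "dist (?X \<delta> \<psi>) (?X \<epsilon> \<psi>) < r" using elim(1) by (simp add: dist_norm)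
          qed
        qed
      qed
    next
      fix \<xi>' assume \<xi>': "\<xi>' < \<xi> / 4"
      show "uniform_limit (torus_strip \<xi>') ?X (\<lambda>_. 0) (at_right 0)"
      proof (rule uniform_limitI)
        fix r :: real assume r: "r > 0"
        have "((\<lambda>\<delta>. real (card corners) * (\<delta> * M)) \<longlongrightarrow> real (card corners) * (0 * M)) (at_right 0)"
          by (intro tendsto_intros)
        then have "\<forall>\<^sub>F \<delta> in at_right 0. real (card corners) * (\<delta> * M) < r"
          using r by (intro order_tendstoD) auto
        moreover have "\<forall>\<^sub>F \<delta> in at_right 0. \<delta> \<in> {0<..<\<epsilon>2}"
          by (rule eventually_at_right_real[OF \<epsilon>2(1)])
        ultimately show "\<forall>\<^sub>F \<delta> in at_right 0. \<forall>\<psi>\<in>torus_strip \<xi>'. dist (?X \<delta> \<psi>) 0 < r"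
        proof eventually_elim
          case (elim \<delta>)
          show ?case
          proof
            fix \<psi> assume "\<psi> \<in> torus_strip \<xi>'"
            then have \<psi>: "\<psi> \<in> torus_strip (\<xi> / 4)" using mono[OF \<xi>'] by auto
            have "norm (?X \<delta> \<psi>) \<le> (\<Sum>h\<in>corners. norm (Z h \<delta>))"
              by (rule norm_trig_sum_le(2)[OF _ \<psi>]) (use Z(1) elim \<epsilon>2 in auto)
            also have "\<dots> \<le> (\<Sum>h\<in>corners. \<delta> * M)" by (rule sum_mono) (use Z(2) elim \<epsilon>2 in auto)
            finally show "dist (?X \<delta> \<psi>) 0 < r" using elim(1) by simp
          qed
        qed
      qed
    qed
  qed
qed

section \<open>Choice of the constants\<close>

text \<open>Introduces all three quantified constants of the theorem at once and leaves a goal in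
  which the last two are already replaced by the powers.\<close>

lemma ex_powr_constants:
  fixes \<eta> :: real
  assumes "\<eta> > 0" "Q (\<eta> powr u) (\<eta> powr v)"
  shows "\<exists>\<eta>>0. \<exists>a b :: real. a = \<eta> powr u \<and> b = \<eta> powr v \<and> Q a b"
  using assms by blast

text \<open>\<eta>0 must be fixed before N, whereas the small divisor constant, and with it the
  threshold for \<epsilon>, depends on where the bound on the denominators sets in. A case
  distinction on that bound with b0 = 1 breaks the circle: if it holds from no index on, \<eta>0 = 1
  leaves no admissible N; otherwise an index N0 supplies the divisor constant, one branch of
  solutions serves all N, and \<eta>0 is chosen after it.\<close>

theorem theorem3:
  fixes \<alpha> \<xi> f0 c C0 :: real
    and A :: "real set"
    and g :: "real \<Rightarrow> real"
    and f :: "real \<times> real \<Rightarrow> real"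
    and F :: "complex \<times> complex \<Rightarrow> complex"
    and n :: nat
  assumes "\<alpha> \<notin> \<rat>"
    and "open A"
    and "real_analytic_on g A"
    and "periodic2_on f UNIV"
    and "analytic2_on f UNIV"
    and "\<xi> > 0"
    and "periodic2_on F (torus_strip \<xi>)"
    and "analytic2_on F (torus_strip \<xi>)"
    and "\<And>u v :: real. F (of_real u, of_real v) = of_real (f (u, v))"
    and "f0 = torus_mean f"
    and "c \<in> A"
    and "odd n"
    and "n > 1"
    and "zero_of_order g f0 c n"
    and "C0 = (real n + 1) / (4 * ((real n)\<^sup>2 + 2 * real n - 1)) * \<xi>"
  shows "\<exists>\<eta>0>0. \<exists>a0 b0 :: real.
    a0 = \<eta>0 powr (1 / (real n + 1)) \<and> b0 = \<eta>0 powr (1 / (real n * (real n + 1))) \<and>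
    (\<forall>N. (\<forall>x::real. x \<ge> cf_denom \<alpha> N \<longrightarrow> exp (- C0 * x) \<le> a0 / x ^ n) \<longrightarrow>
         (\<forall>k\<ge>N. cf_denom \<alpha> (Suc k) \<le> b0 * exp (C0 / real n * cf_denom \<alpha> k)) \<longrightarrow>
         (\<exists>X :: real \<Rightarrow> complex \<times> complex \<Rightarrow> complex.
            (\<forall>\<epsilon>\<in>{0<..<a0 / cf_denom \<alpha> N ^ n}.
               (\<exists>x. is_solution \<epsilon> \<alpha> A g f x \<and>
                    (\<forall>t. of_real (x t) = of_real c + X \<epsilon> (of_real t, of_real (\<alpha> * t)))) \<and>
               (\<forall>\<xi>'. 0 < \<xi>' \<and> \<xi>' < \<xi> / 4 \<longrightarrow>
                    periodic2_on (X \<epsilon>) (torus_strip \<xi>') \<and>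
                    analytic2_on (X \<epsilon>) (torus_strip \<xi>') \<and>
                    uniform_limit (torus_strip \<xi>') X (X \<epsilon>)
                      (at \<epsilon> within {0<..<a0 / cf_denom \<alpha> N ^ n}))) \<and>
            (\<forall>\<xi>'. 0 < \<xi>' \<and> \<xi>' < \<xi> / 4 \<longrightarrow>
               uniform_limit (torus_strip \<xi>') X (\<lambda>_. 0) (at_right 0))))"
proof (cases "\<exists>N. \<forall>k\<ge>N. cf_denom \<alpha> (Suc k) \<le> exp (C0 / real n * cf_denom \<alpha> k)")
  case False
  show ?thesis
  \<comment> \<open>With \<eta>0 = 1 also b0 = 1, and the hypothesis on N is exactly what the case
    excludes.\<close>
  proof (rule ex_powr_constants[of 1], goal_cases)
    case 2
    show ?case
    proof (intro allI impI, goal_cases)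
      case (1 N)
      then have "\<forall>k\<ge>N. cf_denom \<alpha> (Suc k) \<le> exp (C0 / real n * cf_denom \<alpha> k)" by simp
      then show ?case using False by blast
    qed
  qed simp
next
  case True
  then obtain N0 where N0: "\<And>k. k \<ge> N0 \<Longrightarrow> cf_denom \<alpha> (Suc k) \<le> exp (C0 / real n * cf_denom \<alpha> k)" by blast
  define \<sigma> where "\<sigma> = C0 / real n"
  have n3: "real n \<ge> 3" using assms(12,13) by (cases "n = 2") auto
  \<comment> \<open>C0 is at most \<xi>/4 and n is at least 3, so \<sigma> is at most
    \<xi>/12.\<close>
  have \<sigma>: "\<sigma> \<ge> 0" "8 * \<sigma> < \<xi>"
  proof -
    define q where "q = (real n)\<^sup>2 + 2 * real n - 1"
    have "3 * real n \<le> real n * real n" using n3 by (intro mult_right_mono) auto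
    then have q: "q \<ge> real n + 1" using n3 unfolding q_def power2_eq_square by linarith
    then have r: "0 \<le> (real n + 1) / q" "(real n + 1) / q \<le> 1" using n3 by (auto simp: divide_le_eq_1)
    have C0: "C0 = (real n + 1) / q * (\<xi> / 4)" by (simp add: assms(15) q_def)
    have C: "0 \<le> C0" "C0 \<le> \<xi> / 4"
      unfolding C0 using mult_right_mono[OF r(2), of "\<xi> / 4"] mult_nonneg_nonneg[OF r(1), of "\<xi> / 4"] assms(6)
      by linarith+
    then show "\<sigma> \<ge> 0" by (simp add: \<sigma>_def)
    have "8 * C0 < \<xi> * real n" using C assms(6) n3 mult_left_mono[of 3 "real n" \<xi>] by linarith
    then show "8 * \<sigma> < \<xi>" using n3 by (simp add: \<sigma>_def field_simps)
  qed
  obtain K where K: "K > 0" "\<And>j k. (j, k) \<noteq> (0, 0) \<Longrightarrow>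
      exp (- \<sigma> * (\<bar>real_of_int j\<bar> + \<bar>real_of_int k\<bar>)) \<le> K * \<bar>of_int j + \<alpha> * of_int k\<bar>"
  proof (rule cf_small_divisor[OF assms(1) \<sigma>(1), of N0], goal_cases)
    case (1 k)
    then show ?case using N0 by (simp add: \<sigma>_def)
  next
    case (2 K)
    show ?thesis by (rule that[of K]) (fact 2)+
  qed
  obtain \<epsilon>0 and X :: "real \<Rightarrow> complex \<times> complex \<Rightarrow> complex" where \<epsilon>0: "\<epsilon>0 > 0"
    and X1: "\<And>\<epsilon>. \<epsilon> \<in> {0<..<\<epsilon>0} \<Longrightarrow> \<exists>x. is_solution \<epsilon> \<alpha> A g f x \<and>
        (\<forall>t. of_real (x t) = of_real c + X \<epsilon> (of_real t, of_real (\<alpha> * t)))"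
    and X2: "\<And>\<epsilon> \<xi>'. \<epsilon> \<in> {0<..<\<epsilon>0} \<Longrightarrow> \<xi>' < \<xi> / 4 \<Longrightarrow> periodic2_on (X \<epsilon>) (torus_strip \<xi>')"
      "\<And>\<epsilon> \<xi>'. \<epsilon> \<in> {0<..<\<epsilon>0} \<Longrightarrow> \<xi>' < \<xi> / 4 \<Longrightarrow> analytic2_on (X \<epsilon>) (torus_strip \<xi>')"
      "\<And>\<epsilon> \<xi>'. \<epsilon> \<in> {0<..<\<epsilon>0} \<Longrightarrow> \<xi>' < \<xi> / 4 \<Longrightarrow> uniform_limit (torus_strip \<xi>') X (X \<epsilon>) (at \<epsilon> within {0<..<\<epsilon>0})"
    and X3: "\<And>\<xi>'. \<xi>' < \<xi> / 4 \<Longrightarrow> uniform_limit (torus_strip \<xi>') X (\<lambda>_. 0) (at_right 0)"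
    using response_exists[OF assms(2,3,6-14) K(1) \<sigma> K(2)] by blast
  \<comment> \<open>As the denominators are at least 1, \<open>a \<le> \<epsilon>0\<close> places
    every admissible \<epsilon> in the interval of the branch.\<close>
  define a where "a = min 1 \<epsilon>0"
  have a: "0 < a" "a \<le> 1" "a \<le> \<epsilon>0" using \<epsilon>0 by (auto simp: a_def)
  show ?thesis
  \<comment> \<open>This \<eta>0 makes a0 equal to a.\<close>
  proof (rule ex_powr_constants[of "a powr (real n + 1)"], goal_cases)
    case 2
    have pow: "(a powr (real n + 1)) powr (1 / (real n + 1)) = a" using a by (simp add: powr_powr)
    show ?case
      unfolding pow
    proof (intro allI impI exI[of _ X] conjI ballI)
      fix N
      have "1 \<le> real_of_int (cf_denom \<alpha> N)" using cf_denom_ge_1[OF assms(1), of N] by simp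
      then have "1 \<le> real_of_int (cf_denom \<alpha> N) ^ n" by simp
      then have "a / real_of_int (cf_denom \<alpha> N) ^ n \<le> a / 1" using a by (intro divide_left_mono) auto
      then have sub: "{0<..<a / cf_denom \<alpha> N ^ n} \<subseteq> {0<..<\<epsilon>0}" using a by auto
      fix \<epsilon> assume "\<epsilon> \<in> {0<..<a / cf_denom \<alpha> N ^ n}"
      then have \<epsilon>: "\<epsilon> \<in> {0<..<\<epsilon>0}" using sub by blast
      show "\<exists>x. is_solution \<epsilon> \<alpha> A g f x \<and> (\<forall>t. of_real (x t) = of_real c + X \<epsilon> (of_real t, of_real (\<alpha> * t)))"
        by (rule X1[OF \<epsilon>])
      fix \<xi>' assume "0 < \<xi>' \<and> \<xi>' < \<xi> / 4"
      then have \<xi>': "\<xi>' < \<xi> / 4" by simp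
      show "periodic2_on (X \<epsilon>) (torus_strip \<xi>')" "analytic2_on (X \<epsilon>) (torus_strip \<xi>')" by (rule X2[OF \<epsilon> \<xi>'])+
      show "uniform_limit (torus_strip \<xi>') X (X \<epsilon>) (at \<epsilon> within {0<..<a / cf_denom \<alpha> N ^ n})"
        using X2(3)[OF \<epsilon> \<xi>'] by (rule filterlim_mono[OF _ order.refl at_le[OF sub]])
    next
      show "uniform_limit (torus_strip \<xi>') X (\<lambda>_. 0) (at_right 0)" if "0 < \<xi>' \<and> \<xi>' < \<xi> / 4" for \<xi>'
        using X3 that by simp
    qed
  qed (use a in simp)
qed

end
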